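(* Let $\mathcal{K}(x)=e^{-|x|}/2$ and $d>0$. Let $f:\mathbb{R}\to\mathbb{R}$ be smooth and assume there is $a\in(0,1)$ such that $f(0)=f(a)=f(1)=0$, $f<0$ on $(0,a)$, $f>0$ on $(a,1)$, $f'(0)<0$, $f'(1)<0$, $f'(a)>0$ and $\int_0^1 f(u)\,\mathrm{d}u>0$. Let $g(u):=u-\frac{f(u)}{d}$ and assume that there exist $0<\beta<\gamma<1$ such that $g'>0$ on $[0,\beta)\cup(\gamma,1]$, $g'<0$ on $(\beta,\gamma)$ and $g'(\beta)=g'(\gamma)=0$. With $\mathcal{G}_\pm$ as defined in the context, assume $\mathcal{G}_-(g(\beta))=0$. Then there exists a one-parameter family of discontinuous ground states $U$, indexed by $v_0\in[g(\gamma),g(\beta)]$ with $v_0>0$, given by $$U(x)=\begin{cases}g_-^{-1}(V_-(x)),&|x|>x_0,\\ g_+^{-1}(V_+(x)),&|x|<x_0,\end{cases}$$ (with $x_0=x_0(v_0)$ and $V_\pm$ as in the context), which are even, positive, with precisely two points of jump discontinuity and smooth otherwise, together with an even, positive ground state which is smooth on $(-\infty,0)\cup(0,+\infty)$ and continuous at the origin. Furthermore, there is no other ground state.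
   Context: A ground state is a bounded function $U\in L^2(\mathbb{R})$, possibly discontinuous, with $0=d(-U+\mathcal{K}*U)+f(U)$ on $\mathbb{R}$, $U(\pm\infty)=0$ and $U>0$ on $\mathbb{R}$; by convention only even ground states are considered. $g_-^{-1}$ denotes the inverse of $g$ restricted to $[0,\beta]$ (defined on $[0,g(\beta)]$) and $g_+^{-1}$ the inverse of $g$ restricted to $[\gamma,1]$ (defined on $[g(\gamma),1]$). Set $$\mathcal{G}_-(V):=-\tfrac12V^2+\int_0^Vg_-^{-1}(w)\,\mathrm{d}w,\quad V\in[0,g(\beta)],\qquad \mathcal{G}_+(V):=-\tfrac12V^2-\int_V^1g_+^{-1}(w)\,\mathrm{d}w,\quad V\in[g(\gamma),1].$$ For $v_0\in[g(\gamma),g(\beta)]$ with $v_0>0$, $v_*>v_0$ satisfies $\mathcal{G}_+(v_* )=\mathcal{G}_+(v_0)-\mathcal{G}_-(v_0)$ and $\mathcal{G}_+(v_0)-\mathcal{G}_-(v_0)-\mathcal{G}_+(v)>0$ for all $v\in(v_0,v_* )$, and $$x_0=\int_{v_0}^{v_*}\frac{\mathrm{d}v}{\sqrt{2(\mathcal{G}_+(v_0)-\mathcal{G}_-(v_0)-\mathcal{G}_+(v))}}>0.$$ $V_+$ is the even solution of $V-V''=g_+^{-1}(V)$ on $[-x_0,x_0]$ with $\tfrac12(V_+')^2+\mathcal{G}_+(V_+)=\mathcal{G}_+(v_0)-\mathcal{G}_-(v_0)$, $V_+(0)=v_*$, $V_+(\pm x_0)=v_0$. $V_-$ is the even solution of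 $V-V''=g_-^{-1}(V)$ on $\{|x|\ge x_0\}$ with $\tfrac12(V_-')^2+\mathcal{G}_-(V_-)=0$, $V_-(\pm x_0)=v_0$, $V_-(\pm\infty)=0$. They satisfy $V_-'(\pm x_0)=V_+'(\pm x_0)=\mp\sqrt{-2\mathcal{G}_-(v_0)}$.
   Formalization: The family is obtained for v_0<g(β) only (no v_* exists at v_0=g(β)); "no other ground state" is proved, up to null sets, among ground states that are continuous or have values in [0,β]∪[γ,1] and at most two discontinuities, as it fails otherwise (e.g. using the middle branch of g). *)

theory Defs
  imports "HOL-Analysis.Analysis"
begin

text \<open>Infinite differentiability; meant for open \<open>S\<close>, where the derivatives are two-sided.\<close>

definition smooth_on :: "real set \<Rightarrow> (real \<Rightarrow> real) \<Rightarrow> bool" where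
  "smooth_on S f \<longleftrightarrow> (\<forall>n. \<forall>x\<in>S. (deriv ^^ n) f differentiable (at x))"

definition jump_at :: "(real \<Rightarrow> real) \<Rightarrow> real \<Rightarrow> bool" where
  "jump_at U x \<longleftrightarrow>
     (\<exists>l r. (U \<longlongrightarrow> l) (at_left x) \<and> (U \<longlongrightarrow> r) (at_right x) \<and> l \<noteq> r)"

definition exp_kernel :: "real \<Rightarrow> real" where
  "exp_kernel x = exp (- \<bar>x\<bar>) / 2"

definition convolve :: "(real \<Rightarrow> real) \<Rightarrow> (real \<Rightarrow> real) \<Rightarrow> real \<Rightarrow> real" where
  "convolve K U x = (LINT y|lebesgue. K (x - y) * U y)"

text \<open>The conditions \<open>U \<in> borel_measurable lebesgue\<close> and integrability of the square say that \<open>U\<close>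
  is in \<open>L\<^sup>2(\<real>)\<close>. Evenness is part of the notion, as only even ground states are considered.\<close>

definition ground_state ::
  "(real \<Rightarrow> real) \<Rightarrow> real \<Rightarrow> (real \<Rightarrow> real) \<Rightarrow> (real \<Rightarrow> real) \<Rightarrow> bool" where
  "ground_state K d f U \<longleftrightarrow>
     bounded (range U) \<and>
     U \<in> borel_measurable lebesgue \<and> integrable lebesgue (\<lambda>x. (U x)\<^sup>2) \<and>
     (\<forall>x. 0 = d * (- U x + convolve K U x) + f (U x)) \<and>
     (U \<longlongrightarrow> 0) at_top \<and> (U \<longlongrightarrow> 0) at_bot \<and>
     (\<forall>x. U x > 0) \<and>
     (\<forall>x. U (- x) = U x)"

definition g_minus_inv :: "(real \<Rightarrow> real) \<Rightarrow> real \<Rightarrow> real \<Rightarrow> real" where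
  "g_minus_inv g \<beta> = inv_into {0..\<beta>} g"

definition g_plus_inv :: "(real \<Rightarrow> real) \<Rightarrow> real \<Rightarrow> real \<Rightarrow> real" where
  "g_plus_inv g \<gamma> = inv_into {\<gamma>..1} g"

definition G_minus :: "(real \<Rightarrow> real) \<Rightarrow> real \<Rightarrow> real \<Rightarrow> real" where
  "G_minus g \<beta> V = - V\<^sup>2 / 2 + integral {0..V} (g_minus_inv g \<beta>)"

definition G_plus :: "(real \<Rightarrow> real) \<Rightarrow> real \<Rightarrow> real \<Rightarrow> real" where
  "G_plus g \<gamma> V = - V\<^sup>2 / 2 - integral {V..1} (g_plus_inv g \<gamma>)"

text \<open>\<open>V\<close> solves \<open>V - V'' = h(V)\<close> on \<open>S\<close> with derivative \<open>V'\<close>; derivatives are one-sided at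
  boundary points of \<open>S\<close>.\<close>

definition solves_on ::
  "real set \<Rightarrow> (real \<Rightarrow> real) \<Rightarrow> (real \<Rightarrow> real) \<Rightarrow> (real \<Rightarrow> real) \<Rightarrow> bool" where
  "solves_on S h V V' \<longleftrightarrow>
     (\<exists>V''. \<forall>x\<in>S. (V has_real_derivative V' x) (at x within S) \<and>
                 (V' has_real_derivative V'' x) (at x within S) \<and>
                 V x - V'' x = h (V x))"

text \<open>\<open>vs\<close> is the maximal value of the inner profile and \<open>x0\<close> the time at which the inner profile
  has come down from \<open>vs\<close> to \<open>v0\<close>. The integrand is singular at \<open>vs\<close>, so the integral is improper
  there; the Henstock-Kurzweil integral covers this.\<close>

definition switch_data ::
  "(real \<Rightarrow> real) \<Rightarrow> real \<Rightarrow> real \<Rightarrow> real \<Rightarrow> real \<Rightarrow> real \<Rightarrow> bool" where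
  "switch_data g \<beta> \<gamma> v0 vs x0 \<longleftrightarrow>
     (let E = G_plus g \<gamma> v0 - G_minus g \<beta> v0 in
        v0 < vs \<and> vs \<le> 1 \<and>
        G_plus g \<gamma> vs = E \<and>
        (\<forall>v\<in>{v0<..<vs}. E - G_plus g \<gamma> v > 0) \<and>
        ((\<lambda>v. 1 / sqrt (2 * (E - G_plus g \<gamma> v))) has_integral x0) {v0..vs} \<and>
        0 < x0)"

text \<open>The range conditions \<open>V x \<in> {g \<gamma>..1}\<close> and \<open>V x \<in> {0..g \<beta>}\<close> below only say that the inverse
  functions are evaluated inside their domains.\<close>

definition inner_profile ::
  "(real \<Rightarrow> real) \<Rightarrow> real \<Rightarrow> real \<Rightarrow> real \<Rightarrow> real \<Rightarrow> real \<Rightarrow> (real \<Rightarrow> real) \<Rightarrow> bool" where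
  "inner_profile g \<beta> \<gamma> v0 vs x0 V \<longleftrightarrow>
     (\<exists>V'. solves_on {- x0..x0} (g_plus_inv g \<gamma>) V V' \<and>
        (\<forall>x\<in>{- x0..x0}. V x \<in> {g \<gamma>..1} \<and> V (- x) = V x \<and>
            (V' x)\<^sup>2 / 2 + G_plus g \<gamma> (V x) = G_plus g \<gamma> v0 - G_minus g \<beta> v0) \<and>
        V 0 = vs \<and> V x0 = v0 \<and> V (- x0) = v0 \<and>
        V' x0 = - sqrt (- 2 * G_minus g \<beta> v0) \<and>
        V' (- x0) = sqrt (- 2 * G_minus g \<beta> v0))"

text \<open>The sign of \<open>V'\<close> at \<open>x0\<close> is needed to single out the profile: when \<open>G_minus g \<beta> (g \<beta>) = 0\<close>,
  another zero-energy solution first climbs from \<open>v0\<close> to \<open>g \<beta>\<close> and only then decays.\<close>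

definition outer_profile ::
  "(real \<Rightarrow> real) \<Rightarrow> real \<Rightarrow> real \<Rightarrow> real \<Rightarrow> (real \<Rightarrow> real) \<Rightarrow> bool" where
  "outer_profile g \<beta> v0 x0 V \<longleftrightarrow>
     (\<exists>V'. solves_on {x. \<bar>x\<bar> \<ge> x0} (g_minus_inv g \<beta>) V V' \<and>
        (\<forall>x. \<bar>x\<bar> \<ge> x0 \<longrightarrow> V x \<in> {0..g \<beta>} \<and> V (- x) = V x \<and>
            (V' x)\<^sup>2 / 2 + G_minus g \<beta> (V x) = 0) \<and>
        V x0 = v0 \<and> V (- x0) = v0 \<and>
        (V \<longlongrightarrow> 0) at_top \<and> (V \<longlongrightarrow> 0) at_bot \<and>
        V' x0 = - sqrt (- 2 * G_minus g \<beta> v0) \<and>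
        V' (- x0) = sqrt (- 2 * G_minus g \<beta> v0))"

definition family_data ::
  "(real \<Rightarrow> real) \<Rightarrow> real \<Rightarrow> real \<Rightarrow> real \<Rightarrow> real \<Rightarrow> real \<Rightarrow> (real \<Rightarrow> real) \<Rightarrow> (real \<Rightarrow> real) \<Rightarrow> bool" where
  "family_data g \<beta> \<gamma> v0 vs x0 Vp Vm \<longleftrightarrow>
     switch_data g \<beta> \<gamma> v0 vs x0 \<and>
     inner_profile g \<beta> \<gamma> v0 vs x0 Vp \<and>
     outer_profile g \<beta> v0 x0 Vm"

text \<open>The formula for \<open>U\<close> leaves its values at \<open>\<plusminus>x0\<close> open. Here the outer branch is taken there;
  as \<open>Vm (\<plusminus>x0) = v0\<close>, this is a value for which the ground state equation holds pointwise.\<close>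

definition glue ::
  "(real \<Rightarrow> real) \<Rightarrow> real \<Rightarrow> real \<Rightarrow> real \<Rightarrow> (real \<Rightarrow> real) \<Rightarrow> (real \<Rightarrow> real) \<Rightarrow> real \<Rightarrow> real" where
  "glue g \<beta> \<gamma> x0 Vp Vm x =
     (if \<bar>x\<bar> < x0 then g_plus_inv g \<gamma> (Vp x) else g_minus_inv g \<beta> (Vm x))"

text \<open>The class in which nonexistence of further ground states is asserted: all continuous
  functions, and all functions with values on the two branches used to define
  \<open>G_minus\<close> and \<open>G_plus\<close> and with at most two points of discontinuity. Among arbitrary bounded
  solutions the assertion fails: a solution may sit on the decreasing branch \<open>(\<beta>, \<gamma>)\<close> for
  \<open>\<bar>x\<bar> < x0\<close>, may take values above \<open>1\<close> (where \<open>g\<close> is arbitrary), or may switch between the two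
  increasing branches several times while \<open>V\<close> rises through \<open>[g \<gamma>, g \<beta>]\<close>.\<close>

definition branch_admissible :: "real \<Rightarrow> real \<Rightarrow> (real \<Rightarrow> real) \<Rightarrow> bool" where
  "branch_admissible \<beta> \<gamma> W \<longleftrightarrow>
     continuous_on UNIV W \<or>
     (range W \<subseteq> {0..\<beta>} \<union> {\<gamma>..1} \<and>
      finite {x. \<not> isCont W x} \<and> card {x. \<not> isCont W x} \<le> 2)"

end

theory Submission
  imports Defs
begin

text \<open>
  The equation reads \<open>g U = V\<close> with \<open>V = K * U\<close>, and \<open>K * U\<close> is the bounded solution of \<open>V - V'' = U\<close>. On each
  increasing branch of \<open>g\<close> this is a Hamiltonian system with potential \<open>G_minus\<close> or \<open>G_plus\<close>. As \<open>U\<close> decays,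
  \<open>V\<close> has zero energy on the outer branch. Since \<open>G_minus\<close> vanishes at \<open>g \<beta>\<close> with positive slope, there is one
  outer orbit up to translation, the homoclinic through \<open>g \<beta>\<close>; its image under the inverse of \<open>g\<close> is the
  continuous ground state. Switching to the inner branch at height \<open>v0\<close> fixes the energy
  \<open>G_plus v0 - G_minus v0\<close>. Its distance to the saddle value \<open>G_plus 1\<close> decreases in \<open>v0\<close> and is still positive
  at \<open>v0 = g \<beta>\<close>, so the inner orbit turns around at some \<open>vs < 1\<close>.

  Conversely, evenness forces \<open>V' 0 = 0\<close>. A continuous solution that reaches \<open>g \<beta>\<close> at some \<open>p > 0\<close> has
  \<open>V' > 0\<close> to the left of \<open>p\<close>, whichever branch it takes there, back to the previous point where
  \<open>V \<ge> g \<beta>\<close>, which is absurd; so \<open>p = 0\<close>. For a solution with jumps at \<open>\<plusminus>p\<close>, concavity of \<open>V\<close> on the inner branch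
  gives \<open>V' p < 0\<close>, and the profile is the one determined by \<open>v0 = V p\<close>.
\<close>

text \<open>The inverse branches of \<open>g\<close> are not Lipschitz at \<open>g \<beta>\<close>
  and \<open>g \<gamma>\<close>, where \<open>g'\<close> vanishes, and the orbits reach just these
  heights: \<open>g \<beta>\<close> is the peak of the homoclinic, \<open>g \<gamma>\<close> is an
  admissible \<open>v0\<close>. Orbits are therefore built by quadrature from the energy law, and
  uniqueness rests on monotonicity: of the speed as a function of the height for inner orbits, and
  of the homoclinic, hence on its inverse \<open>Yc\<close>, for outer ones. At a jump
  \<open>V - V'' = U\<close> is lost, but \<open>V\<close> stays continuously differentiable. A
  bounded function of this kind with \<open>D'' = D\<close> off a finite set vanishes, so any
  bounded profile agrees with the convolution. Square integrability uses no decay rate of the orbit: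
  \<open>f' 0 < 0\<close> bounds \<open>U\<close> near 0 by a multiple of
  \<open>V - U = V''\<close>, whose integral telescopes. At a jump point both \<open>hm v0\<close>
  and \<open>hp v0\<close> solve the equation. So the value there is not determined, and a
  discontinuous ground state is identified only almost everywhere.\<close>

section \<open>Smooth functions on open sets\<close>

text \<open>L'Hopital for the difference quotient at \<open>x\<close>: its numerator has derivative
  \<open>\<phi>\<close> off \<open>D\<close>, and \<open>\<phi>\<close> has a limit at
  \<open>x\<close>. It serves wherever a differential equation is known only off jumps or off a
  turning point.\<close>

lemma DERIV_removable:
  fixes F \<phi> :: "real \<Rightarrow> real"
  assumes D: "finite D" and S: "open S" "x \<in> S"
    and F: "isCont F x" and \<phi>: "isCont \<phi> x"
    and der: "\<And>y. y \<in> S - D \<Longrightarrow> (F has_real_derivative \<phi> y) (at y)"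
  shows "(F has_real_derivative \<phi> x) (at x)"
proof -
  have "finite (D - {x})" using D by simp
  then have "open (S - (D - {x}))"
    using S by (intro open_Diff finite_imp_closed)
  then have ev: "eventually (\<lambda>y. y \<in> S - (D - {x})) (at x)"
    using S by (intro eventually_at_in_open') auto
  have ev': "eventually (\<lambda>y. y \<in> S - D) (at x)"
    using ev eventually_neq_at_within[of x x UNIV] by eventually_elim auto
  have "((\<lambda>y. (F y - F x) / (y - x)) \<longlongrightarrow> \<phi> x) (at x)"
  proof (rule lhopital[where f' = \<phi> and g' = "\<lambda>_. 1"])
    show "((\<lambda>y. F y - F x) \<longlongrightarrow> 0) (at x)"
      using F by (simp add: isCont_def LIM_zero)
    show "((\<lambda>y. y - x) \<longlongrightarrow> 0) (at x)" by (auto intro!: tendsto_eq_intros)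
    show "\<forall>\<^sub>F y in at x. y - x \<noteq> 0"
      using eventually_neq_at_within[of x x UNIV] by eventually_elim auto
    show "\<forall>\<^sub>F y in at x. ((\<lambda>y. F y - F x) has_real_derivative \<phi> y) (at y)"
      using ev' by eventually_elim (auto intro!: derivative_eq_intros der)
    show "\<forall>\<^sub>F y in at x. ((\<lambda>y. y - x) has_real_derivative 1) (at y)"
      by (intro always_eventually allI) (auto intro!: derivative_eq_intros)
  qed (use \<phi> in \<open>auto simp: isCont_def\<close>)
  then show ?thesis by (simp add: has_field_derivative_iff)
qed

text \<open>The derivative is an existential witness, so that an induction can supply a formula for
  it, whereas \<open>smooth_on\<close> speaks of iterated \<open>deriv\<close>. The two notions
  agree on open sets.\<close>

primrec times_differentiable_on :: "nat \<Rightarrow> real set \<Rightarrow> (real \<Rightarrow> real) \<Rightarrow> bool" where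
  "times_differentiable_on 0 S f \<longleftrightarrow> True"
| "times_differentiable_on (Suc n) S f \<longleftrightarrow>
     (\<exists>f'. (\<forall>x\<in>S. (f has_real_derivative f' x) (at x)) \<and> times_differentiable_on n S f')"

lemma times_differentiable_on_cong:
  assumes "open S" "\<And>x. x \<in> S \<Longrightarrow> f x = g x"
  shows "times_differentiable_on n S f \<longleftrightarrow> times_differentiable_on n S g"
proof (cases n)
  case (Suc m)
  have "(f has_real_derivative f' x) (at x) \<longleftrightarrow> (g has_real_derivative f' x) (at x)" if "x \<in> S" for f' x
    using assms that by (intro DERIV_cong_ev) (auto simp: eventually_nhds)
  then show ?thesis using Suc by simp
qed simp

lemma times_differentiable_on_Suc_D:
  "times_differentiable_on (Suc n) S f \<Longrightarrow> times_differentiable_on n S f"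
  by (induction n arbitrary: f) auto

lemma times_differentiable_on_iff_deriv:
  assumes "open S"
  shows "times_differentiable_on n S f \<longleftrightarrow> (\<forall>k<n. \<forall>x\<in>S. (deriv ^^ k) f differentiable (at x))"
proof (induction n arbitrary: f)
  case (Suc n)
  have "times_differentiable_on (Suc n) S f \<longleftrightarrow>
      (\<forall>x\<in>S. f differentiable (at x)) \<and> times_differentiable_on n S (deriv f)"
  proof
    assume "times_differentiable_on (Suc n) S f"
    then obtain f' where f': "\<forall>x\<in>S. (f has_real_derivative f' x) (at x)" "times_differentiable_on n S f'"
      by auto
    moreover have "deriv f x = f' x" if "x \<in> S" for x
      using f' that by (simp add: DERIV_imp_deriv)
    ultimately show "(\<forall>x\<in>S. f differentiable (at x)) \<and> times_differentiable_on n S (deriv f)"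
      using times_differentiable_on_cong[OF assms, of "deriv f" f' n]
      by (auto simp: real_differentiable_def)
  next
    assume "(\<forall>x\<in>S. f differentiable (at x)) \<and> times_differentiable_on n S (deriv f)"
    then show "times_differentiable_on (Suc n) S f"
      by (auto simp: DERIV_deriv_iff_real_differentiable intro!: exI[of _ "deriv f"])
  qed
  also have "\<dots> \<longleftrightarrow> (\<forall>k<Suc n. \<forall>x\<in>S. (deriv ^^ k) f differentiable (at x))"
    by (simp add: Suc.IH All_less_Suc2 funpow_Suc_right del: funpow.simps(2))
  finally show ?case .
qed simp

lemma smooth_on_iff_times_differentiable:
  "open S \<Longrightarrow> smooth_on S f \<longleftrightarrow> (\<forall>n. times_differentiable_on n S f)"
  by (auto simp: smooth_on_def times_differentiable_on_iff_deriv)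

lemma times_differentiable_on_const: "times_differentiable_on n S (\<lambda>x. c)"
  by (induction n arbitrary: c) (auto intro!: exI[of _ "\<lambda>x. 0"])

lemma times_differentiable_on_id: "times_differentiable_on n S (\<lambda>x. x)"
  by (cases n) (auto intro!: exI[of _ "\<lambda>x. 1"] times_differentiable_on_const)

lemma times_differentiable_on_add:
  "times_differentiable_on n S f \<Longrightarrow> times_differentiable_on n S g \<Longrightarrow>
   times_differentiable_on n S (\<lambda>x. f x + g x)"
proof (induction n arbitrary: f g)
  case (Suc n)
  then obtain f' g' where *: "\<forall>x\<in>S. (f has_real_derivative f' x) (at x)" "times_differentiable_on n S f'"
    "\<forall>x\<in>S. (g has_real_derivative g' x) (at x)" "times_differentiable_on n S g'" by auto
  show ?case
    by (auto intro!: exI[of _ "\<lambda>x. f' x + g' x"] Suc.IH * derivative_eq_intros simp: *)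
qed simp

lemma times_differentiable_on_mult:
  "times_differentiable_on n S f \<Longrightarrow> times_differentiable_on n S g \<Longrightarrow>
   times_differentiable_on n S (\<lambda>x. f x * g x)"
proof (induction n arbitrary: f g)
  case (Suc n)
  then obtain f' g' where *: "\<forall>x\<in>S. (f has_real_derivative f' x) (at x)" "times_differentiable_on n S f'"
    "\<forall>x\<in>S. (g has_real_derivative g' x) (at x)" "times_differentiable_on n S g'" by auto
  have "times_differentiable_on n S f" "times_differentiable_on n S g"
    using Suc.prems times_differentiable_on_Suc_D by blast+
  then show ?case
    by (auto intro!: exI[of _ "\<lambda>x. f' x * g x + g' x * f x"] Suc.IH times_differentiable_on_add *
      DERIV_mult simp: *)
qed simp

lemma times_differentiable_on_diff:
  assumes "times_differentiable_on n S f" "times_differentiable_on n S g"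
  shows "times_differentiable_on n S (\<lambda>x. f x - g x)"
  using times_differentiable_on_add[OF assms(1)
      times_differentiable_on_mult[OF times_differentiable_on_const[of _ _ "-1"] assms(2)]] by simp

lemma times_differentiable_on_compose:
  "times_differentiable_on n T g \<Longrightarrow> times_differentiable_on n S f \<Longrightarrow> f ` S \<subseteq> T \<Longrightarrow>
   times_differentiable_on n S (\<lambda>x. g (f x))"
proof (induction n arbitrary: g)
  case (Suc n)
  then obtain f' g' where *: "\<forall>x\<in>S. (f has_real_derivative f' x) (at x)" "times_differentiable_on n S f'"
    "\<forall>x\<in>T. (g has_real_derivative g' x) (at x)" "times_differentiable_on n T g'" by auto
  have "times_differentiable_on n S f" using Suc.prems times_differentiable_on_Suc_D by blast
  then have "times_differentiable_on n S (\<lambda>x. g' (f x) * f' x)"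
    using Suc.IH[OF *(4)] Suc.prems(3) by (intro times_differentiable_on_mult *) auto
  moreover have "((\<lambda>x. g (f x)) has_real_derivative g' (f x) * f' x) (at x)" if "x \<in> S" for x
    using * Suc.prems(3) that by (intro DERIV_chain2[of g]) auto
  ultimately show ?case by (auto intro!: exI[of _ "\<lambda>x. g' (f x) * f' x"])
qed simp

lemma times_differentiable_on_inverse:
  assumes "0 \<notin> S"
  shows "times_differentiable_on n S inverse"
proof (induction n)
  case (Suc n)
  have "times_differentiable_on n S (\<lambda>x. (-1) * (inverse x * inverse x))"
    by (intro times_differentiable_on_mult Suc times_differentiable_on_const)
  then show ?case using assms
    by (auto intro!: exI[of _ "\<lambda>x. (-1) * (inverse x * inverse x)"] derivative_eq_intros)
qed simp

section \<open>Smoothness of inverse functions and of solutions by bootstrapping\<close>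

lemma DERIV_inverse_strong:
  fixes f g :: "real \<Rightarrow> real"
  assumes "open S" "x \<in> S" "continuous_on S f" "\<And>y. y \<in> S \<Longrightarrow> g (f y) = y"
    and "(f has_real_derivative D) (at x)" "D \<noteq> 0"
  shows "(g has_real_derivative inverse D) (at (f x))"
proof -
  have "(g has_derivative (*) (inverse D)) (at (f x))"
  proof (rule has_derivative_inverse_strong[OF assms(1-4)])
    show "(f has_derivative (*) D) (at x)" using assms(5) by (simp add: has_field_derivative_def)
    show "(*) D \<circ> (*) (inverse D) = id" using assms(6) by auto
  qed auto
  then show ?thesis by (simp add: has_field_derivative_def)
qed

text \<open>Bootstrapping on \<open>g' y = 1 / f' (g y)\<close>: \<open>n\<close> derivatives of
  \<open>g\<close> give \<open>n\<close> derivatives of the right side, hence \<open>n + 1\<close>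
  of \<open>g\<close>.\<close>

lemma smooth_on_inverse_function:
  fixes f g :: "real \<Rightarrow> real"
  assumes S: "open S" and T: "open T" and f: "smooth_on S f"
    and gf: "\<And>x. x \<in> S \<Longrightarrow> g (f x) = x" and fg: "\<And>y. y \<in> T \<Longrightarrow> g y \<in> S \<and> f (g y) = y"
    and nz: "\<And>x. x \<in> S \<Longrightarrow> deriv f x \<noteq> 0"
  shows "smooth_on T g"
proof -
  have f': "(f has_real_derivative deriv f x) (at x)" if "x \<in> S" for x
    using f that unfolding smooth_on_def
    by (metis DERIV_deriv_iff_real_differentiable funpow_0)
  have tf: "times_differentiable_on n S (deriv f)" for n
    using f S unfolding smooth_on_def
    by (auto simp: times_differentiable_on_iff_deriv) (metis funpow.simps(2) funpow_swap1 comp_apply)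
  have g': "(g has_real_derivative inverse (deriv f (g y))) (at y)" if "y \<in> T" for y
  proof -
    have "continuous_on S f"
      using f' by (meson DERIV_isCont continuous_at_imp_continuous_on)
    then show ?thesis
      using DERIV_inverse_strong[OF S _ _ gf f' nz, of "g y"] fg[OF that] by simp
  qed
  have "times_differentiable_on n T g" for n
  proof (induction n)
    case (Suc n)
    have "times_differentiable_on n T (\<lambda>y. deriv f (g y))"
      using fg by (intro times_differentiable_on_compose[OF tf Suc]) auto
    then have "times_differentiable_on n T (\<lambda>y. inverse (deriv f (g y)))"
      using fg nz
      by (intro times_differentiable_on_compose[where g = inverse, OF times_differentiable_on_inverse[of "- {0}"]]) auto
    with g' show ?case by (auto intro!: exI[of _ "\<lambda>y. inverse (deriv f (g y))"])
  qed simp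
  then show ?thesis by (simp add: smooth_on_iff_times_differentiable T)
qed

text \<open>Bootstrapping on \<open>V' = P\<close>, \<open>P' = V - k V\<close>: each round gains
  one derivative for both functions. The open set \<open>T\<close> leaves room to exclude the end
  values, where an inverse branch of \<open>g\<close> may fail to be smooth.\<close>

lemma smooth_on_second_order_solution:
  fixes V P k :: "real \<Rightarrow> real"
  assumes S: "open S" and T: "open T" and k: "smooth_on T k"
    and V: "\<And>x. x \<in> S \<Longrightarrow> V x \<in> T"
    and V': "\<And>x. x \<in> S \<Longrightarrow> (V has_real_derivative P x) (at x)"
    and P': "\<And>x. x \<in> S \<Longrightarrow> (P has_real_derivative V x - k (V x)) (at x)"
  shows "smooth_on S (\<lambda>x. k (V x))"
proof -
  have tk: "times_differentiable_on n T k" for n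
    using k T by (simp add: smooth_on_iff_times_differentiable)
  have "times_differentiable_on n S V \<and> times_differentiable_on n S P" for n
  proof (induction n)
    case (Suc n)
    then have "times_differentiable_on n S (\<lambda>x. V x - k (V x))"
      using V by (intro times_differentiable_on_diff times_differentiable_on_compose[OF tk]) auto
    then have "times_differentiable_on (Suc n) S P"
      using P' by (auto intro!: exI[of _ "\<lambda>x. V x - k (V x)"])
    moreover have "times_differentiable_on (Suc n) S V"
      using Suc V' by auto
    ultimately show ?case by blast
  qed simp
  then have "times_differentiable_on n S (\<lambda>x. k (V x))" for n
    using V by (intro times_differentiable_on_compose[OF tk]) auto
  then show ?thesis by (simp add: smooth_on_iff_times_differentiable S)
qed

lemma smooth_on_cong:
  assumes "open S" "smooth_on S f" "\<And>x. x \<in> S \<Longrightarrow> g x = f x"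
  shows "smooth_on S g"
  using assms times_differentiable_on_cong[of S g f]
  by (auto simp: smooth_on_iff_times_differentiable)

lemma smooth_on_Un: "smooth_on S f \<Longrightarrow> smooth_on T f \<Longrightarrow> smooth_on (S \<union> T) f"
  by (auto simp: smooth_on_def)

section \<open>Orbits with a turning point\<close>

text \<open>\<open>q\<close> is what remains of \<open>G M - G (M - y)\<close> after division by its
  zero at \<open>y = 0\<close>; the value filled in there is the derivative of \<open>G\<close> at
  \<open>M\<close>.\<close>

lemma continuous_difference_quotient:
  fixes G k :: "real \<Rightarrow> real" and M :: real
  assumes G: "\<And>v. (G has_real_derivative k v) (at v)" and k: "continuous_on UNIV k"
  defines "q \<equiv> \<lambda>y. if y = 0 then k M else (G M - G (M - y)) / y"
  shows "continuous_on UNIV q"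
proof -
  have Gc: "continuous_on UNIV G"
    using G by (meson DERIV_isCont continuous_at_imp_continuous_on)
  have "isCont q y" for y
  proof (cases "y = 0")
    case True
    have "((\<lambda>y. (G M - G (M - y)) / y) \<longlongrightarrow> k M) (at 0)"
    proof -
      have "((\<lambda>y. - G (M - y)) has_real_derivative k M) (at 0)"
        by (auto intro!: derivative_eq_intros DERIV_chain2[OF G])
      then show ?thesis by (simp add: DERIV_def)
    qed
    then have "(q \<longlongrightarrow> k M) (at 0)"
      by (rule Lim_transform_eventually)
        (auto simp: q_def eventually_at_filter)
    then show ?thesis using True by (simp add: isCont_def q_def)
  next
    case False
    have "isCont (\<lambda>y. (G M - G (M - y)) / y) y"
      using False by (auto intro!: continuous_intros continuous_on_interior[OF Gc] isCont_o2[where g=G])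
    moreover have "eventually (\<lambda>z. z \<noteq> 0) (nhds y)"
      using False by (simp add: t1_space_nhds)
    then have "eventually (\<lambda>z. (G M - G (M - z)) / z = q z) (nhds y)"
      by eventually_elim (simp add: q_def)
    ultimately show ?thesis
      by (simp add: isCont_cong)
  qed
  then show ?thesis by (simp add: continuous_at_imp_continuous_on)
qed

text \<open>Writing \<open>V = M - \<sigma>\<^sup>2\<close> removes the square-root singularity of the time map \<open>\<integral> dv / sqrt (2 (G M - G v))\<close>
  at the turning point \<open>M\<close>: the time \<open>\<tau>\<close> becomes a continuously differentiable function of \<open>\<sigma>\<close>, and \<open>V\<close> is
  defined through its inverse.\<close>

lemma peak_solution:
  fixes G k :: "real \<Rightarrow> real" and L M :: real
  assumes G: "\<And>v. (G has_real_derivative k v) (at v)" and k: "continuous_on UNIV k"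
    and LM: "L < M" and less: "\<And>v. L < v \<Longrightarrow> v < M \<Longrightarrow> G v < G M" and kM: "k M > 0"
  obtains I V P Y where "open I" "is_interval I" "0 \<in> I" "V 0 = M"
    "\<And>x. x \<in> I \<Longrightarrow> - x \<in> I" "\<And>x. x \<in> I \<Longrightarrow> V (- x) = V x" "\<And>x. x \<in> I \<Longrightarrow> P (- x) = - P x"
    "\<And>x. x \<in> I \<Longrightarrow> (V has_real_derivative P x) (at x)"
    "\<And>x. x \<in> I \<Longrightarrow> (P has_real_derivative - k (V x)) (at x)"
    "\<And>x. x \<in> I \<Longrightarrow> (P x)\<^sup>2 / 2 + G (V x) = G M"
    "\<And>x. x \<in> I \<Longrightarrow> L < V x \<and> V x \<le> M"
    "\<And>x. x \<in> I \<Longrightarrow> 0 < x \<Longrightarrow> P x < 0"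
    "\<And>v. L < v \<Longrightarrow> v \<le> M \<Longrightarrow> Y v \<in> I \<and> 0 \<le> Y v \<and> V (Y v) = v"
    "\<And>v. L < v \<Longrightarrow> v < M \<Longrightarrow> (Y has_real_derivative 1 / P (Y v)) (at v)"
proof -
  define q where "q = (\<lambda>y. if y = 0 then k M else (G M - G (M - y)) / y)"
  have qc: "continuous_on UNIV q"
    unfolding q_def by (rule continuous_difference_quotient[OF G k])
  \<comment> \<open>\<open>M - s\<^sup>2\<close> exceeds \<open>L\<close> exactly when the modulus
    of \<open>s\<close> is below \<open>R\<close>.\<close>
  define R where "R = sqrt (M - L)"
  have R: "R > 0" "R\<^sup>2 = M - L" using LM by (auto simp: R_def)
  have sR: "s\<^sup>2 < M - L" if "\<bar>s\<bar> < R" for s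
  proof -
    have "\<bar>s\<bar>\<^sup>2 < R\<^sup>2" using that by (intro power_strict_mono) auto
    then show ?thesis using R by simp
  qed
  have qpos: "q (s\<^sup>2) > 0" if "\<bar>s\<bar> < R" for s
  proof (cases "s = 0")
    case False
    then have "G (M - s\<^sup>2) < G M" using sR[OF that] by (intro less) auto
    then show ?thesis using False by (simp add: q_def)
  qed (use kM in \<open>simp add: q_def\<close>)
  have qs: "s\<^sup>2 * q (s\<^sup>2) = G M - G (M - s\<^sup>2)" for s
    by (simp add: q_def)
  \<comment> \<open>With \<open>V = M - \<sigma>\<^sup>2\<close> and
    \<open>P = - 2 \<sigma> \<sigma>'\<close> the law \<open>P\<^sup>2 / 2 = G M - G V =
    \<sigma>\<^sup>2 q (\<sigma>\<^sup>2)\<close> becomes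
    \<open>\<sigma>' = sqrt (q (\<sigma>\<^sup>2) / 2)\<close>. The right side stays positive at the
    turning point because \<open>k M > 0\<close>.\<close>
  define \<rho> where "\<rho> = (\<lambda>s. sqrt (q (s\<^sup>2) / 2))"
  have \<rho>pos: "\<rho> s > 0" if "\<bar>s\<bar> < R" for s using qpos[OF that] by (simp add: \<rho>_def)
  have \<rho>c: "continuous_on UNIV \<rho>"
    unfolding \<rho>_def by (intro continuous_intros continuous_on_compose2[OF qc]) auto
  have \<rho>isc: "isCont \<rho> s" for s using \<rho>c by (simp add: continuous_on_eq_continuous_at)
  have "\<exists>F. \<forall>s::real. ereal (-R) < s \<longrightarrow> s < ereal R \<longrightarrow> (F has_vector_derivative 1 / \<rho> s) (at s)"
  proof (rule einterval_antiderivative)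
    show "isCont (\<lambda>s. 1 / \<rho> s) s" if "ereal (-R) < s" "s < ereal R" for s
    proof -
      have "\<rho> s > 0" using that by (intro \<rho>pos) auto
      then show ?thesis using \<rho>isc[of s] by (intro continuous_intros) auto
    qed
  qed (use R in auto)
  then obtain F where "\<forall>s::real. ereal (-R) < s \<longrightarrow> s < ereal R \<longrightarrow> (F has_vector_derivative 1 / \<rho> s) (at s)"
    by blast
  then have F: "(F has_real_derivative 1 / \<rho> s) (at s)" if "\<bar>s\<bar> < R" for s
    using that by (simp add: has_real_derivative_iff_has_vector_derivative abs_less_iff)
  define \<tau> where "\<tau> = (\<lambda>s. F s - F 0)"
  have \<tau>': "(\<tau> has_real_derivative 1 / \<rho> s) (at s)" if "\<bar>s\<bar> < R" for s
    unfolding \<tau>_def using F[OF that] by (auto intro!: derivative_eq_intros)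
  define J where "J = {-R<..<R}"
  have J: "s \<in> J \<longleftrightarrow> \<bar>s\<bar> < R" for s by (auto simp: J_def)
  have Jo: "open J" by (simp add: J_def)
  have \<tau>0: "\<tau> 0 = 0" by (simp add: \<tau>_def)
  have \<tau>c: "continuous_on J \<tau>"
    using \<tau>' J by (meson DERIV_isCont continuous_at_imp_continuous_on)
  have \<tau>mono: "\<tau> s < \<tau> t" if "s \<in> J" "t \<in> J" "s < t" for s t
  proof (rule DERIV_pos_imp_increasing[OF that(3)])
    fix r assume "s \<le> r" "r \<le> t"
    then have "\<bar>r\<bar> < R" using that by (auto simp: J_def)
    then show "\<exists>y. (\<tau> has_real_derivative y) (at r) \<and> y > 0"
      using \<tau>' \<rho>pos by (intro exI[of _ "1 / \<rho> r"]) auto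
  qed
  have \<tau>odd: "\<tau> (- s) = - \<tau> s" if "s \<in> J" for s
  proof -
    have "\<tau> s + \<tau> (- s) = \<tau> 0 + \<tau> (- 0)"
    proof (rule DERIV_isconst3[of "-R" R s 0 "\<lambda>s. \<tau> s + \<tau> (- s)"])
      show "((\<lambda>s. \<tau> s + \<tau> (- s)) has_real_derivative 0) (at x)" if "x \<in> {-R<..<R}" for x
      proof -
        have "((\<lambda>s. \<tau> (- s)) has_real_derivative 1 / \<rho> (-x) * (-1)) (at x)"
          using that by (intro DERIV_chain2[of \<tau>] \<tau>') (auto intro!: derivative_eq_intros)
        moreover have "\<rho> (-x) = \<rho> x" by (simp add: \<rho>_def)
        ultimately show ?thesis using DERIV_add[OF \<tau>'[of x]] that by fastforce
      qed
    qed (use R that in \<open>auto simp: J_def\<close>)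
    then show ?thesis by (simp add: \<tau>0)
  qed
  have inj: "inj_on \<tau> J"
    by (rule linorder_inj_onI') (use \<tau>mono in force)
  define I where "I = \<tau> ` J"
  define \<sigma> where "\<sigma> = the_inv_into J \<tau>"
  have \<sigma>\<tau>: "\<sigma> (\<tau> s) = s" if "s \<in> J" for s
    unfolding \<sigma>_def by (rule the_inv_into_f_f[OF inj that])
  have \<sigma>J: "\<sigma> x \<in> J" and \<tau>\<sigma>: "\<tau> (\<sigma> x) = x" if "x \<in> I" for x
    using that \<sigma>\<tau> by (auto simp: I_def)
  have Iopen: "open I" unfolding I_def by (rule invariance_of_domain[OF \<tau>c Jo inj])
  have Iint: "is_interval I"
    unfolding I_def is_interval_connected_1
    by (rule connected_continuous_image[OF \<tau>c]) (simp add: J_def)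
  have I0: "0 \<in> I" using \<tau>0 R by (auto simp: I_def J_def intro!: image_eqI[of _ _ 0])
  have Im: "- x \<in> I" and \<sigma>odd: "\<sigma> (- x) = - \<sigma> x" if "x \<in> I" for x
  proof -
    have *: "- \<sigma> x \<in> J" "\<tau> (- \<sigma> x) = - x" using \<sigma>J[OF that] \<tau>odd[OF \<sigma>J[OF that]] \<tau>\<sigma>[OF that]
      by (auto simp: J_def)
    then show "- x \<in> I" by (metis I_def image_eqI)
    show "\<sigma> (- x) = - \<sigma> x" using \<sigma>\<tau>[OF *(1)] * by simp
  qed
  have \<sigma>': "(\<sigma> has_real_derivative \<rho> (\<sigma> x)) (at x)" if "x \<in> I" for x
    using DERIV_inverse_strong[OF Jo \<sigma>J[OF that] \<tau>c \<sigma>\<tau> \<tau>'] \<sigma>J[OF that] \<rho>pos[of "\<sigma> x"] \<tau>\<sigma>[OF that]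
    by (simp add: J)
  have \<sigma>pos: "\<sigma> x > 0" if "x \<in> I" "x > 0" for x
  proof (rule ccontr)
    assume "\<not> \<sigma> x > 0"
    then have "\<tau> (\<sigma> x) \<le> \<tau> 0" using \<tau>mono[of "\<sigma> x" 0] \<sigma>J[OF that(1)] R
      by (cases "\<sigma> x = 0") (auto simp: J_def)
    then show False using that \<tau>\<sigma>[OF that(1)] \<tau>0 by simp
  qed
  have \<sigma>0: "\<sigma> 0 = 0" using \<sigma>\<tau>[of 0] \<tau>0 R by (simp add: J_def)
  define V where "V = (\<lambda>x. M - (\<sigma> x)\<^sup>2)"
  define P where "P = (\<lambda>x. - 2 * \<sigma> x * \<rho> (\<sigma> x))"
  have V': "(V has_real_derivative P x) (at x)" if "x \<in> I" for x
    unfolding V_def P_def using \<sigma>'[OF that] by (auto intro!: derivative_eq_intros)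
  have Vr: "L < V x \<and> V x \<le> M" if "x \<in> I" for x
    using sR[of "\<sigma> x"] \<sigma>J[OF that] by (simp add: V_def J)
  have energy: "(P x)\<^sup>2 / 2 + G (V x) = G M" if "x \<in> I" for x
  proof -
    have "(\<rho> (\<sigma> x))\<^sup>2 = q ((\<sigma> x)\<^sup>2) / 2"
      using qpos[of "\<sigma> x"] \<sigma>J[OF that] by (simp add: \<rho>_def J)
    then have "(P x)\<^sup>2 / 2 = (\<sigma> x)\<^sup>2 * q ((\<sigma> x)\<^sup>2)"
      by (simp add: P_def power_mult_distrib)
    then show ?thesis using qs[of "\<sigma> x"] unfolding V_def by linarith
  qed
  have Veven: "V (- x) = V x" and Podd: "P (- x) = - P x" if "x \<in> I" for x
    using \<sigma>odd[OF that] by (simp_all add: V_def P_def \<rho>_def)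
  have Pneg: "P x < 0" if "x \<in> I" "0 < x" for x
    using \<sigma>pos[OF that] \<rho>pos[of "\<sigma> x"] \<sigma>J[OF that(1)] by (simp add: P_def J)
  have Vc: "isCont V x" if "x \<in> I" for x using V'[OF that] by (rule DERIV_isCont)
  \<comment> \<open>\<open>\<rho>\<close> is only known to be continuous, so the product defining
    \<open>P\<close> is not differentiated. For \<open>x > 0\<close> the energy law gives
    \<open>P = - sqrt (2 * (G M - G V))\<close>, whose derivative reduces to \<open>- k V\<close>;
    oddness transfers this to \<open>x < 0\<close>.\<close>
  have Ppos': "(P has_real_derivative - k (V x)) (at x)" if "x \<in> I" "0 < x" for x
  proof -
    have pos: "0 < 2 * (G M - G (V x))" and eq: "sqrt (2 * (G M - G (V x))) = - P x"
      using energy[OF that(1)] Pneg[OF that]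
      by (auto intro!: real_sqrt_unique simp: algebra_simps) 
         (metis add.commute diff_add_cancel half_gt_zero_iff less_add_same_cancel2 less_numeral_extra(3) zero_less_power2)
    have "((\<lambda>x. - sqrt (2 * (G M - G (V x)))) has_real_derivative
        - ((- (2 * (k (V x) * P x))) * (inverse (sqrt (2 * (G M - G (V x)))) / 2))) (at x)"
      using pos by (auto intro!: derivative_eq_intros DERIV_chain2[OF G V'[OF that(1)]])
    then have "((\<lambda>x. - sqrt (2 * (G M - G (V x)))) has_real_derivative - k (V x)) (at x)"
      using Pneg[OF that] unfolding eq by (simp add: field_simps)
    moreover have "eventually (\<lambda>y. y \<in> I \<inter> {0<..}) (nhds x)"
      using that Iopen by (intro eventually_nhds_in_open) auto
    then have "eventually (\<lambda>y. - sqrt (2 * (G M - G (V y))) = P y) (nhds x)"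
    proof eventually_elim
      case (elim y)
      then show ?case
        using energy[of y] Pneg[of y] real_sqrt_unique[of "- P y" "2 * (G M - G (V y))"]
        by (auto simp: algebra_simps)
    qed
    ultimately show ?thesis by (subst (asm) DERIV_cong_ev[OF refl _ refl]) auto
  qed
  have Pneg': "(P has_real_derivative - k (V x)) (at x)" if "x \<in> I" "x < 0" for x
  proof -
    have "((\<lambda>x. - P (- x)) has_real_derivative - (- k (V (- x)) * (-1))) (at x)"
      using that Im by (intro DERIV_minus DERIV_chain2[of P] Ppos') (auto intro!: derivative_eq_intros)
    moreover have "eventually (\<lambda>y. y \<in> I) (nhds x)"
      using that Iopen by (intro eventually_nhds_in_open) auto
    then have "eventually (\<lambda>y. - P (- y) = P y) (nhds x)"
      by eventually_elim (simp add: Podd)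
    ultimately show ?thesis
      using Veven[OF that(1)] by (subst (asm) DERIV_cong_ev[OF refl _ refl]) auto
  qed
  \<comment> \<open>At 0 the radicand vanishes and the square root formula cannot be differentiated;
    continuity of \<open>P\<close> and of \<open>k V\<close> closes the gap.\<close>
  have P': "(P has_real_derivative - k (V x)) (at x)" if "x \<in> I" for x
  proof (cases "x = 0")
    case True
    show ?thesis
    proof (rule DERIV_removable[of "{0}" I])
      have "isCont \<sigma> x" using \<sigma>'[OF that] by (rule DERIV_isCont)
      then show "isCont P x" unfolding P_def
        by (intro continuous_intros isCont_o2[OF _ \<rho>isc])
      show "isCont (\<lambda>x. - k (V x)) x"
        using k by (intro continuous_intros isCont_o2[OF Vc[OF that]]) (simp add: continuous_on_eq_continuous_at)
      show "(P has_real_derivative - k (V y)) (at y)" if "y \<in> I - {0}" for y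
        using Ppos'[of y] Pneg'[of y] that by (cases "y > 0") auto
    qed (use Iopen that True in auto)
  qed (use Ppos' Pneg' that in \<open>cases "x > 0"; auto\<close>)
  define Y where "Y = (\<lambda>v. \<tau> (sqrt (M - v)))"
  have sJ: "sqrt (M - v) \<in> J" if "L < v" "v \<le> M" for v
    using that R by (auto simp: J_def R_def intro: less_le_trans[of _ 0])
  have Y: "Y v \<in> I \<and> 0 \<le> Y v \<and> V (Y v) = v" if "L < v" "v \<le> M" for v
  proof -
    have "\<tau> 0 \<le> \<tau> (sqrt (M - v))"
      using \<tau>mono[of 0 "sqrt (M - v)"] sJ[OF that] that R by (cases "M = v") (auto simp: J_def)
    then show ?thesis
      using sJ[OF that] that \<sigma>\<tau>[OF sJ[OF that]] by (simp add: Y_def I_def V_def \<tau>0)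
  qed
  have Y': "(Y has_real_derivative 1 / P (Y v)) (at v)" if "L < v" "v < M" for v
  proof -
    have "(Y has_real_derivative 1 / \<rho> (sqrt (M - v)) * (- (inverse (sqrt (M - v)) / 2))) (at v)"
      unfolding Y_def using that sJ[of v] by (intro DERIV_chain2[of \<tau>] \<tau>') (auto simp: J intro!: derivative_eq_intros)
    moreover have "P (Y v) = - 2 * sqrt (M - v) * \<rho> (sqrt (M - v))"
      using sJ[of v] that by (simp add: P_def Y_def \<sigma>\<tau>)
    ultimately show ?thesis by (simp add: field_simps)
  qed
  show ?thesis
    using that[of I V P Y] Iopen Iint I0 Im Veven Podd V' P' energy Vr Pneg Y Y' \<sigma>0
    by (auto simp: V_def)
qed

section \<open>Convolution with the exponential kernel\<close>

lemma exp_absolutely_integrable_atMost: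
  fixes x :: real
  shows "exp absolutely_integrable_on {..x}" "integral {..x} exp = exp x"
proof -
  have *: "((\<lambda>y::real. exp (- y)) has_integral exp x) {-x..}"
    using has_integral_exp_minus_to_infinity[of 1 "-x"] by simp
  then have "(\<lambda>y::real. exp (- y)) absolutely_integrable_on {-x..}"
    by (intro nonnegative_absolutely_integrable_1) (auto simp: integrable_on_def)
  with * have "(\<lambda>y::real. exp (- y)) absolutely_integrable_on {-x..} \<and> integral {-x..} (\<lambda>y. exp (- y)) = exp x"
    by (auto simp: integral_unique)
  then have "exp absolutely_integrable_on {..x} \<and> integral {..x} exp = exp x"
    by (subst (asm) has_absolute_integral_reflect_real[where B = "{..x}" and f = "exp"]) auto
  then show "exp absolutely_integrable_on {..x}" "integral {..x} exp = exp x" by auto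
qed

text \<open>The kernel factors into exponentials on either side of \<open>y = x\<close>, which
  reduces the convolution to this one-sided integral. Being locally an indefinite integral,
  \<open>A\<close> is continuous even where \<open>W\<close> jumps, and differentiable where
  \<open>W\<close> is continuous.\<close>

lemma exp_weighted_tail:
  fixes W :: "real \<Rightarrow> real"
  assumes meas: "W \<in> borel_measurable lebesgue" and bdd: "\<And>x. \<bar>W x\<bar> \<le> B"
  defines "A \<equiv> \<lambda>x. LINT y|lebesgue. indicator {..x} y * (exp y * W y)"
  shows "integrable lebesgue (\<lambda>y. indicator {..x} y * (exp y * W y))"
    and "\<bar>A x\<bar> \<le> B * exp x"
    and "isCont A x"
    and "isCont W x \<Longrightarrow> (A has_real_derivative exp x * W x) (at x)"
proof -
  define w where "w = (\<lambda>y. exp y * W y)"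
  have B: "B \<ge> 0" using bdd[of 0] by linarith
  have "(exp :: real \<Rightarrow> real) \<in> borel_measurable borel"
    by (intro borel_measurable_continuous_onI continuous_on_exp continuous_on_id)
  then have expm: "(exp :: real \<Rightarrow> real) \<in> borel_measurable lebesgue"
    by (intro measurable_completion) simp
  have ei: "integrable lebesgue (\<lambda>y. indicator {..x} y * exp y)" for x :: real
    using exp_absolutely_integrable_atMost(1)[of x] by (simp add: set_integrable_def)
  have int: "integrable lebesgue (\<lambda>y. indicator {..x} y * w y)" for x
  proof (rule Bochner_Integration.integrable_bound)
    show "integrable lebesgue (\<lambda>y. B * (indicator {..x} y * exp y))"
      by (intro integrable_mult_right ei)
    show "(\<lambda>y. indicator {..x} y * w y) \<in> borel_measurable lebesgue"
      unfolding w_def by (intro borel_measurable_times meas expm borel_measurable_indicator) simp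
    show "AE y in lebesgue. norm (indicator {..x} y * w y) \<le> norm (B * (indicator {..x} y * exp y))"
      using bdd B by (auto simp: w_def abs_mult indicator_def mult.commute intro!: mult_left_mono)
  qed
  then show "integrable lebesgue (\<lambda>y. indicator {..x} y * (exp y * W y))" by (simp add: w_def)
  show "\<bar>A x\<bar> \<le> B * exp x"
  proof -
    have "\<bar>A x\<bar> \<le> (LINT y|lebesgue. B * (indicator {..x} y * exp y))"
      unfolding A_def
    proof (rule order_trans[OF integral_abs_bound Bochner_Integration.integral_mono])
      show "\<bar>indicator {..x} y * (exp y * W y)\<bar> \<le> B * (indicator {..x} y * exp y)" for y
        using bdd[of y] by (auto simp: abs_mult indicator_def mult.commute intro!: mult_left_mono)
    qed (use ei int in \<open>auto simp: w_def intro!: integrable_mult_right integrable_abs\<close>)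
    also have "(LINT y|lebesgue. B * (indicator {..x} y * exp y)) = B * exp x"
      using set_lebesgue_integral_eq_integral(2)[OF exp_absolutely_integrable_atMost(1)[of x]]
        exp_absolutely_integrable_atMost(2)[of x]
      by (simp add: set_lebesgue_integral_def)
    finally show ?thesis .
  qed
  have wset: "set_integrable lebesgue {a..b} w" for a b
  proof (rule set_integrable_subset)
    show "set_integrable lebesgue {..b} w" using int by (simp add: set_integrable_def)
  qed auto
  have wint: "w integrable_on {a..b}" for a b
    by (rule set_lebesgue_integral_eq_integral(1)[OF wset])
  have A: "A u = A a + integral {a..u} w" if "a \<le> u" for a u
  proof -
    have "A u = A a + (LINT y|lebesgue. indicator {a..u} y * w y)"
    proof -
      have "A u = (LINT y|lebesgue. indicator {..a} y * w y + indicator {a..u} y * w y)"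
        unfolding A_def
        by (rule integral_discrete_difference[of "{a}"]) (use that in \<open>auto simp: indicator_def w_def\<close>)
      also have "\<dots> = A a + (LINT y|lebesgue. indicator {a..u} y * w y)"
        using int wset[of a u] by (simp add: A_def w_def set_integrable_def)
      finally show ?thesis .
    qed
    then show ?thesis
      using set_lebesgue_integral_eq_integral(2)[OF wset[of a u]] by (simp add: set_lebesgue_integral_def)
  qed
  \<comment> \<open>The base point \<open>x - 1\<close> lies strictly to the left of
    \<open>x\<close>, so the representation holds on a two-sided neighbourhood.\<close>
  have ev: "eventually (\<lambda>u. A (x - 1) + integral {x - 1..u} w = A u) (nhds x)"
  proof -
    have "eventually (\<lambda>u. u \<in> {x-1<..}) (nhds x)" by (intro eventually_nhds_in_open) auto
    then show ?thesis by eventually_elim (rule A[symmetric], simp)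
  qed
  show "isCont A x"
  proof -
    have "continuous_on {x-1..x+1} (\<lambda>u. integral {x-1..u} w)"
      by (rule indefinite_integral_continuous_1[OF wint])
    then have "isCont (\<lambda>u. integral {x-1..u} w) x"
      by (rule continuous_on_interior) simp
    then have "isCont (\<lambda>u. A (x-1) + integral {x-1..u} w) x" by (intro continuous_intros)
    then show ?thesis by (subst (asm) isCont_cong[OF ev])
  qed
  show "(A has_real_derivative exp x * W x) (at x)" if "isCont W x"
  proof -
    have "isCont w x" unfolding w_def using that by (intro continuous_intros)
    then have "((\<lambda>u. integral {x-1..u} w) has_vector_derivative w x) (at x within ({x-1..x+1} - {}))"
      by (intro integral_has_vector_derivative_continuous_at wint)
        (auto intro: continuous_at_imp_continuous_at_within)
    moreover have "x \<in> interior {x-1..x+1}" by simp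
    ultimately have "((\<lambda>u. integral {x-1..u} w) has_vector_derivative w x) (at x)"
      by (metis Diff_empty at_within_interior)
    then have "((\<lambda>u. A (x-1) + integral {x-1..u} w) has_real_derivative w x) (at x)"
      by (auto intro!: derivative_eq_intros simp: has_real_derivative_iff_has_vector_derivative[symmetric])
    then show ?thesis by (subst (asm) DERIV_cong_ev[OF refl ev refl]) (simp add: w_def)
  qed
qed

text \<open>By evenness the right half of the convolution is a left tail at \<open>- x\<close>, so
  \<open>V x = (exp (- x) * A x + exp x * A (- x)) / 2\<close>. In \<open>V'\<close> the terms
  containing \<open>W\<close> cancel, so \<open>P\<close> is continuous across jumps; in
  \<open>P'\<close> they add up to \<open>- W\<close>. For nonnegative \<open>W\<close> both
  summands are nonnegative and \<open>P\<close> is half their difference, whence the bound by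
  \<open>V\<close>.\<close>

lemma convolve_exp_kernel:
  fixes W :: "real \<Rightarrow> real"
  assumes meas: "W \<in> borel_measurable lebesgue" and bdd: "\<And>x. \<bar>W x\<bar> \<le> B"
    and even: "\<And>x. W (- x) = W x" and fin: "finite {x. \<not> isCont W x}"
  defines "V \<equiv> convolve exp_kernel W"
  obtains P where "\<And>x. (V has_real_derivative P x) (at x)" "continuous_on UNIV P"
    "\<And>x. isCont W x \<Longrightarrow> (P has_real_derivative V x - W x) (at x)"
    "\<And>x. \<bar>V x\<bar> \<le> B" "\<And>x. \<bar>P x\<bar> \<le> B" "(\<And>x. 0 \<le> W x) \<Longrightarrow> (\<forall>x. \<bar>P x\<bar> \<le> V x)"
proof -
  define w where "w = (\<lambda>x y. indicator {..x} y * (exp y * W y))"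
  define A where "A = (\<lambda>x. LINT y|lebesgue. w x y)"
  note tail' = exp_weighted_tail[OF meas bdd]
  have tail: "integrable lebesgue (w x)" "\<bar>A x\<bar> \<le> B * exp x" "isCont A x"
    "isCont W x \<Longrightarrow> (A has_real_derivative exp x * W x) (at x)" for x
    unfolding w_def A_def by (rule tail'; assumption)+
  have V: "V x = (exp (-x) * A x + exp x * A (- x)) / 2" for x
  proof -
    have int2: "integrable lebesgue (\<lambda>y. w (-x) (-y))"
      using lebesgue_integrable_real_affine[OF tail(1)[of "-x"], of "-1" 0] by simp
    \<comment> \<open>The two half-lines overlap in the single point \<open>y = x\<close>, where the
      integrands may differ.\<close>
    have "V x = (LINT y|lebesgue. (exp (-x) / 2) * w x y + (exp x / 2) * w (-x) (-y))"
      unfolding V_def convolve_def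
      by (rule integral_discrete_difference[of "{x}"])
        (auto simp: w_def exp_kernel_def even indicator_def exp_diff exp_minus field_simps)
    also have "\<dots> = (exp (-x) / 2) * A x + (exp x / 2) * (LINT y|lebesgue. w (-x) (-y))"
      using tail(1)[of x] int2 by (simp add: A_def)
    also have "(LINT y|lebesgue. w (-x) (-y)) = A (-x)"
      using lebesgue_integral_real_affine[of "-1" "w (-x)" 0] by (simp add: A_def)
    finally show ?thesis by (simp add: field_simps)
  qed
  define P where "P = (\<lambda>x. (exp x * A (- x) - exp (-x) * A x) / 2)"
  have Ac: "isCont A x" "isCont (\<lambda>x. A (-x)) x" for x
    using isCont_o2[OF isCont_minus[OF continuous_ident] tail(3)[of "- x"]] tail(3) by auto
  have Wm: "isCont W (- x)" if "isCont W x" for x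
  proof -
    have "isCont (\<lambda>y. W (- y)) (- x)"
      using isCont_o2[OF isCont_minus[OF continuous_ident], where g = W and a = "- x"] that by simp
    then show ?thesis by (simp add: even)
  qed
  have Am: "((\<lambda>x. A (-x)) has_real_derivative - (exp (-x) * W x)) (at x)" if "isCont W x" for x
  proof -
    have "((\<lambda>x. A (-x)) has_real_derivative exp (-x) * W (-x) * (-1)) (at x)"
      using tail(4)[OF Wm[OF that]] by (intro DERIV_chain2[of A _ uminus]) (auto intro!: derivative_eq_intros)
    then show ?thesis by (simp add: even)
  qed
  have V_eq: "V = (\<lambda>x. (exp (-x) * A x + exp x * A (- x)) / 2)" using V by auto
  have V': "(V has_real_derivative P x) (at x)" if "isCont W x" for x
    unfolding V_eq P_def using tail(4)[OF that] Am[OF that]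
    by (auto intro!: derivative_eq_intros simp: field_simps exp_minus)
  have P': "(P has_real_derivative V x - W x) (at x)" if "isCont W x" for x
    unfolding V P_def using tail(4)[OF that] Am[OF that]
    by (auto intro!: derivative_eq_intros simp: field_simps exp_minus)
  have Pc: "isCont P x" for x unfolding P_def using Ac by (intro continuous_intros) auto
  have Vc: "isCont V x" for x unfolding V_eq using Ac by (intro continuous_intros) auto
  have A1: "\<bar>exp (-x) * A x\<bar> \<le> B" "\<bar>exp x * A (-x)\<bar> \<le> B" for x
    using mult_left_mono[OF tail(2)[of x], of "exp (-x)"] mult_left_mono[OF tail(2)[of "-x"], of "exp x"]
    by (auto simp: abs_mult exp_minus field_simps)
  have mean: "\<bar>(a + b) / 2\<bar> \<le> B" if "\<bar>a\<bar> \<le> B" "\<bar>b\<bar> \<le> B" for a b :: real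
    using that abs_triangle_ineq[of a b] by simp
  show ?thesis
  proof (rule that)
    show "(V has_real_derivative P x) (at x)" for x
      by (rule DERIV_removable[OF fin open_UNIV]) (auto intro: Vc Pc V')
    show "continuous_on UNIV P" using Pc by (simp add: continuous_on_eq_continuous_at)
    show "\<bar>V x\<bar> \<le> B" for x unfolding V by (rule mean[OF A1])
    show "\<bar>P x\<bar> \<le> B" for x
      unfolding P_def using mean[of "exp x * A (- x)" "- (exp (-x) * A x)"] A1[of x] by simp
    show "\<forall>x. \<bar>P x\<bar> \<le> V x" if "\<And>x. 0 \<le> W x"
    proof
      fix x
      have "0 \<le> A x" for x
        unfolding A_def w_def using that by (intro Bochner_Integration.integral_nonneg) auto
      then have "0 \<le> exp (-x) * A x" "0 \<le> exp x * A (-x)" by simp_all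
      then show "\<bar>P x\<bar> \<le> V x" unfolding V P_def by (simp add: abs_le_iff field_simps)
    qed
  qed (rule P')
qed

lemma bounded_by_decaying_exp_imp_zero:
  fixes c :: real
  assumes "\<And>x. \<bar>c\<bar> \<le> B * exp (- x)"
  shows "c = 0"
proof -
  have "((\<lambda>x. B * exp (- x)) \<longlongrightarrow> B * 0) at_top"
    by (intro tendsto_mult tendsto_const filterlim_compose[OF exp_at_bot] filterlim_uminus_at_bot_at_top)
  then have "\<bar>c\<bar> \<le> B * 0" by (rule tendsto_lowerbound) (use assms in auto)
  then show ?thesis by simp
qed

text \<open>\<open>D + E\<close> and \<open>D - E\<close> solve \<open>u' = u\<close> and
  \<open>u' = - u\<close>. They are multiples of \<open>exp x\<close> and \<open>exp (- x)\<close>,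
  and boundedness forces both factors to vanish.\<close>

lemma bounded_solution_unique:
  fixes D E :: "real \<Rightarrow> real"
  assumes D': "\<And>x. (D has_real_derivative E x) (at x)" and E: "continuous_on UNIV E"
    and fin: "finite X" and E': "\<And>x. x \<notin> X \<Longrightarrow> (E has_real_derivative D x) (at x)"
    and bD: "\<And>x. \<bar>D x\<bar> \<le> B" and bE: "\<And>x. \<bar>E x\<bar> \<le> C"
  shows "D x = 0"
proof -
  have E'': "(E has_real_derivative D x) (at x)" for x
    by (rule DERIV_removable[OF fin open_UNIV])
      (use E D' E' in \<open>auto simp: continuous_on_eq_continuous_at intro: DERIV_isCont\<close>)
  have "D x + E x = 0" for x
  proof -
    have const: "(D x + E x) * exp (- x) = (D 0 + E 0) * exp (- 0)" for x
      by (rule DERIV_isconst_all, rule allI)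
        (auto intro!: derivative_eq_intros D' E'' simp: algebra_simps)
    have "D 0 + E 0 = 0"
    proof (rule bounded_by_decaying_exp_imp_zero)
      show "\<bar>D 0 + E 0\<bar> \<le> (B + C) * exp (- x)" for x
      proof -
        have "\<bar>D 0 + E 0\<bar> = \<bar>D x + E x\<bar> * exp (- x)"
          using const[of x] by (metis abs_exp_cancel abs_mult exp_zero minus_zero mult.right_neutral)
        also have "\<dots> \<le> (B + C) * exp (- x)"
          using bD[of x] bE[of x] by (intro mult_right_mono) auto
        finally show ?thesis .
      qed
    qed
    then show ?thesis using const[of x] by simp
  qed
  moreover have "D x - E x = 0" for x
  proof -
    have const: "(D x - E x) * exp x = (D 0 - E 0) * exp 0" for x
      by (rule DERIV_isconst_all, rule allI)
        (auto intro!: derivative_eq_intros D' E'' simp: algebra_simps)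
    have "D 0 - E 0 = 0"
    proof (rule bounded_by_decaying_exp_imp_zero)
      show "\<bar>D 0 - E 0\<bar> \<le> (B + C) * exp (- x)" for x
      proof -
        have "\<bar>D 0 - E 0\<bar> = \<bar>D (-x) - E (-x)\<bar> * exp (- x)"
          using const[of "-x"] by (metis abs_exp_cancel abs_mult exp_zero mult.right_neutral)
        also have "\<dots> \<le> (B + C) * exp (- x)"
          using bD[of "-x"] bE[of "-x"] by (intro mult_right_mono) auto
        finally show ?thesis .
      qed
    qed
    then show ?thesis using const[of x] by simp
  qed
  ultimately show ?thesis by (smt (verit))
qed

section \<open>Descending orbits\<close>

text \<open>Fundamental theorem for the inverse \<open>X\<close> of \<open>V\<close>, with
  \<open>X' = - 1 / \<phi>\<close>. Continuity of \<open>X\<close> up to the ends and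
  differentiability inside suffice, which covers an integrand that is singular at the peak
  \<open>V 0\<close>.\<close>

lemma travel_time_has_integral:
  fixes V P \<phi> :: "real \<Rightarrow> real"
  assumes p: "0 < p" and Vc: "continuous_on {0..p} V"
    and V': "\<And>x. 0 < x \<Longrightarrow> x < p \<Longrightarrow> (V has_real_derivative P x) (at x)"
    and neg: "\<And>x. 0 < x \<Longrightarrow> x < p \<Longrightarrow> P x < 0"
    and \<phi>: "\<And>x. 0 < x \<Longrightarrow> x < p \<Longrightarrow> \<phi> (V x) = - P x"
  shows "((\<lambda>v. 1 / \<phi> v) has_integral p) {V p..V 0}"
proof -
  have mono: "V t < V s" if "0 \<le> s" "s < t" "t \<le> p" for s t
  proof (rule DERIV_neg_imp_decreasing_open[OF that(2)])
    show "\<exists>y. (V has_real_derivative y) (at x) \<and> y < 0" if "s < x" "x < t" for x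
      using V'[of x] neg[of x] that \<open>0 \<le> s\<close> \<open>t \<le> p\<close> by (intro exI[of _ "P x"]) auto
    show "continuous_on {s..t} V" using that by (intro continuous_on_subset[OF Vc]) auto
  qed
  define X where "X = inv_into {0..p} V"
  have inj: "inj_on V {0..p}" by (rule linorder_inj_onI') (use mono in force)
  have XV: "X (V x) = x" if "x \<in> {0..p}" for x
    unfolding X_def by (rule inv_into_f_f[OF inj that])
  have img: "V ` {0..p} = {V p..V 0}"
  proof
    show "V ` {0..p} \<subseteq> {V p..V 0}"
      using mono p by (auto; metis le_less order.strict_iff_order)
    show "{V p..V 0} \<subseteq> V ` {0..p}"
      using IVT2'[of V p _ 0] Vc p by (force simp: image_iff)
  qed
  have Xc: "continuous_on {V p..V 0} X"
    using continuous_on_inv[OF Vc compact_Icc, of X] XV by (simp add: img)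
  have X': "(X has_vector_derivative - (1 / \<phi> v)) (at v)" if "v \<in> {V p<..<V 0}" for v
  proof -
    have "v \<in> V ` {0..p}" using that unfolding img by simp
    then obtain x where x: "x \<in> {0..p}" "v = V x" by blast
    then have "0 < x" "x < p" using that by (auto simp: less_le)
    then have "(X has_real_derivative inverse (P x)) (at (V x))"
      using neg[of x] V'[of x] XV
      by (intro DERIV_inverse_strong[of "{0<..<p}" x V X])
        (auto intro: continuous_on_subset[OF Vc])
    then show ?thesis using \<phi>[of x] \<open>0 < x\<close> \<open>x < p\<close> neg[of x] x(2)
      by (simp add: has_real_derivative_iff_has_vector_derivative[symmetric] inverse_eq_divide)
  qed
  have "((\<lambda>v. - (1 / \<phi> v)) has_integral (X (V 0) - X (V p))) {V p..V 0}"
    using mono[of 0 p] p by (intro fundamental_theorem_of_calculus_interior Xc X') auto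
  moreover have "X (V 0) = 0" "X (V p) = p" using XV p by auto
  ultimately have "((\<lambda>v. - (1 / \<phi> v)) has_integral - p) {V p..V 0}" by simp
  from has_integral_neg[OF this] show ?thesis by simp
qed

text \<open>The flow of \<open>V' = - \<phi> V\<close> with antitone \<open>\<phi>\<close> contracts distances backwards in time. So no
  Lipschitz condition is needed for uniqueness.\<close>

lemma backward_unique_antitone:
  fixes U V \<phi> :: "real \<Rightarrow> real"
  assumes anti: "\<And>u v. u \<in> S \<Longrightarrow> v \<in> S \<Longrightarrow> u \<le> v \<Longrightarrow> \<phi> v \<le> \<phi> u"
    and c: "continuous_on {0..p} U" "continuous_on {0..p} V"
    and U: "\<And>x. 0 < x \<Longrightarrow> x < p \<Longrightarrow> U x \<in> S \<and> (U has_real_derivative - \<phi> (U x)) (at x)"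
    and V: "\<And>x. 0 < x \<Longrightarrow> x < p \<Longrightarrow> V x \<in> S \<and> (V has_real_derivative - \<phi> (V x)) (at x)"
    and p: "U p = V p" and x: "0 \<le> x" "x \<le> p"
  shows "U x = V x"
proof -
  have "(\<lambda>x. (U x - V x)\<^sup>2) x \<le> (\<lambda>x. (U x - V x)\<^sup>2) p"
  proof (rule DERIV_nonneg_imp_increasing_open[OF x(2)])
    fix y assume y: "x < y" "y < p"
    have "(U y - V y) * (\<phi> (V y) - \<phi> (U y)) \<ge> 0"
      using anti[of "U y" "V y"] anti[of "V y" "U y"] U[of y] V[of y] x y
      by (cases "U y \<le> V y") (auto intro: mult_nonpos_nonpos mult_nonneg_nonneg)
    moreover have "((\<lambda>x. (U x - V x)\<^sup>2) has_real_derivative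
        2 * ((U y - V y) * (\<phi> (V y) - \<phi> (U y)))) (at y)"
      using U[of y] V[of y] x y by (auto intro!: derivative_eq_intros simp: algebra_simps)
    ultimately show "\<exists>z. ((\<lambda>x. (U x - V x)\<^sup>2) has_real_derivative z) (at y) \<and> z \<ge> 0"
      by (intro exI[of _ "2 * ((U y - V y) * (\<phi> (V y) - \<phi> (U y)))"]) auto
  next
    show "continuous_on {x..p} (\<lambda>x. (U x - V x)\<^sup>2)"
      by (intro continuous_intros continuous_on_subset[OF c(1)] continuous_on_subset[OF c(2)]) (use x in auto)
  qed
  then show ?thesis using p by simp
qed

section \<open>The two increasing branches\<close>

lemma smooth_on_subset: "smooth_on T f \<Longrightarrow> S \<subseteq> T \<Longrightarrow> smooth_on S f"
  by (auto simp: smooth_on_def)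

text \<open>The extension by constants makes both branch nonlinearities continuous on the whole line, so that
  the potentials are globally differentiable and no one-sided derivatives are needed.\<close>

definition clamped_inv :: "(real \<Rightarrow> real) \<Rightarrow> real \<Rightarrow> real \<Rightarrow> real \<Rightarrow> real" where
  "clamped_inv g l r v = inv_into {l..r} g (max (g l) (min v (g r)))"

context
  fixes g :: "real \<Rightarrow> real" and l r :: real
  assumes lr: "l < r" and cont: "continuous_on {l..r} g"
    and mono: "\<And>u v. l \<le> u \<Longrightarrow> u < v \<Longrightarrow> v \<le> r \<Longrightarrow> g u < g v"
begin

lemma clamped_inv_image: "g ` {l..r} = {g l..g r}"
proof
  show "g ` {l..r} \<subseteq> {g l..g r}"
    using mono[of l] mono[of _ r] lr by (auto simp: less_eq_real_def)
  show "{g l..g r} \<subseteq> g ` {l..r}"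
    using IVT'[of g l _ r] cont lr by (force simp: image_iff)
qed

lemma clamped_inv_inj: "inj_on g {l..r}"
  by (rule linorder_inj_onI') (use mono in force)

lemma clamped_inv_range: "clamped_inv g l r v \<in> {l..r}"
proof -
  have "max (g l) (min v (g r)) \<in> g ` {l..r}"
    using mono[OF order_refl lr order_refl] unfolding clamped_inv_image by auto
  then show ?thesis unfolding clamped_inv_def by (rule inv_into_into)
qed

lemma clamped_inv_eq: "v \<in> {g l..g r} \<Longrightarrow> clamped_inv g l r v = inv_into {l..r} g v"
  by (simp add: clamped_inv_def)

lemma f_clamped_inv: "v \<in> {g l..g r} \<Longrightarrow> g (clamped_inv g l r v) = v"
  using f_inv_into_f[of v g "{l..r}"] by (simp add: clamped_inv_eq clamped_inv_image)

lemma clamped_inv_f: "u \<in> {l..r} \<Longrightarrow> clamped_inv g l r (g u) = u"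
  using imageI[of u "{l..r}" g] clamped_inv_eq[of "g u"] inv_into_f_f[OF clamped_inv_inj, of u]
  unfolding clamped_inv_image by simp

lemma clamped_inv_strict_mono:
  assumes "g l \<le> v" "v < w" "w \<le> g r"
  shows "clamped_inv g l r v < clamped_inv g l r w"
proof (rule ccontr)
  assume "\<not> ?thesis"
  then have "g (clamped_inv g l r w) \<le> g (clamped_inv g l r v)"
    using mono[of "clamped_inv g l r w" "clamped_inv g l r v"] clamped_inv_range[of v] clamped_inv_range[of w]
    by (auto simp: less_eq_real_def not_less)
  then show False using assms f_clamped_inv[of v] f_clamped_inv[of w] by auto
qed

lemma continuous_on_clamped_inv: "continuous_on UNIV (clamped_inv g l r)"
proof -
  have "continuous_on {g l..g r} (inv_into {l..r} g)"
    using continuous_on_inv[OF cont compact_Icc, of "inv_into {l..r} g"] inv_into_f_f[OF clamped_inv_inj]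
    by (simp add: clamped_inv_image)
  moreover have "continuous_on UNIV (\<lambda>v. max (g l) (min v (g r)))" by (intro continuous_intros)
  ultimately show ?thesis
    unfolding clamped_inv_def
    by (rule continuous_on_compose2) (use mono[OF order_refl lr order_refl] in auto)
qed

lemma isCont_clamped_inv: "isCont (clamped_inv g l r) v"
  using continuous_on_clamped_inv by (simp add: continuous_on_eq_continuous_at)

lemma smooth_on_clamped_inv:
  assumes "smooth_on {l<..<r} g" "\<And>u. u \<in> {l<..<r} \<Longrightarrow> deriv g u \<noteq> 0"
  shows "smooth_on {g l<..<g r} (clamped_inv g l r)"
proof (rule smooth_on_inverse_function[OF _ _ assms(1) _ _ assms(2)])
  fix v assume v: "v \<in> {g l<..<g r}"
  have "clamped_inv g l r v \<noteq> l" "clamped_inv g l r v \<noteq> r"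
    using f_clamped_inv[of v] v by auto
  then show "clamped_inv g l r v \<in> {l<..<r} \<and> g (clamped_inv g l r v) = v"
    using f_clamped_inv[of v] clamped_inv_range[of v] v by auto
qed (auto simp: clamped_inv_f)

end

text \<open>\<open>integral {c..v} h\<close> is 0 for \<open>v < c\<close>, so it is not an
  antiderivative across \<open>c\<close>. The chosen function is differentiable on both sides of
  every point.\<close>

definition antiderivative_from :: "real \<Rightarrow> (real \<Rightarrow> real) \<Rightarrow> real \<Rightarrow> real" where
  "antiderivative_from c h = (SOME H. H c = 0 \<and> (\<forall>v. (H has_real_derivative h v) (at v)))"

lemma antiderivative_from:
  assumes "continuous_on UNIV h"
  shows "antiderivative_from c h c = 0" "(antiderivative_from c h has_real_derivative h v) (at v)"
proof -
  have "\<exists>F. \<forall>x::real. -\<infinity> < ereal x \<longrightarrow> x < \<infinity> \<longrightarrow> (F has_vector_derivative h x) (at x)"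
    using assms by (intro einterval_antiderivative) (auto simp: continuous_on_eq_continuous_at)
  then obtain F where F: "\<And>x. (F has_real_derivative h x) (at x)"
    by (auto simp: has_real_derivative_iff_has_vector_derivative)
  have "\<exists>H. H c = 0 \<and> (\<forall>v. (H has_real_derivative h v) (at v))"
    using F by (intro exI[of _ "\<lambda>x. F x - F c"]) (auto intro!: derivative_eq_intros)
  then have "antiderivative_from c h c = 0 \<and> (\<forall>v. (antiderivative_from c h has_real_derivative h v) (at v))"
    unfolding antiderivative_from_def by (rule someI_ex)
  then show "antiderivative_from c h c = 0" "(antiderivative_from c h has_real_derivative h v) (at v)" by auto
qed

lemma integral_eq_antiderivative:
  fixes H :: "real \<Rightarrow> real"
  assumes "\<And>v. (H has_real_derivative h v) (at v)" "x \<le> y" "\<And>v. v \<in> {x..y} \<Longrightarrow> k v = h v"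
  shows "integral {x..y} k = H y - H x"
proof -
  have "(h has_integral (H y - H x)) {x..y}"
    using assms(1) by (intro fundamental_theorem_of_calculus assms(2))
      (auto simp: has_real_derivative_iff_has_vector_derivative intro: has_vector_derivative_at_within)
  then have "(k has_integral (H y - H x)) {x..y}"
    by (rule has_integral_eq[rotated]) (simp add: assms(3))
  then show ?thesis by (rule integral_unique)
qed

lemma DERIV_pos_imp_less:
  fixes F F' :: "real \<Rightarrow> real"
  assumes "u < v" "\<And>x. (F has_real_derivative F' x) (at x)" "\<And>x. u < x \<Longrightarrow> x < v \<Longrightarrow> 0 < F' x"
  shows "F u < F v"
  using assms(1)
proof (rule DERIV_pos_imp_increasing_open)
  show "continuous_on {u..v} F"
    using assms(2) by (meson DERIV_isCont continuous_at_imp_continuous_on)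
qed (use assms(2,3) in blast)

lemma DERIV_neg_imp_greater:
  fixes F F' :: "real \<Rightarrow> real"
  assumes "u < v" "\<And>x. (F has_real_derivative F' x) (at x)" "\<And>x. u < x \<Longrightarrow> x < v \<Longrightarrow> F' x < 0"
  shows "F v < F u"
  using DERIV_pos_imp_less[OF assms(1), of "\<lambda>x. - F x" "\<lambda>x. - F' x"] assms(2,3)
  by (auto intro: DERIV_minus)

section \<open>The hypotheses on \<open>f\<close> and \<open>g\<close>, and the shape of the two
  potentials\<close>

locale bistable =
  fixes f g :: "real \<Rightarrow> real" and d a \<beta> \<gamma> :: real
  assumes d: "d > 0"
    and f_smooth: "smooth_on UNIV f"
    and a: "0 < a" "a < 1"
    and f_zero: "f 0 = 0" "f a = 0" "f 1 = 0"
    and f_neg: "\<forall>u\<in>{0<..<a}. f u < 0"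
    and f_pos: "\<forall>u\<in>{a<..<1}. f u > 0"
    and f'0: "deriv f 0 < 0"
    and g_def: "g = (\<lambda>u. u - f u / d)"
    and \<beta>\<gamma>: "0 < \<beta>" "\<beta> < \<gamma>" "\<gamma> < 1"
    and g'_pos: "\<forall>u\<in>{0..<\<beta>} \<union> {\<gamma><..1}. deriv g u > 0"
    and G_minus_top: "G_minus g \<beta> (g \<beta>) = 0"
begin

lemma f_deriv: "(f has_real_derivative deriv f x) (at x)"
  using f_smooth unfolding smooth_on_def
  by (metis DERIV_deriv_iff_real_differentiable UNIV_I funpow_0)

lemma g_smooth: "smooth_on UNIV g"
proof -
  have "times_differentiable_on n UNIV g" for n
    using f_smooth times_differentiable_on_diff[OF times_differentiable_on_id
        times_differentiable_on_mult[OF _ times_differentiable_on_const[of _ _ "1 / d"]], of n UNIV f]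
    by (simp add: g_def smooth_on_iff_times_differentiable)
  then show ?thesis by (simp add: smooth_on_iff_times_differentiable)
qed

lemma g_deriv: "(g has_real_derivative deriv g x) (at x)"
  using g_smooth unfolding smooth_on_def
  by (metis DERIV_deriv_iff_real_differentiable UNIV_I funpow_0)

lemma isCont_g: "isCont g x"
  using g_deriv by (rule DERIV_isCont)

lemma continuous_on_g: "continuous_on S g"
  using isCont_g continuous_at_imp_continuous_on by blast

lemma g_values [simp]: "g 0 = 0" "g a = a" "g 1 = 1"
  using f_zero by (auto simp: g_def)

lemma g_gt: "0 < u \<Longrightarrow> u < a \<Longrightarrow> u < g u"
  using f_neg d by (auto simp: g_def divide_neg_pos)

lemma g_lt: "a < u \<Longrightarrow> u < 1 \<Longrightarrow> g u < u"
  using f_pos d by (auto simp: g_def)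

lemma g_mono_minus: "0 \<le> u \<Longrightarrow> u < v \<Longrightarrow> v \<le> \<beta> \<Longrightarrow> g u < g v"
  by (rule DERIV_pos_imp_less[OF _ g_deriv]) (use g'_pos in auto)

lemma g_mono_plus: "\<gamma> \<le> u \<Longrightarrow> u < v \<Longrightarrow> v \<le> 1 \<Longrightarrow> g u < g v"
  by (rule DERIV_pos_imp_less[OF _ g_deriv]) (use g'_pos in auto)

lemma g_\<beta>_pos: "0 < g \<beta>" using g_mono_minus[of 0 \<beta>] \<beta>\<gamma> by simp

text \<open>\<open>hm\<close>, \<open>hp\<close>, \<open>Gm\<close>, \<open>Gp\<close> are global versions of \<open>g_minus_inv\<close>, \<open>g_plus_inv\<close>, \<open>G_minus\<close>, \<open>G_plus\<close>.\<close>

definition hm :: "real \<Rightarrow> real" where "hm = clamped_inv g 0 \<beta>"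

definition hp :: "real \<Rightarrow> real" where "hp = clamped_inv g \<gamma> 1"

lemmas hm_facts = \<beta>\<gamma>(1) continuous_on_g g_mono_minus
lemmas hp_facts = \<beta>\<gamma>(3) continuous_on_g g_mono_plus

lemma hm_range: "0 \<le> hm v" "hm v \<le> \<beta>"
  using clamped_inv_range[OF hm_facts] by (auto simp: hm_def)

lemma hp_range: "\<gamma> \<le> hp v" "hp v \<le> 1"
  using clamped_inv_range[OF hp_facts] by (auto simp: hp_def)

lemma g_minus_inv_eq: "v \<in> {0..g \<beta>} \<Longrightarrow> g_minus_inv g \<beta> v = hm v"
  using clamped_inv_eq[OF hm_facts, of v] by (simp add: hm_def g_minus_inv_def)

lemma g_plus_inv_eq: "v \<in> {g \<gamma>..1} \<Longrightarrow> g_plus_inv g \<gamma> v = hp v"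
  using clamped_inv_eq[OF hp_facts, of v] by (simp add: hp_def g_plus_inv_def)

lemma g_hm: "v \<in> {0..g \<beta>} \<Longrightarrow> g (hm v) = v"
  using f_clamped_inv[OF hm_facts, of v] by (simp add: hm_def)

lemma g_hp: "v \<in> {g \<gamma>..1} \<Longrightarrow> g (hp v) = v"
  using f_clamped_inv[OF hp_facts, of v] by (simp add: hp_def)

lemma hm_g: "u \<in> {0..\<beta>} \<Longrightarrow> hm (g u) = u"
  using clamped_inv_f[OF hm_facts, of u] by (simp add: hm_def)

lemma hp_g: "u \<in> {\<gamma>..1} \<Longrightarrow> hp (g u) = u"
  using clamped_inv_f[OF hp_facts, of u] by (simp add: hp_def)

lemma hm_0 [simp]: "hm 0 = 0"
  using hm_g[of 0] \<beta>\<gamma> by simp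

lemma g_range_minus: "u \<in> {0..\<beta>} \<Longrightarrow> g u \<in> {0..g \<beta>}"
  using clamped_inv_image[OF hm_facts] by auto

lemma g_range_plus: "u \<in> {\<gamma>..1} \<Longrightarrow> g u \<in> {g \<gamma>..1}"
  using clamped_inv_image[OF hp_facts] by auto

lemma hm_pos: "0 < v \<Longrightarrow> v \<le> g \<beta> \<Longrightarrow> 0 < hm v"
  using clamped_inv_strict_mono[OF hm_facts, of 0 v] hm_0 by (simp add: hm_def)

lemma isCont_hm: "isCont hm v" and isCont_hp: "isCont hp v"
  using isCont_clamped_inv[OF hm_facts] isCont_clamped_inv[OF hp_facts]
  by (auto simp: hm_def hp_def)

lemma continuous_hm: "continuous_on UNIV hm" and continuous_hp: "continuous_on UNIV hp"
  using isCont_hm isCont_hp by (auto simp: continuous_on_eq_continuous_at)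

lemma smooth_hm: "smooth_on {0<..<g \<beta>} hm"
proof -
  have "smooth_on {0<..<\<beta>} g" using g_smooth by (rule smooth_on_subset) simp
  moreover have "deriv g u \<noteq> 0" if "u \<in> {0<..<\<beta>}" for u using bspec[OF g'_pos, of u] that by auto
  ultimately show ?thesis using smooth_on_clamped_inv[OF hm_facts] by (simp add: hm_def)
qed

lemma smooth_hp: "smooth_on {g \<gamma><..<1} hp"
proof -
  have "smooth_on {\<gamma><..<1} g" using g_smooth by (rule smooth_on_subset) simp
  moreover have "deriv g u \<noteq> 0" if "u \<in> {\<gamma><..<1}" for u using bspec[OF g'_pos, of u] that by auto
  ultimately show ?thesis using smooth_on_clamped_inv[OF hp_facts] by (simp add: hp_def)
qed

definition Gm :: "real \<Rightarrow> real" where "Gm v = - v\<^sup>2 / 2 + antiderivative_from 0 hm v"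

definition Gp :: "real \<Rightarrow> real" where "Gp v = - v\<^sup>2 / 2 + antiderivative_from 1 hp v"

lemma Gm_deriv: "(Gm has_real_derivative hm v - v) (at v)"
  unfolding Gm_def using antiderivative_from(2)[OF continuous_hm]
  by (auto intro!: derivative_eq_intros)

lemma Gp_deriv: "(Gp has_real_derivative hp v - v) (at v)"
  unfolding Gp_def using antiderivative_from(2)[OF continuous_hp]
  by (auto intro!: derivative_eq_intros)

lemma isCont_Gm: "isCont Gm v" and isCont_Gp: "isCont Gp v"
  using Gm_deriv Gp_deriv DERIV_isCont by blast+

lemma continuous_on_Gm: "continuous_on S Gm" and continuous_on_Gp: "continuous_on S Gp"
  using isCont_Gm isCont_Gp continuous_at_imp_continuous_on by blast+

lemma Gm_0 [simp]: "Gm 0 = 0"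
  by (simp add: Gm_def antiderivative_from(1)[OF continuous_hm])

lemma G_minus_eq: "v \<in> {0..g \<beta>} \<Longrightarrow> G_minus g \<beta> v = Gm v"
  using integral_eq_antiderivative[OF antiderivative_from(2)[OF continuous_hm], of 0 v "g_minus_inv g \<beta>" 0]
  by (auto simp: G_minus_def Gm_def g_minus_inv_eq antiderivative_from(1)[OF continuous_hm])

lemma G_plus_eq: "v \<in> {g \<gamma>..1} \<Longrightarrow> G_plus g \<gamma> v = Gp v"
  using integral_eq_antiderivative[OF antiderivative_from(2)[OF continuous_hp], of v 1 "g_plus_inv g \<gamma>" 1]
  by (auto simp: G_plus_def Gp_def g_plus_inv_eq antiderivative_from(1)[OF continuous_hp])

lemma Gm_top [simp]: "Gm (g \<beta>) = 0"
  using G_minus_top G_minus_eq[of "g \<beta>"] g_\<beta>_pos by simp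

text \<open>If \<open>\<beta> \<le> a\<close>, then \<open>g u > u\<close> on
  \<open>(0, \<beta>)\<close> gives \<open>hm v < v\<close> on \<open>(0, g \<beta>)\<close>, and
  \<open>Gm\<close> falls strictly from 0, against \<open>Gm (g \<beta>) = 0\<close>. So that
  equation puts the middle zero \<open>a\<close> on the lower branch.\<close>

lemma a_less_\<beta>: "a < \<beta>"
proof (rule ccontr)
  assume "\<not> a < \<beta>"
  have "Gm (g \<beta>) < Gm 0"
  proof (rule DERIV_neg_imp_greater[OF g_\<beta>_pos Gm_deriv])
    fix v assume v: "0 < v" "v < g \<beta>"
    have "hm v \<noteq> \<beta>" using g_hm[of v] v by auto
    then have "hm v < g (hm v)"
      using hm_pos[of v] hm_range[of v] v \<open>\<not> a < \<beta>\<close> by (intro g_gt) auto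
    then show "hm v - v < 0" using g_hm[of v] v by simp
  qed
  then show False by simp
qed

lemma a_less_g_\<beta>: "a < g \<beta>" using g_mono_minus[of a \<beta>] a_less_\<beta> a by simp

lemma g_\<beta>_less: "g \<beta> < \<beta>" using g_lt[of \<beta>] a_less_\<beta> \<beta>\<gamma> by simp

lemma hm_less: "0 < v \<Longrightarrow> v < a \<Longrightarrow> hm v < v"
proof -
  assume v: "0 < v" "v < a"
  then have *: "g (hm v) = v" using a_less_g_\<beta> by (intro g_hm) auto
  have "hm v < a"
  proof (rule ccontr)
    assume "\<not> hm v < a"
    then have "g a \<le> g (hm v)"
      using g_mono_minus[of a "hm v"] hm_range[of v] a by (cases "a = hm v") auto
    then show False using * v by simp
  qed
  then show ?thesis using g_gt[of "hm v"] hm_pos[of v] v * a_less_g_\<beta> by simp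
qed

lemma hm_greater: "a < v \<Longrightarrow> v \<le> g \<beta> \<Longrightarrow> v < hm v"
proof -
  assume v: "a < v" "v \<le> g \<beta>"
  then have *: "g (hm v) = v" using a by (intro g_hm) auto
  have "a < hm v"
  proof (rule ccontr)
    assume "\<not> a < hm v"
    then have "g (hm v) \<le> g a"
      using g_mono_minus[of "hm v" a] hm_range[of v] a_less_\<beta> by (cases "a = hm v") auto
    then show False using * v by simp
  qed
  then show ?thesis using g_lt[of "hm v"] hm_range[of v] \<beta>\<gamma> * by simp
qed

text \<open>A single well: the slope \<open>hm v - v\<close> is negative on \<open>(0, a)\<close>
  and positive on \<open>(a, g \<beta>)\<close>, and \<open>Gm\<close> vanishes at both
  ends.\<close>

lemma Gm_neg: assumes "0 < v" "v < g \<beta>" shows "Gm v < 0"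
proof (cases "v \<le> a")
  case True
  have "Gm v < Gm 0"
    by (rule DERIV_neg_imp_greater[OF assms(1) Gm_deriv]) (use hm_less True in auto)
  then show ?thesis by simp
next
  case False
  have "Gm v < Gm (g \<beta>)"
    by (rule DERIV_pos_imp_less[OF assms(2) Gm_deriv]) (use hm_greater False in auto)
  then show ?thesis by simp
qed

text \<open>\<open>hm\<close> is nonnegative, hence so is the integral part of \<open>Gm\<close>. At
  zero energy this becomes a speed limit: the modulus of \<open>P\<close> is at most
  \<open>V\<close>.\<close>

lemma Gm_lower: assumes "0 \<le> v" shows "- 2 * Gm v \<le> v\<^sup>2"
proof -
  have "antiderivative_from 0 hm 0 \<le> antiderivative_from 0 hm v"
    by (rule DERIV_nonneg_imp_nondecreasing[OF assms])
      (use hm_range(1) antiderivative_from(2)[OF continuous_hm] in blast)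
  then show ?thesis by (simp add: Gm_def antiderivative_from(1)[OF continuous_hm])
qed

text \<open>Below \<open>g \<gamma>\<close> the clamped inverse is still at least
  \<open>\<gamma>\<close>, which exceeds \<open>g \<gamma>\<close>. Hence \<open>Gp\<close>
  increases on the whole half-line up to 1.\<close>

lemma hp_greater: assumes "v < 1" shows "v < hp v"
proof (cases "g \<gamma> \<le> v")
  case True
  then have *: "g (hp v) = v" using assms by (intro g_hp) auto
  then have "hp v \<noteq> 1" using assms by auto
  then show ?thesis using g_lt[of "hp v"] hp_range[of v] a_less_\<beta> \<beta>\<gamma> * by auto
next
  case False
  then show ?thesis using g_lt[of \<gamma>] a_less_\<beta> \<beta>\<gamma> hp_range[of v] by auto
qed

lemma Gp_strict_mono: "u < v \<Longrightarrow> v \<le> 1 \<Longrightarrow> Gp u < Gp v"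
  by (rule DERIV_pos_imp_less[OF _ Gp_deriv]) (use hp_greater in auto)

text \<open>\<open>Gp - Gm\<close> has slope \<open>hp - hm \<ge> \<gamma> - \<beta>\<close>, so the
  extreme case is \<open>v = g \<beta>\<close>, where \<open>Gm\<close> vanishes and
  \<open>Gp (g \<beta>) < Gp 1\<close> remains.\<close>

lemma energy_less_Gp_1: assumes "0 \<le> v" "v \<le> g \<beta>" shows "Gp v - Gm v < Gp 1"
proof -
  have "Gp v - Gm v \<le> Gp (g \<beta>) - Gm (g \<beta>)"
  proof (rule DERIV_nonneg_imp_nondecreasing[OF assms(2)])
    fix x
    have "((\<lambda>v. Gp v - Gm v) has_real_derivative (hp x - x) - (hm x - x)) (at x)"
      by (rule DERIV_diff[OF Gp_deriv Gm_deriv])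
    moreover have "0 \<le> (hp x - x) - (hm x - x)" using hp_range[of x] hm_range[of x] \<beta>\<gamma> by auto
    ultimately show "\<exists>y. ((\<lambda>v. Gp v - Gm v) has_real_derivative y) (at x) \<and> 0 \<le> y" by blast
  qed
  also have "\<dots> < Gp 1" using Gp_strict_mono[of "g \<beta>" 1] g_\<beta>_less \<beta>\<gamma> by simp
  finally show ?thesis .
qed

end

section \<open>The homoclinic orbit and the outer profile\<close>

lemma even_extension_deriv:
  fixes V P :: "real \<Rightarrow> real"
  assumes "(V has_real_derivative D) (at \<bar>x\<bar>)" "x \<noteq> 0"
  shows "((\<lambda>y. V \<bar>y\<bar>) has_real_derivative sgn x * D) (at x)"
    and "((\<lambda>y. sgn y * V \<bar>y\<bar>) has_real_derivative D) (at x)"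
proof -
  have ev: "eventually (\<lambda>y. sgn y = sgn x) (nhds x)"
  proof (cases "x > 0")
    case True
    have "eventually (\<lambda>y. y \<in> {0<..}) (nhds x)" using True by (intro eventually_nhds_in_open) auto
    then show ?thesis using True by (auto elim: eventually_mono)
  next
    case False
    have "eventually (\<lambda>y. y \<in> {..<0}) (nhds x)"
      using False assms by (intro eventually_nhds_in_open) auto
    then show ?thesis using False assms by (auto elim: eventually_mono)
  qed
  have "\<bar>x\<bar> = sgn x * x" by (simp add: sgn_if)
  then have "((\<lambda>y. V (sgn x * y)) has_real_derivative D * sgn x) (at x)"
    using assms by (intro DERIV_chain2[of V]) (auto intro!: derivative_eq_intros)
  then have *: "((\<lambda>y. V (sgn x * y)) has_real_derivative sgn x * D) (at x)"
    by (simp add: mult.commute)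
  have ev1: "eventually (\<lambda>y. V (sgn x * y) = V \<bar>y\<bar>) (nhds x)"
    using ev by eventually_elim (simp add: abs_sgn mult.commute)
  show "((\<lambda>y. V \<bar>y\<bar>) has_real_derivative sgn x * D) (at x)"
    using * by (subst (asm) DERIV_cong_ev[OF refl ev1 refl])
  have "((\<lambda>y. sgn x * V (sgn x * y)) has_real_derivative sgn x * (sgn x * D)) (at x)"
    using * by (rule DERIV_cmult)
  moreover have "sgn x * (sgn x * D) = D" using assms(2) by (simp add: sgn_if)
  moreover have ev2: "eventually (\<lambda>y. sgn x * V (sgn x * y) = sgn y * V \<bar>y\<bar>) (nhds x)"
    using ev by eventually_elim (simp add: abs_sgn mult.commute)
  ultimately show "((\<lambda>y. sgn y * V \<bar>y\<bar>) has_real_derivative D) (at x)"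
    using DERIV_cong_ev[OF refl ev2 refl] by metis
qed

lemma DERIV_within_interior:
  fixes F :: "real \<Rightarrow> real"
  assumes "(F has_real_derivative D) (at x within S)" "open T" "T \<subseteq> S" "x \<in> T"
  shows "(F has_real_derivative D) (at x)"
  using has_field_derivative_subset[OF assms(1,3)] at_within_open[OF assms(4,2)] by simp

lemma DERIV_within_continuous_on:
  fixes F :: "real \<Rightarrow> real"
  assumes "\<And>x. x \<in> S \<Longrightarrow> (F has_real_derivative D x) (at x within T)" "S \<subseteq> T"
  shows "continuous_on S F"
  by (rule DERIV_continuous_on) (rule has_field_derivative_subset[OF assms])

lemma first_zero:
  fixes P :: "real \<Rightarrow> real"
  assumes "continuous_on {s..t} P" "s \<le> t" "P s < 0" "0 \<le> P t"
  obtains y where "s < y" "y \<le> t" "P y = 0" "\<And>x. s \<le> x \<Longrightarrow> x < y \<Longrightarrow> P x < 0"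
proof -
  define Z where "Z = {s..t} \<inter> P -` {0}"
  have "closed Z" unfolding Z_def using assms(1) by (intro continuous_closed_preimage) auto
  moreover have "bounded Z" unfolding Z_def by (rule bounded_subset[OF bounded_closed_interval[of s t]]) auto
  ultimately have "compact Z" by (simp add: compact_eq_bounded_closed)
  have "Z \<noteq> {}" using IVT'[of P s 0 t] assms by (auto simp: Z_def)
  obtain y where y: "y \<in> Z" "\<And>x. x \<in> Z \<Longrightarrow> y \<le> x"
    using compact_attains_inf[OF \<open>compact Z\<close> \<open>Z \<noteq> {}\<close>] by blast
  show ?thesis
  proof (rule that)
    show "s < y" using y(1) assms(3) by (cases "s = y") (auto simp: Z_def)
    show "y \<le> t" "P y = 0" using y(1) by (auto simp: Z_def)
    show "P x < 0" if x: "s \<le> x" "x < y" for x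
    proof (rule ccontr)
      assume "\<not> P x < 0"
      moreover have "continuous_on {s..x} P"
        using x y(1) by (intro continuous_on_subset[OF assms(1)]) (auto simp: Z_def)
      ultimately obtain z where "s \<le> z" "z \<le> x" "P z = 0"
        using IVT'[of P s 0 x] x assms(3) by auto
      then show False using y(2)[of z] y(1) x by (auto simp: Z_def)
    qed
  qed
qed

context bistable
begin

text \<open>\<open>Y\<close> is the inverse of \<open>V\<close> on \<open>[0, \<infinity>)\<close>.\<close>

definition is_homoclinic :: "(real \<Rightarrow> real) \<Rightarrow> (real \<Rightarrow> real) \<Rightarrow> (real \<Rightarrow> real) \<Rightarrow> bool" where
  "is_homoclinic V P Y \<longleftrightarrow> V 0 = g \<beta> \<and>
     (\<forall>x. V (- x) = V x \<and> P (- x) = - P x \<and> (V has_real_derivative P x) (at x) \<and>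
          (P has_real_derivative V x - hm (V x)) (at x) \<and> (P x)\<^sup>2 / 2 + Gm (V x) = 0 \<and>
          0 < V x \<and> V x \<le> g \<beta>) \<and>
     (\<forall>x>0. P x < 0) \<and> (\<forall>v. 0 < v \<and> v \<le> g \<beta> \<longrightarrow> 0 \<le> Y v \<and> V (Y v) = v) \<and>
     (\<forall>v. 0 < v \<and> v < g \<beta> \<longrightarrow> (Y has_real_derivative 1 / P (Y v)) (at v))"

lemma abs_speed_le:
  assumes "p\<^sup>2 / 2 + Gm v = 0" "0 \<le> v" shows "\<bar>p\<bar> \<le> v"
proof -
  have "p\<^sup>2 \<le> v\<^sup>2" using Gm_lower[OF assms(2)] assms(1) by linarith
  then show ?thesis using assms(2) abs_le_square_iff[of p v] by simp
qed

text \<open>\<open>P \<ge> - V\<close> makes \<open>V x * exp x\<close> nondecreasing, so an orbit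
  obeying the speed limit cannot reach 0 in finite time.\<close>

lemma exp_decay_bound:
  fixes V P :: "real \<Rightarrow> real"
  assumes "s \<le> t" "continuous_on {s..t} V"
    and "\<And>x. s < x \<Longrightarrow> x < t \<Longrightarrow> (V has_real_derivative P x) (at x) \<and> \<bar>P x\<bar> \<le> V x"
  shows "V s * exp (s - t) \<le> V t"
proof -
  have "V s * exp s \<le> V t * exp t"
  proof (rule DERIV_nonneg_imp_increasing_open[OF assms(1), of "\<lambda>x. V x * exp x"])
    fix x assume x: "s < x" "x < t"
    have "((\<lambda>x. V x * exp x) has_real_derivative (P x + V x) * exp x) (at x)"
      using assms(3)[OF x] by (auto intro!: derivative_eq_intros simp: algebra_simps)
    moreover have "0 \<le> (P x + V x) * exp x" using assms(3)[OF x] by (intro mult_nonneg_nonneg) auto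
    ultimately show "\<exists>y. ((\<lambda>x. V x * exp x) has_real_derivative y) (at x) \<and> 0 \<le> y" by blast
  next
    show "continuous_on {s..t} (\<lambda>x. V x * exp x)" by (intro continuous_intros assms(2))
  qed
  then have "V s * exp s * exp (- t) \<le> V t * exp t * exp (- t)" by (rule mult_right_mono) simp
  then show ?thesis by (simp add: exp_diff exp_minus field_simps)
qed

text \<open>The quadrature yields an orbit on some interval \<open>I\<close>. If \<open>I\<close>
  were bounded, the exponential lower bound would keep \<open>V\<close> away from 0 on
  \<open>I\<close>, although \<open>V\<close> attains there every height in
  \<open>(0, g \<beta>]\<close>.\<close>

lemma homoclinic_exists: "\<exists>V P Y. is_homoclinic V P Y"
proof -
  obtain I V P Y where I: "open I" "is_interval I" "0 \<in> I" "V 0 = g \<beta>"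
    "\<And>x. x \<in> I \<Longrightarrow> - x \<in> I" "\<And>x. x \<in> I \<Longrightarrow> V (- x) = V x" "\<And>x. x \<in> I \<Longrightarrow> P (- x) = - P x"
    "\<And>x. x \<in> I \<Longrightarrow> (V has_real_derivative P x) (at x)"
    "\<And>x. x \<in> I \<Longrightarrow> (P has_real_derivative - (hm (V x) - V x)) (at x)"
    "\<And>x. x \<in> I \<Longrightarrow> (P x)\<^sup>2 / 2 + Gm (V x) = Gm (g \<beta>)"
    "\<And>x. x \<in> I \<Longrightarrow> 0 < V x \<and> V x \<le> g \<beta>"
    "\<And>x. x \<in> I \<Longrightarrow> 0 < x \<Longrightarrow> P x < 0"
    "\<And>v. 0 < v \<Longrightarrow> v \<le> g \<beta> \<Longrightarrow> Y v \<in> I \<and> 0 \<le> Y v \<and> V (Y v) = v"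
    "\<And>v. 0 < v \<Longrightarrow> v < g \<beta> \<Longrightarrow> (Y has_real_derivative 1 / P (Y v)) (at v)"
    by (rule peak_solution[of Gm "\<lambda>v. hm v - v" 0 "g \<beta>"])
      (auto intro: Gm_deriv continuous_intros continuous_hm g_\<beta>_pos Gm_neg hm_greater a_less_g_\<beta>)
  have "x \<in> I" if "0 \<le> x" for x
  proof (rule ccontr)
    assume x: "x \<notin> I"
    have less: "y < x" if "y \<in> I" for y
      using mem_is_interval_1_I[OF I(2) I(3) that, of x] x \<open>0 \<le> x\<close> by (cases "y < x") auto
    \<comment> \<open>\<open>c\<close> is the lower bound for \<open>V\<close> on
      \<open>[0, x)\<close>; the contradiction comes from the height \<open>c / 2\<close>, attained
      before time \<open>x\<close>.\<close>
    define c where "c = g \<beta> * exp (- x)"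
    have c: "0 < c" "c \<le> g \<beta>" using g_\<beta>_pos \<open>0 \<le> x\<close> by (auto simp: c_def)
    then have Y: "Y (c / 2) \<in> I" "0 \<le> Y (c / 2)" "V (Y (c / 2)) = c / 2" using I(13)[of "c / 2"] by auto
    have sub: "y \<in> I" if "0 \<le> y" "y \<le> Y (c / 2)" for y
      using mem_is_interval_1_I[OF I(2) I(3) Y(1)] that by auto
    have "V 0 * exp (0 - Y (c / 2)) \<le> V (Y (c / 2))"
    proof (rule exp_decay_bound[OF Y(2)])
      show "continuous_on {0..Y (c / 2)} V"
        using DERIV_isCont[OF I(8)[OF sub]] by (intro continuous_at_imp_continuous_on) auto
      show "(V has_real_derivative P y) (at y) \<and> \<bar>P y\<bar> \<le> V y" if "0 < y" "y < Y (c / 2)" for y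
        using I(8)[OF sub[of y]] I(10,11)[OF sub[of y]] that by (auto intro!: abs_speed_le)
    qed
    moreover have "c < g \<beta> * exp (- Y (c / 2))"
      using less[OF Y(1)] g_\<beta>_pos by (simp add: c_def)
    ultimately show False using Y(3) I(4) c by simp
  qed
  then have UNIV: "x \<in> I" for x using I(5)[of "- x"] by (cases "0 \<le> x") auto
  have "is_homoclinic V P Y"
    unfolding is_homoclinic_def using I UNIV by auto
  then show ?thesis by blast
qed

section \<open>The chosen homoclinic and the orbits that descend along it\<close>

definition Vc :: "real \<Rightarrow> real" where "Vc = (SOME V. \<exists>P Y. is_homoclinic V P Y)"
definition Pc :: "real \<Rightarrow> real" where "Pc = (SOME P. \<exists>Y. is_homoclinic Vc P Y)"
definition Yc :: "real \<Rightarrow> real" where "Yc = (SOME Y. is_homoclinic Vc Pc Y)"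

lemma homoclinic: "is_homoclinic Vc Pc Yc"
proof -
  have "\<exists>P Y. is_homoclinic Vc P Y" unfolding Vc_def by (rule someI_ex[OF homoclinic_exists])
  then have "\<exists>Y. is_homoclinic Vc Pc Y" unfolding Pc_def by (rule someI_ex)
  then show ?thesis unfolding Yc_def by (rule someI_ex)
qed

lemma Vc_0 [simp]: "Vc 0 = g \<beta>"
  and Vc_even: "Vc (- x) = Vc x" and Pc_odd: "Pc (- x) = - Pc x"
  and Vc_deriv: "(Vc has_real_derivative Pc x) (at x)"
  and Pc_deriv: "(Pc has_real_derivative Vc x - hm (Vc x)) (at x)"
  and Vc_energy: "(Pc x)\<^sup>2 / 2 + Gm (Vc x) = 0"
  and Vc_pos: "0 < Vc x" and Vc_le: "Vc x \<le> g \<beta>"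
  and Pc_neg: "0 < x \<Longrightarrow> Pc x < 0"
  and Yc: "0 < v \<Longrightarrow> v \<le> g \<beta> \<Longrightarrow> 0 \<le> Yc v" "0 < v \<Longrightarrow> v \<le> g \<beta> \<Longrightarrow> Vc (Yc v) = v"
  and Yc_deriv: "0 < v \<Longrightarrow> v < g \<beta> \<Longrightarrow> (Yc has_real_derivative 1 / Pc (Yc v)) (at v)"
  using homoclinic by (auto simp: is_homoclinic_def)

lemma Vc_strict_anti: "0 \<le> x \<Longrightarrow> x < y \<Longrightarrow> Vc y < Vc x"
  by (rule DERIV_neg_imp_greater[OF _ Vc_deriv]) (auto intro: Pc_neg)

lemma Vc_less: "x \<noteq> 0 \<Longrightarrow> Vc x < g \<beta>"
  using Vc_strict_anti[of 0 "\<bar>x\<bar>"] Vc_even[of x] by (cases "x < 0") auto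

lemma Yc_pos: "0 < v \<Longrightarrow> v < g \<beta> \<Longrightarrow> 0 < Yc v"
  using Yc[of v] by (cases "Yc v = 0") auto

lemma Yc_Vc: assumes "0 \<le> x" shows "Yc (Vc x) = x"
  using Yc[OF Vc_pos Vc_le, of x] Vc_strict_anti[of x "Yc (Vc x)"] Vc_strict_anti[of "Yc (Vc x)" x] assms
  by (cases x "Yc (Vc x)" rule: linorder_cases) auto

lemma isCont_Vc: "isCont Vc x" and isCont_Pc: "isCont Pc x"
  using Vc_deriv Pc_deriv DERIV_isCont by blast+

lemma Vc_tendsto_0: "(Vc \<longlongrightarrow> 0) at_top"
proof (rule order_tendstoI)
  fix e :: real assume "0 < e"
  define v where "v = min e (g \<beta>)"
  have v: "0 < v" "v \<le> g \<beta>" "v \<le> e" using \<open>0 < e\<close> g_\<beta>_pos by (auto simp: v_def)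
  show "eventually (\<lambda>x. Vc x < e) at_top"
    using eventually_gt_at_top[of "Yc v"]
  proof eventually_elim
    case (elim x)
    then show ?case using Vc_strict_anti[of "Yc v" x] Yc[of v] v by auto
  qed
qed (use Vc_pos in \<open>auto intro: always_eventually less_trans\<close>)

text \<open>\<open>Yc\<close> is an antiderivative of \<open>- 1 / sqrt (- 2 * Gm v)\<close>, so it linearizes every solution that
  descends with zero energy.\<close>

lemma descending_is_translate:
  assumes V: "\<And>x. q < x \<Longrightarrow> (V has_real_derivative P x) (at x) \<and> 0 < V x \<and> V x < g \<beta> \<and> P x < 0 \<and>
    (P x)\<^sup>2 / 2 + Gm (V x) = 0"
  obtains s where "s \<le> q" "\<And>x. q < x \<Longrightarrow> V x = Vc (x - s)"
proof -
  define Z where "Z = (\<lambda>x. Yc (V x) - x)"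
  have Z': "(Z has_real_derivative 0) (at x)" if "q < x" for x
  proof -
    note Vx = V[OF that]
    \<comment> \<open>Both speeds belong to zero energy at the same height and both are negative, so
      they coincide.\<close>
    have "(Pc (Yc (V x)))\<^sup>2 = (P x)\<^sup>2"
      using Vc_energy[of "Yc (V x)"] Vx Yc[of "V x"] by simp
    then have "Pc (Yc (V x)) = P x"
      using Vx Pc_neg[OF Yc_pos[of "V x"]] by (auto simp: power2_eq_iff)
    moreover have "((\<lambda>x. Yc (V x)) has_real_derivative 1 / Pc (Yc (V x)) * P x) (at x)"
      using Vx by (intro DERIV_chain2[of Yc] Yc_deriv) auto
    ultimately show ?thesis unfolding Z_def using Vx by (auto intro!: derivative_eq_intros)
  qed
  have const: "Z x = Z y" if "q < x" "q < y" for x y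
    by (rule DERIV_isconst3[of q "max x y + 1"]) (use that Z' in auto)
  define s where "s = - Z (q + 1)"
  have Y: "Yc (V x) = x - s" if "q < x" for x
    using const[OF that, of "q + 1"] by (simp add: Z_def s_def)
  show ?thesis
  proof
    show "V x = Vc (x - s)" if "q < x" for x
      using Y[OF that] Yc(2)[of "V x"] V[OF that] by simp
    have "s \<le> x" if "q < x" for x using Y[OF that] Yc(1)[of "V x"] V[OF that] by simp
    then show "s \<le> q" by (rule dense_ge)
  qed
qed

text \<open>The end point is added by continuity: \<open>V q\<close> may equal
  \<open>g \<beta>\<close>, the height of the peak, where \<open>Pc\<close> vanishes and
  \<open>1 / Pc\<close> gives no derivative of \<open>Yc\<close>.\<close>

lemma descending_is_translate_closed:
  assumes V: "\<And>x. q < x \<Longrightarrow> (V has_real_derivative P x) (at x) \<and> 0 < V x \<and> V x < g \<beta> \<and> P x < 0 \<and>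
    (P x)\<^sup>2 / 2 + Gm (V x) = 0"
    and c: "continuous_on {q..} V" and x: "q \<le> x"
  shows "V x = Vc (x - q + Yc (V q))"
proof -
  obtain s where s: "s \<le> q" "\<And>x. q < x \<Longrightarrow> V x = Vc (x - s)"
    using descending_is_translate[OF V] by blast
  have "V q = Vc (q - s)"
  proof (rule tendsto_unique[OF trivial_limit_at_right_real])
    have "(V \<longlongrightarrow> V q) (at q within {q..})" using c by (simp add: continuous_on_def)
    then show "(V \<longlongrightarrow> V q) (at_right q)" by (rule tendsto_within_subset) auto
    have "isCont (\<lambda>x. Vc (x - s)) q" by (intro isCont_o2[OF _ isCont_Vc] continuous_intros)
    then have "((\<lambda>x. Vc (x - s)) \<longlongrightarrow> Vc (q - s)) (at_right q)"
      by (auto simp: isCont_def intro: tendsto_within_subset)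
    then show "(V \<longlongrightarrow> Vc (q - s)) (at_right q)"
      by (rule Lim_transform_eventually) (auto simp: eventually_at_filter s(2))
  qed
  moreover from this have "Yc (V q) = q - s" using Yc_Vc[of "q - s"] s(1) by simp
  ultimately have "x - q + Yc (V q) = x - s" "V q = Vc (q - s)" by auto
  then show ?thesis using s(2)[of x] x by (cases "x = q") (simp, metis order_le_less)
qed

text \<open>\<open>P\<close> is negative at \<open>x0\<close>. Up to its first later zero
  \<open>V\<close> would have stayed in \<open>(0, v0]\<close>, where \<open>Gm < 0\<close>, and
  this contradicts zero energy. So \<open>V\<close> descends forever and is a translate of the
  homoclinic, entered at phase \<open>Yc v0\<close>.\<close>

lemma outer_profile_unique:
  assumes out: "outer_profile g \<beta> v0 x0 V" and v0: "0 < v0" "v0 < g \<beta>" and x0: "0 < x0" and x: "x0 \<le> \<bar>x\<bar>"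
  shows "V x = Vc (\<bar>x\<bar> - x0 + Yc v0)"
proof -
  obtain P where sol: "solves_on {x. x0 \<le> \<bar>x\<bar>} (g_minus_inv g \<beta>) V P"
    and V: "\<And>x. x0 \<le> \<bar>x\<bar> \<Longrightarrow> V x \<in> {0..g \<beta>} \<and> V (- x) = V x \<and> (P x)\<^sup>2 / 2 + G_minus g \<beta> (V x) = 0"
    and V0: "V x0 = v0" "P x0 = - sqrt (- 2 * G_minus g \<beta> v0)"
    using out unfolding outer_profile_def by blast
  obtain V'' where V': "\<And>x. x0 \<le> \<bar>x\<bar> \<Longrightarrow> (V has_real_derivative P x) (at x within {x. x0 \<le> \<bar>x\<bar>})"
    and P': "\<And>x. x0 \<le> \<bar>x\<bar> \<Longrightarrow> (P has_real_derivative V'' x) (at x within {x. x0 \<le> \<bar>x\<bar>})"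
    using sol unfolding solves_on_def by blast
  have energy: "(P x)\<^sup>2 / 2 + Gm (V x) = 0" if "x0 \<le> x" for x
    using V[of x] that x0 G_minus_eq by auto
  have Vi: "(V has_real_derivative P x) (at x)" if "x0 < x" for x
    by (rule DERIV_within_interior[OF V', of _ "{x0<..}"]) (use that in auto)
  have Vcont: "continuous_on {x0..} V" and Pcont: "continuous_on {x0..} P"
    by (rule DERIV_within_continuous_on[OF V'] DERIV_within_continuous_on[OF P']; force)+
  have Vpos: "0 < V x" if "x0 \<le> x" for x
  proof -
    have "V x0 * exp (x0 - x) \<le> V x"
    proof (rule exp_decay_bound[OF that])
      show "continuous_on {x0..x} V" by (rule continuous_on_subset[OF Vcont]) auto
      show "(V has_real_derivative P y) (at y) \<and> \<bar>P y\<bar> \<le> V y" if "x0 < y" "y < x" for y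
        using Vi[of y] V[of y] energy[of y] that x0 by (auto intro!: abs_speed_le)
    qed
    moreover have "0 < V x0 * exp (x0 - x)" using v0 V0 by simp
    ultimately show ?thesis by linarith
  qed
  have Vle: "V y \<le> v0" if "x0 \<le> y" "\<And>x. x0 \<le> x \<Longrightarrow> x < y \<Longrightarrow> P x < 0" for y
  proof -
    have "V y \<le> V x0"
    proof (rule DERIV_nonpos_imp_decreasing_open[OF that(1)])
      show "\<exists>z. (V has_real_derivative z) (at x) \<and> z \<le> 0" if "x0 < x" "x < y" for x
        using Vi[of x] \<open>\<And>x. x0 \<le> x \<Longrightarrow> x < y \<Longrightarrow> P x < 0\<close>[of x] that by (intro exI[of _ "P x"]) auto
      show "continuous_on {x0..y} V" by (rule continuous_on_subset[OF Vcont]) auto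
    qed
    then show ?thesis using V0 by simp
  qed
  have P0: "P x0 < 0"
    using V0(2) Gm_neg[OF v0] G_minus_eq[of v0] v0 by simp
  have Pneg: "P x < 0" if le: "x0 \<le> x" for x
  proof (rule ccontr)
    assume "\<not> P x < 0"
    moreover have "continuous_on {x0..x} P" by (rule continuous_on_subset[OF Pcont]) auto
    ultimately obtain y where y: "x0 < y" "P y = 0" "\<And>z. x0 \<le> z \<Longrightarrow> z < y \<Longrightarrow> P z < 0"
      using first_zero[of x0 x P] le P0 by (metis not_less)
    then have "Gm (V y) < 0" using Vle[of y] Vpos[of y] v0 by (intro Gm_neg) auto
    then show False using energy[of y] y by simp
  qed
  have "(V has_real_derivative P y) (at y) \<and> 0 < V y \<and> V y < g \<beta> \<and> P y < 0 \<and> (P y)\<^sup>2 / 2 + Gm (V y) = 0"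
    if "x0 < y" for y
    using Vi[OF that] Vpos[of y] Vle[of y] Pneg energy[of y] that v0 by auto
  from descending_is_translate_closed[OF this Vcont]
  have "V y = Vc (y - x0 + Yc v0)" if "x0 \<le> y" for y
    using that V0(1) by simp
  from this[of "\<bar>x\<bar>"] show ?thesis using V[of x] x by (auto simp: abs_if split: if_splits)
qed

lemma outer_profile_exists:
  assumes v0: "0 < v0" "v0 < g \<beta>" and x0: "0 < x0"
  shows "outer_profile g \<beta> v0 x0 (\<lambda>x. Vc (\<bar>x\<bar> - x0 + Yc v0))" (is "outer_profile _ _ _ _ ?V")
proof -
  define y0 where "y0 = Yc v0"
  have y0: "0 < y0" "Vc y0 = v0" unfolding y0_def using Yc_pos[OF v0] Yc(2)[of v0] v0 by auto
  define P where "P = (\<lambda>x. sgn x * Pc (\<bar>x\<bar> - x0 + y0))"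
  have shift: "((\<lambda>x. x - x0 + y0) has_real_derivative 1) (at x)" for x
    by (auto intro!: derivative_eq_intros)
  have Vs: "((\<lambda>x. Vc (x - x0 + y0)) has_real_derivative Pc (x - x0 + y0)) (at x)"
    and Ps: "((\<lambda>x. Pc (x - x0 + y0)) has_real_derivative Vc (x - x0 + y0) - hm (Vc (x - x0 + y0))) (at x)" for x
    using DERIV_chain2[OF Vc_deriv shift] DERIV_chain2[OF Pc_deriv shift] by simp_all
  have VV: "?V x \<in> {0..g \<beta>}" for x using Vc_pos[of "\<bar>x\<bar> - x0 + Yc v0"] Vc_le by auto
  have lim: "(?V \<longlongrightarrow> 0) at_top"
  proof -
    have "eventually (\<lambda>x. Vc (x + (y0 - x0)) = ?V x) at_top"
      using eventually_ge_at_top[of 0] by eventually_elim (simp add: y0_def algebra_simps)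
    moreover have "((\<lambda>x. Vc (x + (y0 - x0))) \<longlongrightarrow> 0) at_top"
      by (rule filterlim_compose[OF Vc_tendsto_0])
        (rule filterlim_tendsto_add_at_top[OF tendsto_const filterlim_ident, of "y0 - x0", simplified add.commute])
    ultimately show ?thesis by (rule Lim_transform_eventually[rotated])
  qed
  have energy: "(P x)\<^sup>2 / 2 + G_minus g \<beta> (?V x) = 0" if "x0 \<le> \<bar>x\<bar>" for x
    using that x0 Vc_energy[of "\<bar>x\<bar> - x0 + y0"] G_minus_eq[OF VV[of x]]
    by (auto simp: P_def y0_def power_mult_distrib sgn_if)
  have P0: "Pc y0 = - sqrt (- 2 * G_minus g \<beta> v0)"
  proof -
    have "(- Pc y0)\<^sup>2 = - 2 * G_minus g \<beta> v0"
      using Vc_energy[of y0] G_minus_eq[of v0] v0 y0 by simp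
    then have "sqrt (- 2 * G_minus g \<beta> v0) = - Pc y0"
      using Pc_neg[OF y0(1)] by (intro real_sqrt_unique) auto
    then show ?thesis by simp
  qed
  show ?thesis unfolding outer_profile_def
  proof (intro exI[of _ P] conjI allI impI)
    show "solves_on {x. x0 \<le> \<bar>x\<bar>} (g_minus_inv g \<beta>) ?V P"
      unfolding solves_on_def
    proof (intro exI[of _ "\<lambda>x. ?V x - hm (?V x)"] ballI conjI)
      fix x assume x: "x \<in> {x. x0 \<le> \<bar>x\<bar>}"
      then have "x \<noteq> 0" using x0 by auto
      show "(?V has_real_derivative P x) (at x within {x. x0 \<le> \<bar>x\<bar>})"
        using even_extension_deriv(1)[OF Vs \<open>x \<noteq> 0\<close>] unfolding P_def y0_def
        by (rule has_field_derivative_at_within)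
      show "(P has_real_derivative ?V x - hm (?V x)) (at x within {x. x0 \<le> \<bar>x\<bar>})"
        using even_extension_deriv(2)[OF Ps \<open>x \<noteq> 0\<close>] unfolding P_def y0_def
        by (rule has_field_derivative_at_within)
      show "?V x - (?V x - hm (?V x)) = g_minus_inv g \<beta> (?V x)"
        using g_minus_inv_eq[OF VV[of x]] by simp
    qed
    show "(?V \<longlongrightarrow> 0) at_bot"
      using lim by (simp add: filterlim_at_bot_mirror)
    show "P x0 = - sqrt (- 2 * G_minus g \<beta> v0)" "P (- x0) = sqrt (- 2 * G_minus g \<beta> v0)"
      using P0 x0 by (auto simp: P_def)
  qed (use VV energy lim x0 y0 in \<open>auto simp: y0_def\<close>)
qed

section \<open>The inner profile\<close>

context
  fixes V P :: "real \<Rightarrow> real" and p E :: real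
  assumes p: "0 < p"
    and V': "\<And>x. x \<in> {-p..p} \<Longrightarrow> (V has_real_derivative P x) (at x within {-p..p})"
    and P': "\<And>x. x \<in> {-p..p} \<Longrightarrow> (P has_real_derivative V x - hp (V x)) (at x within {-p..p})"
    and energy: "\<And>x. x \<in> {-p..p} \<Longrightarrow> (P x)\<^sup>2 / 2 + Gp (V x) = E"
    and V_le_1: "\<And>x. x \<in> {-p..p} \<Longrightarrow> V x \<le> 1"
    and P0: "P 0 = 0" and E: "E < Gp 1"
begin

lemma inner_energy_0: "Gp (V 0) = E"
  using energy[of 0] p P0 by simp

text \<open>Zero speed at 0 means \<open>Gp (V 0) = E\<close>, the largest value the energy permits,
  and \<open>Gp\<close> is strictly increasing up to 1. Energy below \<open>Gp 1\<close> keeps the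
  orbit off the equilibrium 1.\<close>

lemma inner_le_top: assumes "x \<in> {-p..p}" shows "V x \<le> V 0" "V x < 1"
proof -
  have "Gp (V x) \<le> Gp (V 0)"
    using energy[OF assms] inner_energy_0 zero_le_power2[of "P x"] by linarith
  then show "V x \<le> V 0"
    using Gp_strict_mono[of "V 0" "V x"] V_le_1[OF assms] by (cases "V x \<le> V 0") auto
  moreover have "V 0 \<noteq> 1" using inner_energy_0 E by auto
  ultimately show "V x < 1" using V_le_1[of 0] p by auto
qed

lemma inner_interior:
  assumes "- p < x" "x < p"
  shows "(V has_real_derivative P x) (at x)" "(P has_real_derivative V x - hp (V x)) (at x)"
  by (rule DERIV_within_interior[OF V' open_greaterThanLessThan[of "- p" p]]; use assms in auto)
    (rule DERIV_within_interior[OF P' open_greaterThanLessThan[of "- p" p]]; use assms in auto)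

lemma inner_continuous: "continuous_on {-p..p} V" "continuous_on {-p..p} P"
  by (rule DERIV_within_continuous_on[OF V' subset_refl], assumption)
    (rule DERIV_within_continuous_on[OF P' subset_refl], assumption)

text \<open>\<open>V'' = V - hp V < 0\<close>: strict concavity, starting from slope 0.\<close>

lemma inner_P_neg: assumes "0 < x" "x \<le> p" shows "P x < 0"
proof -
  have "P x < P 0"
  proof (rule DERIV_neg_imp_decreasing_open[OF assms(1)])
    show "\<exists>z. (P has_real_derivative z) (at y) \<and> z < 0" if "0 < y" "y < x" for y
      using inner_interior(2)[of y] hp_greater[OF inner_le_top(2)[of y]] that assms
      by (intro exI[of _ "V y - hp (V y)"]) auto
    show "continuous_on {0..x} P" by (rule continuous_on_subset[OF inner_continuous(2)]) (use assms in auto)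
  qed
  then show ?thesis using P0 by simp
qed

lemma inner_strict_anti: assumes "0 \<le> x" "x < y" "y \<le> p" shows "V y < V x"
proof (rule DERIV_neg_imp_decreasing_open[OF assms(2)])
  show "\<exists>z. (V has_real_derivative z) (at t) \<and> z < 0" if "x < t" "t < y" for t
    using inner_interior(1)[of t] inner_P_neg[of t] that assms by (intro exI[of _ "P t"]) auto
  show "continuous_on {x..y} V" by (rule continuous_on_subset[OF inner_continuous(1)]) (use assms in auto)
qed

lemma inner_P_eq: assumes "0 < x" "x \<le> p" shows "P x = - sqrt (2 * (E - Gp (V x)))"
proof -
  have "sqrt (2 * (E - Gp (V x))) = - P x"
    using energy[of x] inner_P_neg[OF assms] assms p by (intro real_sqrt_unique) auto
  then show ?thesis by simp
qed

lemma inner_time: "((\<lambda>v. 1 / sqrt (2 * (E - Gp v))) has_integral p) {V p..V 0}"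
proof (rule travel_time_has_integral[OF p])
  show "continuous_on {0..p} V" by (rule continuous_on_subset[OF inner_continuous(1)]) (use p in auto)
  show "(V has_real_derivative P x) (at x)" if "0 < x" "x < p" for x
    using that p by (intro inner_interior) auto
qed (use inner_P_neg inner_P_eq in auto)

end

text \<open>To the right of 0 the orbit solves \<open>V' = - sqrt (2 * (E - Gp V))\<close>, and this
  speed is antitone in \<open>V\<close> because \<open>Gp\<close> increases. The comparison runs
  backwards from the common value at \<open>p\<close>, so the singular peak is met only at the
  end.\<close>

lemma inner_unique:
  fixes V1 P1 V2 P2 :: "real \<Rightarrow> real"
  assumes p: "0 < p" and E: "E < Gp 1"
    and 1: "\<And>x. x \<in> {-p..p} \<Longrightarrow> (V1 has_real_derivative P1 x) (at x within {-p..p})"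
      "\<And>x. x \<in> {-p..p} \<Longrightarrow> (P1 has_real_derivative V1 x - hp (V1 x)) (at x within {-p..p})"
      "\<And>x. x \<in> {-p..p} \<Longrightarrow> (P1 x)\<^sup>2 / 2 + Gp (V1 x) = E" "\<And>x. x \<in> {-p..p} \<Longrightarrow> V1 x \<le> 1" "P1 0 = 0"
    and 2: "\<And>x. x \<in> {-p..p} \<Longrightarrow> (V2 has_real_derivative P2 x) (at x within {-p..p})"
      "\<And>x. x \<in> {-p..p} \<Longrightarrow> (P2 has_real_derivative V2 x - hp (V2 x)) (at x within {-p..p})"
      "\<And>x. x \<in> {-p..p} \<Longrightarrow> (P2 x)\<^sup>2 / 2 + Gp (V2 x) = E" "\<And>x. x \<in> {-p..p} \<Longrightarrow> V2 x \<le> 1" "P2 0 = 0"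
    and eq: "V1 p = V2 p" and x: "0 \<le> x" "x \<le> p"
  shows "V1 x = V2 x"
proof (rule backward_unique_antitone[where U = V1 and V = V2 and x = x and S = "{..1}" and \<phi> = "\<lambda>v. sqrt (2 * (E - Gp v))" and p = p])
  show "sqrt (2 * (E - Gp v)) \<le> sqrt (2 * (E - Gp u))" if "u \<in> {..1}" "v \<in> {..1}" "u \<le> v" for u v
    using Gp_strict_mono[of u v] that by (cases "u = v") auto
  show "continuous_on {0..p} V1" "continuous_on {0..p} V2"
    using inner_continuous(1)[OF p 1 E] inner_continuous(1)[OF p 2 E] p
    by (auto elim!: continuous_on_subset)
  show "V1 y \<in> {..1} \<and> (V1 has_real_derivative - sqrt (2 * (E - Gp (V1 y)))) (at y)" if "0 < y" "y < p" for y
    using inner_interior(1)[OF p 1 E, of y] inner_P_eq[OF p 1 E, of y] 1(4)[of y] that by auto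
  show "V2 y \<in> {..1} \<and> (V2 has_real_derivative - sqrt (2 * (E - Gp (V2 y)))) (at y)" if "0 < y" "y < p" for y
    using inner_interior(1)[OF p 2 E, of y] inner_P_eq[OF p 2 E, of y] 2(4)[of y] that by auto
qed (use eq x in auto)

section \<open>Family data in terms of inner orbits\<close>

definition energy_at :: "real \<Rightarrow> real" where "energy_at v = Gp v - Gm v"

text \<open>The inner profile with the global nonlinearity and potential. \<open>P 0 = 0\<close> is
  recorded in place of the peak value, which the energy then determines.\<close>

definition is_inner :: "real \<Rightarrow> real \<Rightarrow> (real \<Rightarrow> real) \<Rightarrow> (real \<Rightarrow> real) \<Rightarrow> bool" where
  "is_inner v0 p V P \<longleftrightarrow>
     (\<forall>x\<in>{-p..p}. (V has_real_derivative P x) (at x within {-p..p}) \<and>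
        (P has_real_derivative V x - hp (V x)) (at x within {-p..p}) \<and>
        (P x)\<^sup>2 / 2 + Gp (V x) = energy_at v0 \<and> V x \<in> {g \<gamma>..1} \<and> V (- x) = V x) \<and>
     P 0 = 0 \<and> V p = v0 \<and> P p = - sqrt (- 2 * Gm v0) \<and> P (- p) = sqrt (- 2 * Gm v0)"

lemma is_innerD:
  assumes "is_inner v0 p V P"
  shows "\<And>x. x \<in> {-p..p} \<Longrightarrow> (V has_real_derivative P x) (at x within {-p..p})"
    "\<And>x. x \<in> {-p..p} \<Longrightarrow> (P has_real_derivative V x - hp (V x)) (at x within {-p..p})"
    "\<And>x. x \<in> {-p..p} \<Longrightarrow> (P x)\<^sup>2 / 2 + Gp (V x) = energy_at v0"
    "\<And>x. x \<in> {-p..p} \<Longrightarrow> V x \<le> 1" "P 0 = 0"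
  using assms by (auto simp: is_inner_def)

lemma is_inner_even: "is_inner v0 p V P \<Longrightarrow> \<bar>x\<bar> \<le> p \<Longrightarrow> V (- x) = V x"
  by (simp add: is_inner_def abs_le_iff)

text \<open>At \<open>v0 = g \<beta>\<close> the energy is \<open>Gp v0\<close> itself, so the peak
  would satisfy \<open>Gp vs = Gp v0\<close> with \<open>v0 < vs \<le> 1\<close>, against strict
  monotonicity.\<close>

lemma family_data_top_less:
  assumes "family_data g \<beta> \<gamma> v0 vs x0 Vp Vm" and v0: "v0 \<in> {g \<gamma>..g \<beta>}" "0 < v0"
  shows "v0 < g \<beta>"
proof (rule ccontr)
  assume "\<not> v0 < g \<beta>"
  then have "v0 = g \<beta>" using v0 by auto
  then have "G_minus g \<beta> v0 = 0" by (simp add: G_minus_top)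
  then have *: "v0 < vs" "vs \<le> 1" "G_plus g \<gamma> vs = G_plus g \<gamma> v0"
    using assms(1) by (auto simp: family_data_def switch_data_def Let_def)
  then show False using Gp_strict_mono[of v0 vs] G_plus_eq[of v0] G_plus_eq[of vs] v0 by auto
qed

text \<open>The switching data come for free with an inner orbit: its peak has the required
  potential, and the integral is its travel time from the peak to \<open>v0\<close>. Conversely,
  \<open>P 0 = 0\<close> follows from the energy law at the peak.\<close>

lemma family_data_iff:
  assumes v0: "g \<gamma> \<le> v0" "v0 < g \<beta>" "0 < v0"
  shows "family_data g \<beta> \<gamma> v0 vs x0 Vp Vm \<longleftrightarrow>
    0 < x0 \<and> Vp 0 = vs \<and> (\<exists>P. is_inner v0 x0 Vp P) \<and> outer_profile g \<beta> v0 x0 Vm"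
proof -
  have v1: "v0 < 1" using v0 g_\<beta>_less \<beta>\<gamma> by simp
  have Gmv: "G_minus g \<beta> v0 = Gm v0" and Gpv: "G_plus g \<gamma> v0 = Gp v0"
    using v0 v1 by (auto intro: G_minus_eq G_plus_eq)
  have E1: "energy_at v0 < Gp 1" unfolding energy_at_def using v0 by (intro energy_less_Gp_1) auto
  show ?thesis
  proof
    assume fam: "family_data g \<beta> \<gamma> v0 vs x0 Vp Vm"
    have sw: "v0 < vs" "vs \<le> 1" "G_plus g \<gamma> vs = energy_at v0" "0 < x0"
      using fam by (auto simp: family_data_def switch_data_def Let_def energy_at_def Gmv Gpv)
    obtain P where sol: "solves_on {-x0..x0} (g_plus_inv g \<gamma>) Vp P"
      and V: "\<And>x. x \<in> {-x0..x0} \<Longrightarrow> Vp x \<in> {g \<gamma>..1} \<and> Vp (- x) = Vp x \<and>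
        (P x)\<^sup>2 / 2 + G_plus g \<gamma> (Vp x) = energy_at v0"
      and V0: "Vp 0 = vs" "Vp x0 = v0" "P x0 = - sqrt (- 2 * Gm v0)" "P (- x0) = sqrt (- 2 * Gm v0)"
      using fam unfolding family_data_def inner_profile_def Gmv Gpv energy_at_def by blast
    obtain W where W: "\<And>x. x \<in> {-x0..x0} \<Longrightarrow> (Vp has_real_derivative P x) (at x within {-x0..x0})"
      "\<And>x. x \<in> {-x0..x0} \<Longrightarrow> (P has_real_derivative W x) (at x within {-x0..x0})"
      "\<And>x. x \<in> {-x0..x0} \<Longrightarrow> Vp x - W x = g_plus_inv g \<gamma> (Vp x)"
      using sol unfolding solves_on_def by blast
    have "(P has_real_derivative Vp x - hp (Vp x)) (at x within {-x0..x0})" if "x \<in> {-x0..x0}" for x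
    proof -
      have "W x = Vp x - hp (Vp x)" using W(3)[OF that] g_plus_inv_eq[of "Vp x"] V[OF that] by simp
      then show ?thesis using W(2)[OF that] by simp
    qed
    moreover have "(P x)\<^sup>2 / 2 + Gp (Vp x) = energy_at v0" if "x \<in> {-x0..x0}" for x
      using V[OF that] G_plus_eq[of "Vp x"] by simp
    moreover have "P 0 = 0" using V[of 0] sw V0 by simp
    ultimately have "is_inner v0 x0 Vp P"
      using W(1) V V0 by (auto simp: is_inner_def)
    then show "0 < x0 \<and> Vp 0 = vs \<and> (\<exists>P. is_inner v0 x0 Vp P) \<and> outer_profile g \<beta> v0 x0 Vm"
      using sw V0 fam by (auto simp: family_data_def)
  next
    assume "0 < x0 \<and> Vp 0 = vs \<and> (\<exists>P. is_inner v0 x0 Vp P) \<and> outer_profile g \<beta> v0 x0 Vm"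
    then obtain P where x0: "0 < x0" and vs: "Vp 0 = vs" and inn: "is_inner v0 x0 Vp P"
      and out: "outer_profile g \<beta> v0 x0 Vm" by blast
    note D = is_innerD[OF inn]
    have V: "Vp x \<in> {g \<gamma>..1}" "Vp (- x) = Vp x" if "x \<in> {-x0..x0}" for x
      using inn that by (auto simp: is_inner_def)
    have ends: "Vp x0 = v0" "Vp (- x0) = v0" "P x0 = - sqrt (- 2 * Gm v0)" "P (- x0) = sqrt (- 2 * Gm v0)"
      using inn V(2)[of x0] x0 by (auto simp: is_inner_def)
    have v0vs: "v0 < vs" using inner_strict_anti[OF x0 D E1, of 0 x0] x0 ends vs by simp
    have vs1: "vs < 1" using inner_le_top(2)[OF x0 D E1, of 0] x0 vs by simp
    have Gpe: "G_plus g \<gamma> v = Gp v" if "v \<in> {v0..vs}" for v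
      using that v0 vs1 by (intro G_plus_eq) auto
    have Evs: "Gp vs = energy_at v0" using inner_energy_0[OF x0 D E1] vs by simp
    have "switch_data g \<beta> \<gamma> v0 vs x0"
      unfolding switch_data_def Let_def Gmv Gpv energy_at_def[symmetric]
    proof (intro conjI ballI)
      show "G_plus g \<gamma> vs = energy_at v0" using Gpe[of vs] v0vs Evs by simp
      show "0 < energy_at v0 - G_plus g \<gamma> v" if "v \<in> {v0<..<vs}" for v
        using Gpe[of v] that Gp_strict_mono[of v vs] vs1 Evs by auto
      have "((\<lambda>v. 1 / sqrt (2 * (energy_at v0 - Gp v))) has_integral x0) {v0..vs}"
        using inner_time[OF x0 D E1] ends vs by simp
      then show "((\<lambda>v. 1 / sqrt (2 * (energy_at v0 - G_plus g \<gamma> v))) has_integral x0) {v0..vs}"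
        by (rule has_integral_eq[rotated]) (simp add: Gpe)
    qed (use v0vs vs1 x0 in auto)
    moreover have "inner_profile g \<beta> \<gamma> v0 vs x0 Vp"
      unfolding inner_profile_def Gmv Gpv energy_at_def[symmetric]
    proof (intro exI[of _ P] conjI ballI)
      show "solves_on {- x0..x0} (g_plus_inv g \<gamma>) Vp P"
        unfolding solves_on_def
        by (intro exI[of _ "\<lambda>x. Vp x - hp (Vp x)"] ballI conjI D) (simp_all add: g_plus_inv_eq[OF V(1)])
      show "(P x)\<^sup>2 / 2 + G_plus g \<gamma> (Vp x) = energy_at v0" if "x \<in> {-x0..x0}" for x
        using D(3)[OF that] G_plus_eq[OF V(1)[OF that]] by simp
    qed (use V ends vs in auto)
    ultimately show "family_data g \<beta> \<gamma> v0 vs x0 Vp Vm"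
      using out by (simp add: family_data_def)
  qed
qed

text \<open>The energy fixes the peak by injectivity of \<open>Gp\<close>, and the peak fixes the
  travel time \<open>x0\<close>. Then the inner profiles agree by backward uniqueness and the outer
  ones as the same translate of the homoclinic.\<close>

lemma family_data_unique:
  assumes v0: "g \<gamma> \<le> v0" "v0 < g \<beta>" "0 < v0"
    and 1: "family_data g \<beta> \<gamma> v0 vs x0 Vp Vm" and 2: "family_data g \<beta> \<gamma> v0 vs' x0' Vp' Vm'"
  shows "x0' = x0" "glue g \<beta> \<gamma> x0' Vp' Vm' = glue g \<beta> \<gamma> x0 Vp Vm"
proof -
  have E1: "energy_at v0 < Gp 1" unfolding energy_at_def using v0 by (intro energy_less_Gp_1) auto
  obtain P P' where x0: "0 < x0" and inn: "Vp 0 = vs" "is_inner v0 x0 Vp P" and out: "outer_profile g \<beta> v0 x0 Vm"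
    and x0': "0 < x0'" and inn': "Vp' 0 = vs'" "is_inner v0 x0' Vp' P'" and out': "outer_profile g \<beta> v0 x0' Vm'"
    using 1 2 unfolding family_data_iff[OF v0] by blast
  note D = is_innerD[OF inn(2)] and D' = is_innerD[OF inn'(2)]
  have end': "Vp x0 = v0" "Vp' x0' = v0" using inn inn' by (auto simp: is_inner_def)
  have "vs = vs'"
  proof (rule ccontr)
    assume "vs \<noteq> vs'"
    then show False
      using inner_energy_0[OF x0 D E1] inner_energy_0[OF x0' D' E1] D(4)[of 0] D'(4)[of 0] x0 x0'
        Gp_strict_mono[of vs vs'] Gp_strict_mono[of vs' vs] inn(1) inn'(1)
      by (cases vs vs' rule: linorder_cases) auto
  qed
  then show eq: "x0' = x0"
    using inner_time[OF x0 D E1] inner_time[OF x0' D' E1] end' inn(1) inn'(1)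
    by (auto intro: has_integral_unique)
  have inner: "Vp' x = Vp x" if "0 \<le> x" "x \<le> x0" for x
    using inner_unique[OF x0 E1 D'[unfolded eq] D _ that] end' eq by simp
  have inner': "Vp' x = Vp x" if "\<bar>x\<bar> < x0" for x
  proof (cases "0 \<le> x")
    case False
    have "Vp (- x) = Vp x" "Vp' (- x) = Vp' x"
      using is_inner_even[OF inn(2), of x] is_inner_even[OF inn'(2), of x] that eq by auto
    then show ?thesis using inner[of "- x"] False that by simp
  qed (use inner that in auto)
  have outer: "Vm' x = Vm x" if "x0 \<le> \<bar>x\<bar>" for x
    using outer_profile_unique[OF out v0(3,2) x0 that] outer_profile_unique[OF out' v0(3,2) x0'] that eq by simp
  show "glue g \<beta> \<gamma> x0' Vp' Vm' = glue g \<beta> \<gamma> x0 Vp Vm"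
    using inner' outer eq by (auto simp: glue_def fun_eq_iff)
qed

text \<open>\<open>Gm v0 < 0\<close> puts the energy strictly between \<open>Gp v0\<close> and
  \<open>Gp 1\<close>, so an intermediate value argument yields the peak \<open>vs\<close>, and the
  orbit turning there is followed down to \<open>v0\<close>.\<close>

lemma family_data_exists:
  assumes v0: "g \<gamma> \<le> v0" "v0 < g \<beta>" "0 < v0"
  shows "\<exists>vs x0 Vp Vm. family_data g \<beta> \<gamma> v0 vs x0 Vp Vm"
proof -
  have E1: "energy_at v0 < Gp 1" unfolding energy_at_def using v0 by (intro energy_less_Gp_1) auto
  have v1: "v0 < 1" using v0 g_\<beta>_less \<beta>\<gamma> by simp
  have E0: "Gp v0 < energy_at v0" using Gm_neg[OF v0(3,2)] by (simp add: energy_at_def)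
  obtain vs where vs: "v0 \<le> vs" "vs \<le> 1" "Gp vs = energy_at v0"
    using IVT'[of Gp v0 "energy_at v0" 1] E0 E1 v1 continuous_on_Gp by auto
  then have vs': "v0 < vs" "vs < 1" using E0 E1 by (auto simp: less_le)
  obtain I V P Y where I: "open I" "is_interval I" "0 \<in> I" "V 0 = vs"
    "\<And>x. x \<in> I \<Longrightarrow> - x \<in> I" "\<And>x. x \<in> I \<Longrightarrow> V (- x) = V x" "\<And>x. x \<in> I \<Longrightarrow> P (- x) = - P x"
    "\<And>x. x \<in> I \<Longrightarrow> (V has_real_derivative P x) (at x)"
    "\<And>x. x \<in> I \<Longrightarrow> (P has_real_derivative - (hp (V x) - V x)) (at x)"
    "\<And>x. x \<in> I \<Longrightarrow> (P x)\<^sup>2 / 2 + Gp (V x) = Gp vs"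
    "\<And>x. x \<in> I \<Longrightarrow> v0 - 1 < V x \<and> V x \<le> vs"
    "\<And>x. x \<in> I \<Longrightarrow> 0 < x \<Longrightarrow> P x < 0"
    "\<And>v. v0 - 1 < v \<Longrightarrow> v \<le> vs \<Longrightarrow> Y v \<in> I \<and> 0 \<le> Y v \<and> V (Y v) = v"
    \<comment> \<open>The lower limit \<open>v0 - 1\<close> is any height strictly below
      \<open>v0\<close>: the orbit then continues past the switching time, and all derivatives on
      \<open>[-p, p]\<close> are two-sided.\<close>
    by (rule peak_solution[of Gp "\<lambda>v. hp v - v" "v0 - 1" vs])
      (use vs' in \<open>auto intro: Gp_deriv continuous_intros continuous_hp Gp_strict_mono hp_greater\<close>)
  define p where "p = Y v0"
  have pI: "p \<in> I" "0 \<le> p" "V p = v0" using I(13)[of v0] vs' by (auto simp: p_def)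
  then have p: "0 < p" using I(4) vs' by (cases "p = 0") auto
  have sub: "x \<in> I" if "x \<in> {-p..p}" for x
    using mem_is_interval_1_I[OF I(2) I(5)[OF pI(1)] pI(1)] that by auto
  have ge: "v0 \<le> V x" if "0 \<le> x" "x \<le> p" for x
  proof -
    have "V p \<le> V x"
    proof (rule DERIV_nonpos_imp_nonincreasing[OF that(2)])
      fix y assume y: "x \<le> y" "y \<le> p"
      then have "y \<in> I" using that by (intro sub) auto
      moreover have "P 0 = 0" using I(7)[of 0] I(3) by simp
      ultimately show "\<exists>z. (V has_real_derivative z) (at y) \<and> z \<le> 0"
        using I(8)[of y] I(12)[of y] that y by (intro exI[of _ "P y"]) (cases "y = 0"; auto)
    qed
    then show ?thesis using pI by simp
  qed
  have range: "V x \<in> {g \<gamma>..1}" if "x \<in> {-p..p}" for x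
    using ge[of x] ge[of "- x"] I(6,11)[OF sub[OF that]] that vs' v0 by (cases "x < 0") auto
  have P0: "P 0 = 0" using I(7)[OF I(3)] by simp
  have Pp: "P p = - sqrt (- 2 * Gm v0)"
  proof -
    have "sqrt (- 2 * Gm v0) = - P p"
      using I(10)[OF pI(1)] I(12)[OF pI(1) p] pI(3) vs(3) by (intro real_sqrt_unique) (auto simp: energy_at_def)
    then show ?thesis by simp
  qed
  have "is_inner v0 p V P"
    unfolding is_inner_def
  proof (intro conjI ballI)
    fix x assume x: "x \<in> {-p..p}"
    note xI = sub[OF x]
    show "(V has_real_derivative P x) (at x within {-p..p})"
      using I(8)[OF xI] by (rule has_field_derivative_at_within)
    show "(P has_real_derivative V x - hp (V x)) (at x within {-p..p})"
      using has_field_derivative_at_within[OF I(9)[OF xI]] by simp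
    show "(P x)\<^sup>2 / 2 + Gp (V x) = energy_at v0" using I(10)[OF xI] vs by simp
    show "V x \<in> {g \<gamma>..1}" by (rule range[OF x])
    show "V (- x) = V x" by (rule I(6)[OF xI])
  qed (use P0 pI Pp I(7)[OF pI(1)] in auto)
  then have "family_data g \<beta> \<gamma> v0 (V 0) p V (\<lambda>x. Vc (\<bar>x\<bar> - p + Yc v0))"
    unfolding family_data_iff[OF v0] using p outer_profile_exists[OF v0(3,2) p] by blast
  then show ?thesis by blast
qed

section \<open>The ground states\<close>

text \<open>\<open>g u - u = - f u / d\<close> has the positive slope \<open>- deriv f 0 / d\<close>
  at 0; \<open>c\<close> is half of it.\<close>

lemma linear_decay_near_0:
  obtains c \<delta> where "0 < c" "0 < \<delta>" "\<And>u. 0 \<le> u \<Longrightarrow> u < \<delta> \<Longrightarrow> c * u \<le> g u - u"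
proof -
  define c where "c = - deriv f 0 / (2 * d)"
  have c: "0 < c" using f'0 d by (simp add: c_def divide_neg_pos)
  have "((\<lambda>u. (f (0 + u) - f 0) / u) \<longlongrightarrow> deriv f 0) (at 0)"
    using f_deriv[of 0] by (simp add: DERIV_def)
  then have "((\<lambda>u. f u / u) \<longlongrightarrow> deriv f 0) (at 0)" using f_zero by simp
  then have "eventually (\<lambda>u. f u / u < deriv f 0 / 2) (at 0)"
    by (rule order_tendstoD) (use f'0 in simp)
  then obtain \<delta> where \<delta>: "0 < \<delta>" "\<And>u. u \<noteq> 0 \<Longrightarrow> \<bar>u\<bar> < \<delta> \<Longrightarrow> f u / u < deriv f 0 / 2"
    by (auto simp: eventually_at dist_real_def)
  have "c * u \<le> g u - u" if "0 \<le> u" "u < \<delta>" for u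
  proof (cases "u = 0")
    case False
    then have "f u < deriv f 0 / 2 * u" using \<delta>(2)[of u] that by (simp add: field_simps)
    then have "f u / d \<le> deriv f 0 / 2 * u / d" using d by (intro divide_right_mono) auto
    then show ?thesis using d by (simp add: g_def c_def field_simps)
  qed simp
  with c \<delta>(1) that show ?thesis by blast
qed

text \<open>On the tail \<open>c * U \<le> V - U = P'\<close>, and \<open>P'\<close> integrates to
  \<open>- P R\<close> because \<open>P\<close> tends to 0. As \<open>U \<le> 1\<close>,
  \<open>U\<^sup>2\<close> is dominated by this on the right, by its reflection on the left, and by
  1 in between.\<close>

lemma profile_square_integrable:
  fixes U V P :: "real \<Rightarrow> real"
  assumes X: "finite X" and P': "\<And>x. x \<notin> X \<Longrightarrow> (P has_real_derivative V x - U x) (at x)"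
    and Ub: "\<And>x. 0 \<le> U x \<and> U x \<le> 1" and Uc: "finite {x. \<not> isCont U x}"
    and even: "\<And>x. U (- x) = U x" and gU: "\<And>x. g (U x) = V x"
    and Ulim: "(U \<longlongrightarrow> 0) at_top" and Plim: "(P \<longlongrightarrow> 0) at_top"
  shows "U \<in> borel_measurable borel" "integrable lebesgue (\<lambda>x. (U x)\<^sup>2)"
proof -
  show Um: "U \<in> borel_measurable borel"
    by (rule borel_measurable_continuous_countable_exceptions[of "{x. \<not> isCont U x}"])
      (use Uc in \<open>auto intro!: countable_finite continuous_at_imp_continuous_on\<close>)
  have V_eq: "V = (\<lambda>x. g (U x))" using gU by auto
  have Vm: "V \<in> borel_measurable borel"
    unfolding V_eq by (rule measurable_compose[OF Um borel_measurable_continuous_onI[OF continuous_on_g]])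
  obtain c \<delta> where c: "0 < c" "0 < \<delta>" "\<And>u. 0 \<le> u \<Longrightarrow> u < \<delta> \<Longrightarrow> c * u \<le> g u - u"
    using linear_decay_near_0 by blast
  have "eventually (\<lambda>x. U x < \<delta>) at_top" by (rule order_tendstoD(2)[OF Ulim c(2)])
  then obtain R0 where R0: "\<And>x. R0 \<le> x \<Longrightarrow> U x < \<delta>" by (auto simp: eventually_at_top_linorder)
  \<comment> \<open>Beyond \<open>R\<close> there is no exceptional point and
    \<open>U < \<delta>\<close>; inserting 0 keeps \<open>Max\<close> meaningful when
    \<open>X\<close> is empty.\<close>
  define R where "R = max 0 (max R0 (Max (insert 0 X) + 1))"
  have RX: "x \<notin> X" if "R \<le> x" for x
  proof
    assume "x \<in> X"
    then have "x \<le> Max (insert 0 X)" using X by (intro Max_ge) auto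
    then show False using that by (simp add: R_def)
  qed
  have le: "c * U x \<le> V x - U x" if "R \<le> x" for x
    using c(3)[of "U x"] R0[of x] Ub[of x] that gU[of x] by (simp add: R_def)
  define F where "F = (\<lambda>x. indicator {R..} x * (V x - U x))"
  have Fnn: "0 \<le> F x" for x
  proof (cases "R \<le> x")
    case True
    have "0 \<le> c * U x" using Ub[of x] c(1) by simp
    then show ?thesis using le[OF True] True by (simp add: F_def)
  qed (simp add: F_def)
  have Fm: "F \<in> borel_measurable borel" unfolding F_def using Um Vm by measurable
  have "(\<integral>\<^sup>+x. ennreal (V x - U x) * indicator {R..} x \<partial>lborel) = ennreal (0 - P R)"
  proof (rule nn_integral_FTC_atLeast[OF _ _ _ Plim])
    show "0 \<le> V x - U x" if "R \<le> x" for x using Fnn[of x] that by (simp add: F_def)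
  qed (use P' RX Um Vm in auto)
  also have "(\<integral>\<^sup>+x. ennreal (V x - U x) * indicator {R..} x \<partial>lborel) = (\<integral>\<^sup>+x. ennreal (F x) \<partial>lborel)"
    by (rule nn_integral_cong) (auto simp: F_def indicator_def)
  finally have "integrable lborel F"
    using Fm Fnn by (intro integrableI_nonneg) (auto simp: less_top[symmetric])
  then have F1: "integrable lebesgue F" using Fm by (simp add: integrable_completion)
  then have F2: "integrable lebesgue (\<lambda>x. F (- x))"
    using lebesgue_integrable_real_affine[of F "-1" 0] by simp
  have I: "integrable lebesgue (indicat_real {-R..R})"
    by (intro integrable_real_indicator) (auto simp: emeasure_lborel_Icc_eq)
  show "integrable lebesgue (\<lambda>x. (U x)\<^sup>2)"
  proof (rule Bochner_Integration.integrable_bound)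
    show "integrable lebesgue (\<lambda>x. indicat_real {-R..R} x + (F x / c + F (- x) / c))"
      by (intro Bochner_Integration.integrable_add integrable_divide I F1 F2)
    show "(\<lambda>x. (U x)\<^sup>2) \<in> borel_measurable lebesgue"
      using Um by (intro measurable_completion) measurable
    have "(U x)\<^sup>2 \<le> indicat_real {-R..R} x + (F x / c + F (- x) / c)" for x
    proof -
      have sq: "(U x)\<^sup>2 \<le> U x" "U x \<le> 1" using Ub[of x] by (auto simp: power2_eq_square mult_left_le)
      have Fc: "0 \<le> F x / c" "0 \<le> F (- x) / c" using Fnn c(1) by auto
      consider "\<bar>x\<bar> \<le> R" | "R \<le> x" | "R \<le> - x" by linarith
      then show ?thesis
      proof cases
        case 1
        then show ?thesis using sq Fc by (auto simp: indicator_def)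
      next
        case 2
        then have "U x \<le> F x / c" using le[of x] c(1) by (simp add: F_def field_simps)
        then show ?thesis using sq Fc by (auto simp: indicator_def)
      next
        case 3
        have "U x \<le> F (- x) / c" using le[OF 3] c(1) 3 even[of x] by (simp add: F_def field_simps)
        then show ?thesis using sq Fc by (auto simp: indicator_def)
      qed
    qed
    then show "AE x in lebesgue. norm ((U x)\<^sup>2) \<le> norm (indicat_real {-R..R} x + (F x / c + F (- x) / c))"
      by (intro AE_I2) (smt (verit) real_norm_def zero_le_power2)
  qed
qed

text \<open>\<open>V\<close> and the convolution of \<open>U\<close> are both bounded solutions of
  \<open>v - v'' = U\<close>, hence equal, and \<open>g U = V\<close> then is the ground state
  equation.\<close>

lemma profile_ground_state:
  fixes U V P :: "real \<Rightarrow> real"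
  assumes V': "\<And>x. (V has_real_derivative P x) (at x)" and P: "continuous_on UNIV P"
    and X: "finite X" and P': "\<And>x. x \<notin> X \<Longrightarrow> (P has_real_derivative V x - U x) (at x)"
    and Vb: "\<And>x. \<bar>V x\<bar> \<le> B" and Pb: "\<And>x. \<bar>P x\<bar> \<le> C"
    and Ub: "\<And>x. 0 < U x \<and> U x \<le> 1" and Uc: "finite {x. \<not> isCont U x}"
    and even: "\<And>x. U (- x) = U x" and gU: "\<And>x. g (U x) = V x"
    and Ulim: "(U \<longlongrightarrow> 0) at_top" and Plim: "(P \<longlongrightarrow> 0) at_top"
  shows "ground_state exp_kernel d f U"
proof -
  have Ub': "0 \<le> U x \<and> U x \<le> 1" for x using Ub[of x] by simp
  have Um: "U \<in> borel_measurable borel" and Usq: "integrable lebesgue (\<lambda>x. (U x)\<^sup>2)"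
    using profile_square_integrable[OF X P' Ub' Uc even gU Ulim Plim] by auto
  have Um': "U \<in> borel_measurable lebesgue" using Um by (intro measurable_completion) simp
  have abs: "\<bar>U x\<bar> \<le> 1" for x using Ub[of x] by simp
  obtain Q where Q: "\<And>x. (convolve exp_kernel U has_real_derivative Q x) (at x)" "continuous_on UNIV Q"
    "\<And>x. isCont U x \<Longrightarrow> (Q has_real_derivative convolve exp_kernel U x - U x) (at x)"
    "\<And>x. \<bar>convolve exp_kernel U x\<bar> \<le> 1" "\<And>x. \<bar>Q x\<bar> \<le> 1"
    using convolve_exp_kernel[OF Um' abs even Uc] by metis
  have "V x - convolve exp_kernel U x = 0" for x
  proof (rule bounded_solution_unique[of "\<lambda>x. V x - convolve exp_kernel U x" "\<lambda>x. P x - Q x"])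
    show "finite (X \<union> {x. \<not> isCont U x})" using X Uc by simp
    show "((\<lambda>x. P x - Q x) has_real_derivative V x - convolve exp_kernel U x) (at x)"
      if "x \<notin> X \<union> {x. \<not> isCont U x}" for x
      using DERIV_diff[OF P'[of x] Q(3)[of x]] that by simp
    show "\<bar>V x - convolve exp_kernel U x\<bar> \<le> B + 1" for x using Vb[of x] Q(4)[of x] by linarith
    show "\<bar>P x - Q x\<bar> \<le> C + 1" for x using Pb[of x] Q(5)[of x] by linarith
  qed (auto intro: DERIV_diff V' Q continuous_intros P)
  then have conv: "convolve exp_kernel U x = U x - f (U x) / d" for x
    using gU[of x] by (simp add: g_def)
  show ?thesis
    unfolding ground_state_def
  proof (intro conjI allI)
    show "bounded (range U)" using abs by (auto simp: bounded_iff)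
    show "0 = d * (- U x + convolve exp_kernel U x) + f (U x)" for x
      using d by (simp add: conv)
    show "(U \<longlongrightarrow> 0) at_bot" using Ulim even by (simp add: filterlim_at_bot_mirror)
  qed (use Um' Usq Ulim Ub even in auto)
qed

section \<open>The continuous ground state\<close>

lemma abs_Pc_le: "\<bar>Pc x\<bar> \<le> Vc x"
  using Vc_energy[of x] Vc_pos[of x] by (intro abs_speed_le) auto

lemma Pc_tendsto_0: "(Pc \<longlongrightarrow> 0) at_top"
  by (rule tendsto_0_le[OF Vc_tendsto_0, of _ 1])
    (use abs_Pc_le Vc_pos in \<open>auto intro!: always_eventually simp: abs_of_pos\<close>)

lemma Pc_Yc: assumes "0 < v" "v < g \<beta>" shows "Pc (Yc v) = - sqrt (- 2 * Gm v)"
proof -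
  have "sqrt (- 2 * Gm v) = - Pc (Yc v)"
    using Vc_energy[of "Yc v"] Pc_neg[OF Yc_pos[OF assms]] Yc(2)[of v] assms
    by (intro real_sqrt_unique) auto
  then show ?thesis by simp
qed

definition Uc :: "real \<Rightarrow> real" where "Uc x = hm (Vc x)"

lemma isCont_Uc: "isCont Uc x"
  unfolding Uc_def by (rule isCont_o2[OF isCont_Vc isCont_hm])

lemma hm_tendsto_0: "(V \<longlongrightarrow> 0) F \<Longrightarrow> ((\<lambda>x. hm (V x)) \<longlongrightarrow> 0) F"
  using isCont_tendsto_compose[OF isCont_hm, of V 0 F] by simp

lemma Uc_ground_state: "ground_state exp_kernel d f Uc"
proof (rule profile_ground_state[of Vc Pc "{}"])
  show "\<bar>Vc x\<bar> \<le> g \<beta>" "\<bar>Pc x\<bar> \<le> g \<beta>" for x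
    using Vc_pos[of x] Vc_le[of x] abs_Pc_le[of x] by linarith+
  show "continuous_on UNIV Pc" using isCont_Pc by (simp add: continuous_on_eq_continuous_at)
  show "0 < Uc x \<and> Uc x \<le> 1" for x
    using hm_pos[OF Vc_pos Vc_le, of x] hm_range[of "Vc x"] \<beta>\<gamma> by (auto simp: Uc_def)
  show "finite {x. \<not> isCont Uc x}" by (simp add: isCont_Uc)
  show "(Uc \<longlongrightarrow> 0) at_top" unfolding Uc_def by (rule hm_tendsto_0[OF Vc_tendsto_0])
  show "g (Uc x) = Vc x" for x using g_hm[of "Vc x"] Vc_pos[of x] Vc_le[of x] by (simp add: Uc_def)
qed (auto simp: Uc_def Vc_even intro: Vc_deriv Pc_deriv Pc_tendsto_0)

text \<open>Away from 0 the orbit stays strictly below \<open>g \<beta>\<close>, hence inside the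
  open interval on which \<open>hm\<close> is smooth; at 0 it touches its end.\<close>

lemma Uc_smooth: "smooth_on ({..<0} \<union> {0<..}) Uc"
  unfolding Uc_def
proof (rule smooth_on_second_order_solution[OF _ _ smooth_hm])
  show "Vc x \<in> {0<..<g \<beta>}" if "x \<in> {..<0} \<union> {0<..}" for x
    using Vc_pos[of x] Vc_less[of x] that by auto
qed (auto intro: Vc_deriv Pc_deriv)

section \<open>The discontinuous ground states\<close>

context
  fixes v0 vs x0 :: real and Vp Vm :: "real \<Rightarrow> real"
  assumes v0: "g \<gamma> \<le> v0" "v0 < g \<beta>" "0 < v0" and fam: "family_data g \<beta> \<gamma> v0 vs x0 Vp Vm"
begin

lemma family_switch_pos: "0 < x0"
  using fam family_data_iff[OF v0] by blast

text \<open>At \<open>\<plusminus>x0\<close> the derivatives of both profiles agree, so \<open>V\<close> is continuously differentiable; \<open>V''\<close> jumps.\<close>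

lemma family_profile:
  "\<exists>V P. (\<forall>x. (V has_real_derivative P x) (at x)) \<and> continuous_on UNIV P \<and>
     (\<forall>x. x \<notin> {-x0, x0} \<longrightarrow> (P has_real_derivative V x - glue g \<beta> \<gamma> x0 Vp Vm x) (at x)) \<and>
     (\<forall>x. \<bar>V x\<bar> \<le> 1 + \<bar>g \<gamma>\<bar>) \<and> (\<forall>x. \<bar>P x\<bar> \<le> 1 + sqrt (2 * (energy_at v0 - Gp (g \<gamma>)))) \<and>
     (\<forall>x. \<bar>x\<bar> < x0 \<longrightarrow> glue g \<beta> \<gamma> x0 Vp Vm x = hp (V x) \<and> V x \<in> {g \<gamma><..<1}) \<and>
     (\<forall>x. x0 \<le> \<bar>x\<bar> \<longrightarrow> glue g \<beta> \<gamma> x0 Vp Vm x = hm (V x) \<and> V x \<in> {0<..<g \<beta>}) \<and>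
     (\<forall>x. V (- x) = V x) \<and> (V \<longlongrightarrow> 0) at_top \<and> (P \<longlongrightarrow> 0) at_top"
proof -
  note x0 = family_switch_pos
  have E1: "energy_at v0 < Gp 1" unfolding energy_at_def using v0 by (intro energy_less_Gp_1) auto
  obtain Pp where inn: "is_inner v0 x0 Vp Pp" and out: "outer_profile g \<beta> v0 x0 Vm"
    using fam family_data_iff[OF v0] by blast
  note D = is_innerD[OF inn]
  have ends: "Vp x0 = v0" "Pp x0 = - sqrt (- 2 * Gm v0)" "Pp (- x0) = sqrt (- 2 * Gm v0)"
    using inn by (auto simp: is_inner_def)
  have endm: "Vp (- x0) = v0" using is_inner_even[OF inn, of x0] ends x0 by simp
  define y0 where "y0 = Yc v0"
  have y0: "0 < y0" "Vc y0 = v0" "Pc y0 = - sqrt (- 2 * Gm v0)"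
    unfolding y0_def using Yc_pos[OF v0(3,2)] Yc(2)[of v0] Pc_Yc[OF v0(3,2)] v0 by auto
  \<comment> \<open>\<open>Vm\<close> is known only where the modulus of \<open>x\<close> is at
    least \<open>x0\<close>. The translated homoclinic agrees with it there and is differentiable on
    both sides of the switching points.\<close>
  define Vo where "Vo = (\<lambda>x. Vc (\<bar>x\<bar> - x0 + y0))"
  define Po where "Po = (\<lambda>x. sgn x * Pc (\<bar>x\<bar> - x0 + y0))"
  define V where "V = (\<lambda>x. if \<bar>x\<bar> < x0 then Vp x else Vo x)"
  define P where "P = (\<lambda>x. if \<bar>x\<bar> < x0 then Pp x else Po x)"
  have Vm_eq: "Vm x = Vo x" if "x0 \<le> \<bar>x\<bar>" for x
    using outer_profile_unique[OF out v0(3,2) x0 that] by (simp add: Vo_def y0_def)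
  have shift: "((\<lambda>x. x - x0 + y0) has_real_derivative 1) (at x)" for x
    by (auto intro!: derivative_eq_intros)
  have Vo': "(Vo has_real_derivative Po x) (at x)"
    and Po': "(Po has_real_derivative Vo x - hm (Vo x)) (at x)" if "x \<noteq> 0" for x
    unfolding Vo_def Po_def
    using even_extension_deriv(1)[of "\<lambda>x. Vc (x - x0 + y0)" "Pc (\<bar>x\<bar> - x0 + y0)" x]
      even_extension_deriv(2)[of "\<lambda>x. Pc (x - x0 + y0)" "Vc (\<bar>x\<bar> - x0 + y0) - hm (Vc (\<bar>x\<bar> - x0 + y0))" x]
      DERIV_chain2[OF Vc_deriv shift] DERIV_chain2[OF Pc_deriv shift] that by simp_all
  have cl: "closed {x. x0 \<le> \<bar>x\<bar>}" by (intro closed_Collect_le continuous_intros)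
  have cover: "{- x0..x0} \<union> {x. x0 \<le> \<bar>x\<bar>} = UNIV" by auto
  have Vcont: "continuous_on UNIV V"
    unfolding V_def cover[symmetric]
  proof (rule continuous_on_cases[OF closed_atLeastAtMost cl inner_continuous(1)[OF x0 D E1]])
    show "continuous_on {x. x0 \<le> \<bar>x\<bar>} Vo"
      using Vo' x0 by (intro continuous_at_imp_continuous_on ballI DERIV_isCont[OF Vo']) auto
    show "\<forall>x. x \<in> {-x0..x0} \<and> \<not> \<bar>x\<bar> < x0 \<or> x \<in> {x. x0 \<le> \<bar>x\<bar>} \<and> \<bar>x\<bar> < x0 \<longrightarrow> Vp x = Vo x"
    proof (intro allI impI)
      fix x assume "x \<in> {-x0..x0} \<and> \<not> \<bar>x\<bar> < x0 \<or> x \<in> {x. x0 \<le> \<bar>x\<bar>} \<and> \<bar>x\<bar> < x0"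
      then have "x = x0 \<or> x = - x0" by auto
      then show "Vp x = Vo x" using ends endm y0 x0 by (auto simp: Vo_def)
    qed
  qed
  have Pcont: "continuous_on UNIV P"
    unfolding P_def cover[symmetric]
  proof (rule continuous_on_cases[OF closed_atLeastAtMost cl inner_continuous(2)[OF x0 D E1]])
    show "continuous_on {x. x0 \<le> \<bar>x\<bar>} Po"
      using Po' x0 by (intro continuous_at_imp_continuous_on ballI DERIV_isCont[OF Po']) auto
    show "\<forall>x. x \<in> {-x0..x0} \<and> \<not> \<bar>x\<bar> < x0 \<or> x \<in> {x. x0 \<le> \<bar>x\<bar>} \<and> \<bar>x\<bar> < x0 \<longrightarrow> Pp x = Po x"
    proof (intro allI impI)
      fix x assume "x \<in> {-x0..x0} \<and> \<not> \<bar>x\<bar> < x0 \<or> x \<in> {x. x0 \<le> \<bar>x\<bar>} \<and> \<bar>x\<bar> < x0"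
      then have "x = x0 \<or> x = - x0" by auto
      then show "Pp x = Po x" using ends y0 x0 by (auto simp: Po_def)
    qed
  qed
  have isC: "isCont V x" "isCont P x" for x
    using Vcont Pcont by (auto simp: continuous_on_eq_continuous_at)
  \<comment> \<open>The strict bounds matter: \<open>hp\<close> is smooth only inside the open
    interval, and \<open>V\<close> reaches \<open>v0\<close>, possibly equal to
    \<open>g \<gamma>\<close>, only at the switching points.\<close>
  have Vin: "V x \<in> {g \<gamma><..<1}" if "\<bar>x\<bar> < x0" for x
  proof -
    have "Vp x0 < Vp \<bar>x\<bar>" using inner_strict_anti[OF x0 D E1, of "\<bar>x\<bar>" x0] that by simp
    moreover have "Vp \<bar>x\<bar> = Vp x" using is_inner_even[OF inn, of x] that by (cases "x < 0") auto
    moreover have "Vp x < 1" using inner_le_top(2)[OF x0 D E1, of x] that by (auto simp: abs_less_iff)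
    ultimately show ?thesis using that v0 ends by (simp add: V_def)
  qed
  have Vout: "V x \<in> {0<..<g \<beta>}" if "x0 \<le> \<bar>x\<bar>" for x
    using that y0 Vc_pos[of "\<bar>x\<bar> - x0 + y0"] Vc_less[of "\<bar>x\<bar> - x0 + y0"] by (simp add: V_def Vo_def)
  have glue_in: "glue g \<beta> \<gamma> x0 Vp Vm x = hp (V x)" if "\<bar>x\<bar> < x0" for x
    using Vin[OF that] that g_plus_inv_eq[of "V x"] by (simp add: glue_def V_def)
  have glue_out: "glue g \<beta> \<gamma> x0 Vp Vm x = hm (V x)" if "x0 \<le> \<bar>x\<bar>" for x
    using Vout[OF that] that g_minus_inv_eq[of "V x"] Vm_eq[OF that] by (simp add: glue_def V_def)
  have der: "(V has_real_derivative P x) (at x) \<and> (P has_real_derivative V x - glue g \<beta> \<gamma> x0 Vp Vm x) (at x)"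
    if "x \<notin> {-x0, x0}" for x
  proof (cases "\<bar>x\<bar> < x0")
    case True
    then have "eventually (\<lambda>y. y \<in> {-x0<..<x0}) (nhds x)" by (intro eventually_nhds_in_open) auto
    then have ev: "eventually (\<lambda>y. Vp y = V y) (nhds x)" "eventually (\<lambda>y. Pp y = P y) (nhds x)"
      by (eventually_elim, auto simp: V_def P_def)+
    have x: "- x0 < x" "x < x0" using True by auto
    have "(Vp has_real_derivative P x) (at x)" "(Pp has_real_derivative V x - glue g \<beta> \<gamma> x0 Vp Vm x) (at x)"
      using inner_interior[OF x0 D E1 x] True glue_in[OF True] by (auto simp: V_def P_def)
    then show ?thesis using DERIV_cong_ev[OF refl ev(1) refl] DERIV_cong_ev[OF refl ev(2) refl] by auto
  next
    case False
    then have *: "x \<in> {..<-x0} \<union> {x0<..}" using that by auto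
    then have "eventually (\<lambda>y. y \<in> {..<-x0} \<union> {x0<..}) (nhds x)"
      by (intro eventually_nhds_in_open) auto
    then have ev: "eventually (\<lambda>y. Vo y = V y) (nhds x)" "eventually (\<lambda>y. Po y = P y) (nhds x)"
      by (eventually_elim, use x0 in \<open>auto simp: V_def P_def\<close>)+
    have "x \<noteq> 0" using False x0 by auto
    then have "(Vo has_real_derivative P x) (at x)" "(Po has_real_derivative V x - glue g \<beta> \<gamma> x0 Vp Vm x) (at x)"
      using Vo'[of x] Po'[of x] False glue_out[of x] by (auto simp: V_def P_def)
    then show ?thesis using DERIV_cong_ev[OF refl ev(1) refl] DERIV_cong_ev[OF refl ev(2) refl] by auto
  qed
  have ev: "eventually (\<lambda>x. Vc (x + (y0 - x0)) = V x) at_top"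
      "eventually (\<lambda>x. Pc (x + (y0 - x0)) = P x) at_top"
    using eventually_ge_at_top[of x0]
    by (eventually_elim, use x0 in \<open>auto simp: V_def Vo_def P_def Po_def algebra_simps\<close>)+
  have sh: "filterlim (\<lambda>x. x + (y0 - x0)) at_top at_top"
    by (rule filterlim_tendsto_add_at_top[OF tendsto_const filterlim_ident, of "y0 - x0", simplified add.commute])
  show ?thesis
  proof (rule exI[of _ V], rule exI[of _ P], intro conjI allI impI)
    show "(V has_real_derivative P x) (at x)" for x
      by (rule DERIV_removable[of "{-x0, x0}" UNIV]) (use isC der in auto)
    show "continuous_on UNIV P" by (rule Pcont)
    show "(P has_real_derivative V x - glue g \<beta> \<gamma> x0 Vp Vm x) (at x)" if "x \<notin> {-x0, x0}" for x
      using der[OF that] by blast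
    \<comment> \<open>Inside, \<open>Gp (V x) > Gp (g \<gamma>)\<close> caps the kinetic energy;
      outside, the speed is at most \<open>g \<beta> < 1\<close>. The sum covers both cases.\<close>
    show "\<bar>P x\<bar> \<le> 1 + sqrt (2 * (energy_at v0 - Gp (g \<gamma>)))" for x
    proof -
      have *: "0 \<le> energy_at v0 - Gp (g \<gamma>)"
        using Gp_strict_mono[of "g \<gamma>" v0] v0 Gm_neg[OF v0(3,2)] g_\<beta>_less \<beta>\<gamma>
        by (cases "g \<gamma> = v0") (auto simp: energy_at_def)
      show ?thesis
      proof (cases "\<bar>x\<bar> < x0")
        case True
        then have "Gp (g \<gamma>) < Gp (Vp x)" using Vin[OF True] by (intro Gp_strict_mono) (auto simp: V_def)
        then have "(Pp x)\<^sup>2 \<le> 2 * (energy_at v0 - Gp (g \<gamma>))" using D(3)[of x] True by (auto simp: abs_less_iff)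
        then have "\<bar>Pp x\<bar> \<le> sqrt (2 * (energy_at v0 - Gp (g \<gamma>)))"
          by (rule real_le_rsqrt[of "\<bar>Pp x\<bar>", simplified])
        then show ?thesis using True by (simp add: P_def)
      next
        case False
        have "\<bar>Po x\<bar> \<le> 1"
          using abs_Pc_le[of "\<bar>x\<bar> - x0 + y0"] Vc_le[of "\<bar>x\<bar> - x0 + y0"] g_\<beta>_less \<beta>\<gamma>
          by (auto simp: Po_def abs_mult sgn_if)
        moreover have "0 \<le> sqrt (2 * (energy_at v0 - Gp (g \<gamma>)))" using * by simp
        ultimately show ?thesis using False unfolding P_def by (simp del: real_sqrt_ge_0_iff)
      qed
    qed
    show "\<bar>V x\<bar> \<le> 1 + \<bar>g \<gamma>\<bar>" for x
      using Vin[of x] Vout[of x] g_\<beta>_less \<beta>\<gamma> by (cases "\<bar>x\<bar> < x0") auto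
    show "V (- x) = V x" for x using is_inner_even[OF inn, of x] by (auto simp: V_def Vo_def)
    show "(V \<longlongrightarrow> 0) at_top"
      by (rule Lim_transform_eventually[OF filterlim_compose[OF Vc_tendsto_0 sh] ev(1)])
    show "(P \<longlongrightarrow> 0) at_top"
      by (rule Lim_transform_eventually[OF filterlim_compose[OF Pc_tendsto_0 sh] ev(2)])
  qed (use glue_in glue_out Vin Vout in auto)
qed

end

end

lemma jump_at_imp_not_isCont: "jump_at U x \<Longrightarrow> \<not> isCont U x"
proof
  assume "jump_at U x" "isCont U x"
  then obtain l r where lr: "(U \<longlongrightarrow> l) (at_left x)" "(U \<longlongrightarrow> r) (at_right x)" "l \<noteq> r"
    by (auto simp: jump_at_def)
  have "(U \<longlongrightarrow> U x) (at_left x)" "(U \<longlongrightarrow> U x) (at_right x)"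
    using \<open>isCont U x\<close> by (auto simp: isCont_def intro: tendsto_within_subset)
  then show False
    using lr tendsto_unique[OF trivial_limit_at_left_real] tendsto_unique[OF trivial_limit_at_right_real]
    by metis
qed

lemma jump_atI:
  fixes U F G :: "real \<Rightarrow> real"
  assumes "isCont F x" "isCont G x" "F x \<noteq> G x" and e: "0 < e"
    and "\<And>y. x - e < y \<Longrightarrow> y < x \<Longrightarrow> U y = F y" "\<And>y. x < y \<Longrightarrow> y < x + e \<Longrightarrow> U y = G y"
  shows "jump_at U x"
  unfolding jump_at_def
proof (intro exI conjI)
  have "(F \<longlongrightarrow> F x) (at_left x)" "(G \<longlongrightarrow> G x) (at_right x)"
    using assms(1,2) by (auto simp: isCont_def intro: tendsto_within_subset)
  moreover have "eventually (\<lambda>y. F y = U y) (at_left x)"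
    using eventually_at_left_real[of "x - e" x] e by (auto elim!: eventually_mono simp: assms(5))
  moreover have "eventually (\<lambda>y. G y = U y) (at_right x)"
    using eventually_at_right_real[of x "x + e"] e by (auto elim!: eventually_mono simp: assms(6))
  ultimately show "(U \<longlongrightarrow> F x) (at_left x)" "(U \<longlongrightarrow> G x) (at_right x)"
    by (auto intro: Lim_transform_eventually)
qed (rule assms(3))

context bistable
begin

lemma family_ground_state:
  assumes v0: "g \<gamma> \<le> v0" "v0 < g \<beta>" "0 < v0" and fam: "family_data g \<beta> \<gamma> v0 vs x0 Vp Vm"
  defines "U \<equiv> glue g \<beta> \<gamma> x0 Vp Vm"
  shows "ground_state exp_kernel d f U" "{x. jump_at U x} = {- x0, x0}" "smooth_on (- {- x0, x0}) U"
proof -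
  note x0 = family_switch_pos[OF v0 fam]
  obtain V P where V: "\<forall>x. (V has_real_derivative P x) (at x)" and Pc: "continuous_on UNIV P"
    and P: "\<forall>x. x \<notin> {-x0, x0} \<longrightarrow> (P has_real_derivative V x - U x) (at x)"
    and Vb: "\<forall>x. \<bar>V x\<bar> \<le> 1 + \<bar>g \<gamma>\<bar>"
    and Pb: "\<forall>x. \<bar>P x\<bar> \<le> 1 + sqrt (2 * (energy_at v0 - Gp (g \<gamma>)))"
    and inner: "\<forall>x. \<bar>x\<bar> < x0 \<longrightarrow> U x = hp (V x) \<and> V x \<in> {g \<gamma><..<1}"
    and outer: "\<forall>x. x0 \<le> \<bar>x\<bar> \<longrightarrow> U x = hm (V x) \<and> V x \<in> {0<..<g \<beta>}"
    and even: "\<forall>x. V (- x) = V x" and lim: "(V \<longlongrightarrow> 0) at_top" "(P \<longlongrightarrow> 0) at_top"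
    using family_profile[OF v0 fam, folded U_def] by (elim exE conjE)
  note V = V[rule_format] and P = P[rule_format] and Vb = Vb[rule_format] and Pb = Pb[rule_format]
    and inner = inner[rule_format] and outer = outer[rule_format] and even = even[rule_format]
  have hpV: "isCont (\<lambda>x. hp (V x)) x" and hmV: "isCont (\<lambda>x. hm (V x)) x" for x
    by (rule isCont_o2[OF DERIV_isCont[OF V] isCont_hp] isCont_o2[OF DERIV_isCont[OF V] isCont_hm])+
  have Uc: "isCont U x" if "x \<notin> {-x0, x0}" for x
  proof (cases "\<bar>x\<bar> < x0")
    case True
    then have "eventually (\<lambda>y. y \<in> {-x0<..<x0}) (nhds x)" by (intro eventually_nhds_in_open) auto
    then have "eventually (\<lambda>y. U y = hp (V y)) (nhds x)" by eventually_elim (use inner in auto)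
    then show ?thesis using isCont_cong hpV by metis
  next
    case False
    then have "x \<in> {..<-x0} \<union> {x0<..}" using that by auto
    then have "eventually (\<lambda>y. y \<in> {..<-x0} \<union> {x0<..}) (nhds x)" by (intro eventually_nhds_in_open) auto
    then have "eventually (\<lambda>y. U y = hm (V y)) (nhds x)" by eventually_elim (use outer x0 in auto)
    then show ?thesis using isCont_cong hmV by metis
  qed
  show "ground_state exp_kernel d f U"
  proof (rule profile_ground_state[of V P "{-x0, x0}" U, OF V Pc _ _ Vb Pb])
    show "(P has_real_derivative V x - U x) (at x)" if "x \<notin> {-x0, x0}" for x by (rule P[OF that])
    show "0 < U x \<and> U x \<le> 1" for x
      using inner[of x] outer[of x] hp_range[of "V x"] hm_range[of "V x"] hm_pos[of "V x"] \<beta>\<gamma>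
      by (cases "\<bar>x\<bar> < x0") auto
    have "{x. \<not> isCont U x} \<subseteq> {-x0, x0}" using Uc by blast
    then show "finite {x. \<not> isCont U x}" by (rule finite_subset) simp
    show "U (- x) = U x" for x using inner[of x] inner[of "- x"] outer[of x] outer[of "- x"] even[of x]
      by (cases "\<bar>x\<bar> < x0") auto
    show "g (U x) = V x" for x
      using inner[of x] outer[of x] g_hp[of "V x"] g_hm[of "V x"] by (cases "\<bar>x\<bar> < x0") auto
    have "eventually (\<lambda>x. hm (V x) = U x) at_top"
      using eventually_ge_at_top[of x0] by eventually_elim (use outer in auto)
    then show "(U \<longlongrightarrow> 0) at_top" by (rule Lim_transform_eventually[OF hm_tendsto_0[OF lim(1)]])
  qed (use lim in auto)
  show "{x. jump_at U x} = {- x0, x0}"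
  proof
    show "{x. jump_at U x} \<subseteq> {- x0, x0}" using Uc jump_at_imp_not_isCont by blast
    \<comment> \<open>The branches take values on either side of the gap
      \<open>(\<beta>, \<gamma>)\<close>, so a switch at a common height is a genuine jump.\<close>
    have ne: "hp (V x) \<noteq> hm (V x)" for x using hp_range[of "V x"] hm_range[of "V x"] \<beta>\<gamma> by simp
    have "jump_at U x0"
      by (rule jump_atI[OF hpV hmV ne, of x0]) (use x0 inner outer in auto)
    moreover have "jump_at U (- x0)"
      by (rule jump_atI[OF hmV hpV ne[symmetric], of x0]) (use x0 inner outer in auto)
    ultimately show "{- x0, x0} \<subseteq> {x. jump_at U x}" by auto
  qed
  have 1: "smooth_on {-x0<..<x0} U"
  proof (rule smooth_on_cong[of _ "\<lambda>x. hp (V x)"])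
    show "smooth_on {-x0<..<x0} (\<lambda>x. hp (V x))"
    proof (rule smooth_on_second_order_solution[OF _ _ smooth_hp])
      show "(P has_real_derivative V x - hp (V x)) (at x)" if "x \<in> {-x0<..<x0}" for x
        using P[of x] inner[of x] that by auto
    qed (use V inner in auto)
  qed (use inner in auto)
  have 2: "smooth_on ({..<-x0} \<union> {x0<..}) U"
  proof (rule smooth_on_cong[of _ "\<lambda>x. hm (V x)"])
    show "smooth_on ({..<-x0} \<union> {x0<..}) (\<lambda>x. hm (V x))"
    proof (rule smooth_on_second_order_solution[OF _ _ smooth_hm])
      show "(P has_real_derivative V x - hm (V x)) (at x)" if "x \<in> {..<-x0} \<union> {x0<..}" for x
        using P[of x] outer[of x] that x0 by auto
      show "V x \<in> {0<..<g \<beta>}" if "x \<in> {..<-x0} \<union> {x0<..}" for x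
        using outer[of x] that x0 by auto
    qed (use V in auto)
  qed (use outer x0 in auto)
  show "smooth_on (- {- x0, x0}) U"
  proof (rule smooth_on_subset[OF smooth_on_Un[OF 1 2]])
    show "- {- x0, x0} \<subseteq> {- x0<..<x0} \<union> ({..<- x0} \<union> {x0<..})" by auto
  qed
qed

end

section \<open>Uniqueness\<close>

lemma no_crossing:
  fixes F :: "real \<Rightarrow> real"
  assumes "is_interval S" "continuous_on S F" "\<And>x. x \<in> S \<Longrightarrow> F x \<noteq> c" "m \<in> S" "F m < c" "x \<in> S"
  shows "F x < c"
proof (rule ccontr)
  assume "\<not> F x < c"
  have "is_interval (F ` S)"
    using assms(1,2) by (simp add: is_interval_connected_1 connected_continuous_image)
  then have "c \<in> F ` S"
    using mem_is_interval_1_I[of "F ` S" "F m" "F x" c] assms(4-6) \<open>\<not> F x < c\<close> by auto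
  then show False using assms(3) by auto
qed

lemma eq_off_finite:
  fixes F G :: "real \<Rightarrow> real"
  assumes "isCont F x" "isCont G x" "finite D" "\<And>y. y \<notin> D \<Longrightarrow> F y = G y"
  shows "F x = G x"
proof (rule tendsto_unique[of "at x"])
  have "open (- (D - {x}))" using assms(3) by (intro open_Compl finite_imp_closed) auto
  then have "eventually (\<lambda>y. y \<in> - (D - {x})) (at x)" by (rule eventually_at_in_open') auto
  moreover have "eventually (\<lambda>y. y \<noteq> x) (at x)" by (rule eventually_neq_at_within)
  ultimately have "eventually (\<lambda>y. F y = G y) (at x)" by eventually_elim (use assms(4) in auto)
  then show "(G \<longlongrightarrow> F x) (at x)"
    using assms(1) by (auto simp: isCont_def elim: Lim_transform_eventually)
  show "(G \<longlongrightarrow> G x) (at x)" using assms(2) by (simp add: isCont_def)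
qed simp

lemma AE_eq_off_finite:
  fixes F G :: "real \<Rightarrow> real"
  assumes "finite D" "\<And>y. y \<notin> D \<Longrightarrow> F y = G y"
  shows "AE x in lebesgue. F x = G x"
proof -
  have "D \<in> null_sets lebesgue" using assms(1) negligible_finite negligible_iff_null_sets by blast
  then show ?thesis by (rule AE_mp[OF AE_not_in]) (use assms(2) in auto)
qed

text \<open>\<open>F\<close> differs from a global antiderivative of \<open>\<phi>\<close> by a
  constant on the closed interval. This yields the one-sided derivatives at the ends, where the
  two-sided removability argument does not apply.\<close>

lemma DERIV_within_Icc_removable:
  fixes F \<phi> :: "real \<Rightarrow> real"
  assumes F: "continuous_on {l..u} F" and \<phi>: "continuous_on UNIV \<phi>"
    and der: "\<And>y. l < y \<Longrightarrow> y < u \<Longrightarrow> (F has_real_derivative \<phi> y) (at y)" and lu: "l < u" and x: "x \<in> {l..u}"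
  shows "(F has_real_derivative \<phi> x) (at x within {l..u})"
proof -
  define A where "A = antiderivative_from 0 \<phi>"
  have A: "(A has_real_derivative \<phi> y) (at y)" for y
    unfolding A_def by (rule antiderivative_from(2)[OF \<phi>])
  have "continuous_on {l..u} A"
    by (intro continuous_at_imp_continuous_on ballI DERIV_isCont[OF A])
  then have "F y - A y = F l - A l" if "y \<in> {l..u}" for y
    by (intro DERIV_isconst2[OF lu, of "\<lambda>y. F y - A y"])
      (use that F der DERIV_diff[OF der A] in \<open>auto intro!: continuous_intros\<close>)
  then have eq: "A y + (F l - A l) = F y" if "y \<in> {l..u}" for y using that by (simp add: algebra_simps)
  have "((\<lambda>y. A y + (F l - A l)) has_real_derivative \<phi> x) (at x within {l..u})"
    using has_field_derivative_at_within[OF A] by (auto intro!: derivative_eq_intros)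
  then show ?thesis
    by (rule has_field_derivative_transform_within[OF _ zero_less_one x]) (use eq in auto)
qed

section \<open>Continuous ground states\<close>

context bistable
begin

lemma energy_deriv:
  assumes "(V has_real_derivative P y) (at y)" "(P has_real_derivative V y - h (V y)) (at y)"
    and "(G has_real_derivative h (V y) - V y) (at (V y))"
  shows "((\<lambda>x. (P x)\<^sup>2 / 2 + G (V x)) has_real_derivative 0) (at y)"
proof -
  have "((\<lambda>x. (P x)\<^sup>2 / 2 + G (V x)) has_real_derivative
      (2 * P y * (V y - h (V y))) / 2 + (h (V y) - V y) * P y) (at y)"
    using assms(1,2) DERIV_chain2[OF assms(3,1)] by (auto intro!: derivative_eq_intros)
  moreover have "(2 * P y * (V y - h (V y))) / 2 + (h (V y) - V y) * P y = 0"
    by (simp add: field_simps)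
  ultimately show ?thesis by simp
qed

text \<open>The energy is constant to the right of \<open>p\<close>. It tends to 0 because
  \<open>V\<close> does and because \<open>P\<close> is squeezed by \<open>V\<close>.\<close>

lemma tail_energy:
  fixes V P :: "real \<Rightarrow> real"
  assumes V': "\<And>x. (V has_real_derivative P x) (at x)" and P: "continuous_on UNIV P"
    and P': "\<And>x. p < x \<Longrightarrow> (P has_real_derivative V x - hm (V x)) (at x)"
    and lim: "(V \<longlongrightarrow> 0) at_top" and le: "\<And>x. \<bar>P x\<bar> \<le> V x" and x: "p \<le> x"
  shows "(P x)\<^sup>2 / 2 + Gm (V x) = 0"
proof -
  define e where "e = (\<lambda>x. (P x)\<^sup>2 / 2 + Gm (V x))"
  have Vc: "continuous_on S V" for S
    using V' by (meson DERIV_isCont continuous_at_imp_continuous_on)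
  have ec: "continuous_on S e" for S
    unfolding e_def
    by (intro continuous_intros continuous_on_compose2[OF continuous_on_Gm Vc] continuous_on_subset[OF P]) auto
  have e': "(e has_real_derivative 0) (at y)" if "p < y" for y
    unfolding e_def by (rule energy_deriv[where V = V and P = P and h = hm and G = Gm, OF V' P'[OF that] Gm_deriv])
  have const: "e y = e x" if "x < y" for y
    by (rule DERIV_isconst_end[OF that ec]) (use e' x in auto)
  have "norm (P y) \<le> norm (V y) * 1" for y using order_trans[OF le abs_ge_self, of y] by simp
  then have "(P \<longlongrightarrow> 0) at_top"
    by (intro tendsto_0_le[OF lim, of P 1] always_eventually allI)
  then have "(e \<longlongrightarrow> 0\<^sup>2 / 2 + Gm 0) at_top"
    unfolding e_def by (intro tendsto_intros isCont_tendsto_compose[OF isCont_Gm] lim) auto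
  then have "(e \<longlongrightarrow> 0) at_top" by simp
  moreover have "(e \<longlongrightarrow> e x) at_top"
    by (rule tendsto_eventually, rule eventually_mono[OF eventually_gt_at_top[of x]]) (rule const)
  ultimately have "0 = e x" using tendsto_unique[OF trivial_limit_at_top_linorder] by blast
  then show ?thesis by (simp add: e_def)
qed

text \<open>Stated for a profile, not for a ground state, so that it also applies to the continuous
  representative of a ground state with irregular values at isolated points. \<open>W\<close> may a
  priori visit the middle branch, the upper branch or values above 1, and the proof has to exclude
  this.\<close>

lemma continuous_ground_state_unique:
  fixes V P W :: "real \<Rightarrow> real"
  assumes V': "\<And>x. (V has_real_derivative P x) (at x)"
    and P': "\<And>x. (P has_real_derivative V x - W x) (at x)"
    and W: "continuous_on UNIV W" and le: "\<And>x. \<bar>P x\<bar> \<le> V x" and Vpos: "\<And>x. 0 < V x"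
    and Wnn: "\<And>x. 0 \<le> W x" and gW: "\<And>x. g (W x) = V x"
    and Veven: "\<And>x. V (- x) = V x" and Weven: "\<And>x. W (- x) = W x" and P0: "P 0 = 0"
    and Vlim: "(V \<longlongrightarrow> 0) at_top" and Wlim: "(W \<longlongrightarrow> 0) at_top"
  shows "W x = Uc x"
proof -
  have Vc: "continuous_on S V" and Pc: "continuous_on S P" for S
    using V' P' by (meson DERIV_isCont continuous_at_imp_continuous_on)+
  have Wc: "continuous_on S W" for S using W by (rule continuous_on_subset) simp
  have low: "W x = hm (V x) \<and> V x < g \<beta>" if "W x < \<beta>" for x
    using hm_g[of "W x"] g_mono_minus[of "W x" \<beta>] Wnn[of x] that gW[of x] by auto
  have tailE: "(P x)\<^sup>2 / 2 + Gm (V x) = 0" if "\<And>y. p < y \<Longrightarrow> W y < \<beta>" "p \<le> x" for p x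
  proof (rule tail_energy[OF V' Pc _ Vlim le that(2)])
    show "(P has_real_derivative V y - hm (V y)) (at y)" if "p < y" for y
      using P'[of y] low[OF \<open>\<And>y. p < y \<Longrightarrow> W y < \<beta>\<close>[OF that]] by simp
  qed
  have "eventually (\<lambda>x. W x < \<beta>) at_top" using order_tendstoD(2)[OF Wlim] \<beta>\<gamma> by simp
  then obtain R where R: "\<And>x. R \<le> x \<Longrightarrow> W x < \<beta>" by (auto simp: eventually_at_top_linorder)
  define Z where "Z = {0..R} \<inter> W -` {\<beta>..}"
  \<comment> \<open>If \<open>W\<close> stayed below \<open>\<beta>\<close> on the half-line, the
    energy would be 0 up to time 0, where \<open>P 0 = 0\<close> and
    \<open>Gm (V 0) < 0\<close>.\<close>
  have "Z \<noteq> {}"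
  proof
    assume "Z = {}"
    then have all: "W x < \<beta>" if "0 \<le> x" for x using R[of x] that by (cases "x \<le> R") (auto simp: Z_def)
    then have "(P 0)\<^sup>2 / 2 + Gm (V 0) = 0" using tailE[of 0 0] by auto
    then show False using P0 Gm_neg[of "V 0"] Vpos[of 0] low[of 0] all[of 0] by simp
  qed
  have "closed Z" unfolding Z_def using Wc by (intro continuous_closed_preimage) auto
  moreover have "bounded Z" unfolding Z_def by (rule bounded_subset[OF bounded_closed_interval[of 0 R]]) auto
  ultimately have "compact Z" by (simp add: compact_eq_bounded_closed)
  then obtain p where p: "p \<in> Z" "\<And>x. x \<in> Z \<Longrightarrow> x \<le> p"
    using compact_attains_sup[OF \<open>compact Z\<close> \<open>Z \<noteq> {}\<close>] by blast
  have p0: "0 \<le> p" and Wp_ge: "\<beta> \<le> W p" using p by (auto simp: Z_def)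
  have above: "W x < \<beta>" if "p < x" for x
    using p(2)[of x] R[of x] that p0 by (cases "x \<le> R"; cases "W x < \<beta>") (auto simp: Z_def)
  have "W p \<le> \<beta>"
  proof (rule tendsto_upperbound)
    show "(W \<longlongrightarrow> W p) (at_right p)"
      using W by (auto simp: continuous_on_eq_continuous_at isCont_def intro: tendsto_within_subset)
    show "eventually (\<lambda>x. W x \<le> \<beta>) (at_right p)"
      using eventually_at_right_less[of p] by eventually_elim (use above in \<open>auto intro: less_imp_le\<close>)
  qed simp
  then have Wp: "W p = \<beta>" using Wp_ge by simp
  then have Vp: "V p = g \<beta>" using gW[of p] by simp
  have E: "(P x)\<^sup>2 / 2 + Gm (V x) = 0" if "p \<le> x" for x using tailE[of p x] above that by blast
  have Pp: "P p = 0" using E[of p] Vp by simp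
  have P_nz: "P x \<noteq> 0" if "p < x" for x
    using E[of x] Gm_neg[OF Vpos[of x]] low[OF above[OF that]] that by auto
  have P_neg: "P x < 0" if "p < x" for x
  proof (rule ccontr)
    assume "\<not> P x < 0"
    then have "0 < P x" using P_nz[OF that] by simp
    have pos: "- P y < 0" if "y \<in> {p<..}" for y
      by (rule no_crossing[of "{p<..}" "\<lambda>y. - P y" 0 x])
        (use \<open>0 < P x\<close> \<open>p < x\<close> that P_nz in \<open>auto intro!: continuous_intros Pc\<close>)
    have "V x \<le> V y" if "x \<le> y" for y
    proof (rule DERIV_nonneg_imp_nondecreasing[OF that])
      fix z assume "x \<le> z" "z \<le> y"
      then show "\<exists>d. (V has_real_derivative d) (at z) \<and> 0 \<le> d"
        using V'[of z] pos[of z] \<open>p < x\<close> by (intro exI[of _ "P z"]) auto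
    qed
    then have "V x \<le> 0"
      by (intro tendsto_lowerbound[OF Vlim]) (auto simp: eventually_at_top_linorder)
    then show False using Vpos[of x] by simp
  qed
  have V_tail: "V x = Vc (x - p)" if "p \<le> x" for x
  proof -
    have "V x = Vc (x - p + Yc (V p))"
    proof (rule descending_is_translate_closed[OF _ Vc that])
      show "(V has_real_derivative P y) (at y) \<and> 0 < V y \<and> V y < g \<beta> \<and> P y < 0 \<and> (P y)\<^sup>2 / 2 + Gm (V y) = 0"
        if "p < y" for y
        using V' Vpos low[OF above[OF that]] P_neg[OF that] E[of y] that by auto
    qed
    moreover have "Yc (g \<beta>) = 0" using Yc_Vc[of 0] by simp
    ultimately show ?thesis using Vp by simp
  qed
  have "p = 0"
  proof (rule ccontr)
    assume "p \<noteq> 0"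
    then have "0 < p" using p0 by simp
    \<comment> \<open>\<open>P p = 0\<close> and \<open>P\<close> has slope
      \<open>g \<beta> - \<beta> < 0\<close> at \<open>p\<close>, so \<open>P\<close> is positive
      just to the left.\<close>
    have "V p - W p < 0" using Vp Wp g_\<beta>_less by simp
    then obtain \<epsilon>' where "0 < \<epsilon>'" "\<And>h. 0 < h \<Longrightarrow> h < \<epsilon>' \<Longrightarrow> P p < P (p - h)"
      using DERIV_neg_dec_left[OF P'[of p]] by blast
    then obtain \<epsilon> where \<epsilon>: "0 < \<epsilon>" "\<epsilon> < p" "\<And>x. p - \<epsilon> < x \<Longrightarrow> x < p \<Longrightarrow> 0 < P x"
    proof (intro that[of "min \<epsilon>' (p / 2)"])
      fix x assume "p - min \<epsilon>' (p / 2) < x" "x < p"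
      then show "0 < P x" using \<open>\<And>h. 0 < h \<Longrightarrow> h < \<epsilon>' \<Longrightarrow> P p < P (p - h)\<close>[of "p - x"] Pp by auto
    qed (use \<open>0 < p\<close> \<open>0 < \<epsilon>'\<close> in auto)
    \<comment> \<open>Stopping at \<open>q\<close> keeps \<open>p\<close> itself, where
      \<open>V = g \<beta>\<close>, out of \<open>S\<close>; by evenness \<open>- p\<close> belongs
      to \<open>S\<close>, so the last point \<open>r\<close> exists.\<close>
    define q where "q = p - \<epsilon> / 2"
    define S where "S = {- p..q} \<inter> V -` {g \<beta>..}"
    have "closed S" unfolding S_def using Vc by (intro continuous_closed_preimage) auto
    moreover have "bounded S" unfolding S_def by (rule bounded_subset[OF bounded_closed_interval[of "- p" q]]) auto
    ultimately have "compact S" by (simp add: compact_eq_bounded_closed)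
    have "- p \<in> S" using Veven[of p] Vp \<epsilon> by (simp add: S_def q_def)
    then have "S \<noteq> {}" by blast
    obtain r where r: "r \<in> S" "\<And>x. x \<in> S \<Longrightarrow> x \<le> r"
      using compact_attains_sup[OF \<open>compact S\<close> \<open>S \<noteq> {}\<close>] by blast
    have rq: "r \<le> q" "- p \<le> r" "g \<beta> \<le> V r" using r(1) by (auto simp: S_def)
    have rp: "r < p" using rq \<epsilon> by (simp add: q_def)
    have near: "V x < g \<beta>" if "p - \<epsilon> < x" "x < p" for x
    proof -
      have "V x < V p"
      proof (rule DERIV_pos_imp_increasing_open[OF that(2) _ Vc])
        show "\<exists>d. (V has_real_derivative d) (at y) \<and> 0 < d" if "x < y" "y < p" for y
          using V'[of y] \<epsilon>(3)[of y] that \<open>p - \<epsilon> < x\<close> by (intro exI[of _ "P y"]) auto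
      qed
      then show ?thesis using Vp by simp
    qed
    have below: "V x < g \<beta>" if "r < x" "x < p" for x
    proof (cases "x \<le> q")
      case True
      then show ?thesis using r(2)[of x] that rq by (cases "V x < g \<beta>") (auto simp: S_def)
    next
      case False
      then show ?thesis using near[of x] that \<epsilon> by (simp add: q_def)
    qed
    \<comment> \<open>A point of \<open>(r, p)\<close> so close to \<open>p\<close> that
      \<open>P m > 0\<close>. Since \<open>W\<close> avoids \<open>\<beta>\<close> on
      \<open>(r, p)\<close>, its value at \<open>m\<close> decides between the two cases.\<close>
    define m where "m = max ((r + p) / 2) (p - \<epsilon> / 4)"
    have m: "r < m" "m < p" "p - \<epsilon> < m" using rp \<epsilon> by (auto simp: m_def max_def)
    have W_nb: "W x \<noteq> \<beta>" if "x \<in> {r<..<p}" for x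
      using below[of x] that gW[of x] by auto
    have Ppos: "0 < P x" if x: "r < x" "x < p" for x
    proof (cases "W m < \<beta>")
      case True
      have Wlow: "W y < \<beta>" if "y \<in> {r<..<p}" for y
        by (rule no_crossing[of "{r<..<p}" W \<beta> m]) (use m True that W_nb Wc in auto)
      \<comment> \<open>Zero energy passes from \<open>p\<close> to the left, and
        \<open>V < g \<beta>\<close> then forbids zeros of \<open>P\<close>; so the sign of
        \<open>P\<close> at \<open>m\<close> persists.\<close>
      have energy: "(P y)\<^sup>2 / 2 + Gm (V y) = 0" if "r < y" "y < p" for y
      proof -
        have "(\<lambda>x. (P x)\<^sup>2 / 2 + Gm (V x)) p = (\<lambda>x. (P x)\<^sup>2 / 2 + Gm (V x)) y"
        proof (rule DERIV_isconst_end[OF that(2)])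
          show "continuous_on {y..p} (\<lambda>x. (P x)\<^sup>2 / 2 + Gm (V x))"
            by (intro continuous_intros Pc continuous_on_compose2[OF continuous_on_Gm Vc]) auto
          fix z assume z: "y < z" "z < p"
          have "(P has_real_derivative V z - hm (V z)) (at z)"
            using P'[of z] low[OF Wlow[of z]] z that by simp
          then show "((\<lambda>x. (P x)\<^sup>2 / 2 + Gm (V x)) has_real_derivative 0) (at z)"
            by (rule energy_deriv[where V = V and P = P and h = hm and G = Gm, OF V' _ Gm_deriv])
        qed
        then show ?thesis using E[of p] by simp
      qed
      have nz: "P y \<noteq> 0" if "y \<in> {r<..<p}" for y
        using energy[of y] Gm_neg[OF Vpos[of y] below[of y]] that by auto
      have "- P x < 0"
        by (rule no_crossing[of "{r<..<p}" "\<lambda>y. - P y" 0 m])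
          (use m x nz \<epsilon>(3)[of m] in \<open>auto intro!: continuous_intros Pc\<close>)
      then show ?thesis by simp
    next
      case False
      then have Wm: "\<beta> < W m" using W_nb[of m] m by simp
      have high: "\<beta> < W y" if "y \<in> {r<..<p}" for y
      proof -
        have "- W y < - \<beta>"
          by (rule no_crossing[of "{r<..<p}" "\<lambda>y. - W y" "- \<beta>" m])
            (use m Wm that W_nb in \<open>auto intro!: continuous_intros Wc\<close>)
        then show ?thesis by simp
      qed
      \<comment> \<open>\<open>W = 1\<close> would mean \<open>V = 1 > g \<beta>\<close>. Starting
        from \<open>W p = \<beta>\<close>, \<open>W\<close> thus stays in
        \<open>(\<beta>, 1)\<close>, where \<open>g W < W\<close> and \<open>V\<close> is strictly
        concave.\<close>
      have W1: "W y < 1" if "y \<in> {r<..p}" for y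
      proof (rule no_crossing[of "{r<..p}" W 1 p])
        show "W z \<noteq> 1" if "z \<in> {r<..p}" for z
          using below[of z] that gW[of z] Vp g_\<beta>_less \<beta>\<gamma> by (cases "z = p") auto
      qed (use that rp Wp \<beta>\<gamma> Wc in auto)
      have "P p < P x"
      proof (rule DERIV_neg_imp_decreasing_open[OF x(2) _ Pc])
        fix y assume y: "x < y" "y < p"
        have "V y - W y < 0"
          using g_lt[of "W y"] high[of y] W1[of y] y x a_less_\<beta> gW[of y] by auto
        then show "\<exists>d. (P has_real_derivative d) (at y) \<and> d < 0" using P'[of y] by blast
      qed
      then show ?thesis using Pp by simp
    qed
    have "V r < V p"
    proof (rule DERIV_pos_imp_increasing_open[OF rp _ Vc])
      show "\<exists>d. (V has_real_derivative d) (at y) \<and> 0 < d" if "r < y" "y < p" for y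
        using V'[of y] Ppos[OF that] by blast
    qed
    then show False using rq Vp by simp
  qed
  have pos: "W x = Uc x" if "0 \<le> x" for x
  proof (cases "x = 0")
    case True
    have "hm (g \<beta>) = \<beta>" using hm_g[of \<beta>] \<beta>\<gamma> by simp
    then show ?thesis using True Wp \<open>p = 0\<close> by (simp add: Uc_def)
  next
    case False
    then show ?thesis using low[OF above[of x]] V_tail[of x] that \<open>p = 0\<close> by (simp add: Uc_def)
  qed
  show ?thesis
  proof (cases "0 \<le> x")
    case False
    then have "W (- x) = Uc (- x)" by (intro pos) simp
    then show ?thesis by (simp add: Weven Uc_def Vc_even)
  qed (rule pos)
qed

end

section \<open>Ground states with at most two discontinuities\<close>

lemma symmetric_card_le_2:
  fixes D :: "real set"
  assumes "finite D" "card D \<le> 2" "\<And>x. x \<in> D \<Longrightarrow> - x \<in> D"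
  obtains p where "0 \<le> p" "D \<subseteq> {- p, p}"
proof (cases "\<exists>y\<in>D. y \<noteq> 0")
  case True
  then obtain y where y: "y \<in> D" "y \<noteq> 0" by blast
  have "{- y, y} = D"
    by (rule card_seteq[OF assms(1)]) (use y assms in auto)
  then show ?thesis using that[of "\<bar>y\<bar>"] by (cases "0 \<le> y") auto
next
  case False
  then show ?thesis using that[of 0] by auto
qed

context bistable
begin

lemma ground_state_potential:
  assumes W: "ground_state exp_kernel d f W" and fin: "finite {x. \<not> isCont W x}"
  shows "\<exists>V P. (\<forall>x. (V has_real_derivative P x) (at x)) \<and> continuous_on UNIV P \<and>
    (\<forall>x. isCont W x \<longrightarrow> (P has_real_derivative V x - W x) (at x)) \<and> (\<forall>x. \<bar>P x\<bar> \<le> V x) \<and>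
    (\<forall>x. 0 < V x) \<and> (\<forall>x. g (W x) = V x) \<and> (\<forall>x. V (- x) = V x) \<and> (\<forall>x. P (- x) = - P x) \<and>
    (V \<longlongrightarrow> 0) at_top"
proof -
  have meas: "W \<in> borel_measurable lebesgue" and pos: "\<And>x. 0 < W x" and even: "\<And>x. W (- x) = W x"
    and eq: "\<And>x. 0 = d * (- W x + convolve exp_kernel W x) + f (W x)" and lim: "(W \<longlongrightarrow> 0) at_top"
    using W by (auto simp: ground_state_def)
  obtain B where B: "\<And>x. \<bar>W x\<bar> \<le> B"
    using W by (auto simp: ground_state_def bounded_iff)
  define V where "V = convolve exp_kernel W"
  obtain P where P': "\<And>x. (V has_real_derivative P x) (at x)" "continuous_on UNIV P"
    "\<And>x. isCont W x \<Longrightarrow> (P has_real_derivative V x - W x) (at x)"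
    "(\<And>x. 0 \<le> W x) \<Longrightarrow> (\<forall>x. \<bar>P x\<bar> \<le> V x)"
    unfolding V_def using convolve_exp_kernel[OF meas B even fin] by metis
  then have P: "\<forall>x. (V has_real_derivative P x) (at x)" "continuous_on UNIV P"
    "\<forall>x. isCont W x \<longrightarrow> (P has_real_derivative V x - W x) (at x)" "\<forall>x. \<bar>P x\<bar> \<le> V x"
    using less_imp_le[OF pos] by auto
  have gW: "g (W x) = V x" for x
  proof -
    have "V x = W x - f (W x) / d" using eq[of x] d by (simp add: V_def field_simps)
    then show ?thesis by (simp add: g_def)
  qed
  have Vlim: "(V \<longlongrightarrow> 0) at_top"
    using isCont_tendsto_compose[OF isCont_g lim] by (simp add: gW)
  have Veven: "V (- x) = V x" for x using gW[of x] gW[of "- x"] even[of x] by simp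
  have Podd: "P (- x) = - P x" for x
  proof -
    have "((\<lambda>x. V (- x)) has_real_derivative P (- x) * (- 1)) (at x)"
      by (rule DERIV_chain2[of V]) (use P(1) in \<open>auto intro!: derivative_eq_intros\<close>)
    then have "(V has_real_derivative - P (- x)) (at x)" by (simp add: Veven)
    then show ?thesis using DERIV_unique P(1) by fastforce
  qed
  \<comment> \<open>Far out \<open>0 < W < a\<close>, where \<open>g W > W\<close>. From such a
    point to the left of \<open>x\<close> the speed limit carries positivity to
    \<open>x\<close>.\<close>
  have "0 < V x" for x
  proof -
    have "eventually (\<lambda>y. W y < a \<and> - x \<le> y) at_top"
      using order_tendstoD(2)[OF lim a(1)] eventually_ge_at_top by (rule eventually_conj)
    then obtain y where y: "W y < a" "- x \<le> y" by (auto simp: eventually_at_top_linorder)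
    then have "0 < V (- y)" using g_gt[OF pos[of y] y(1)] gW[of y] Veven[of y] pos[of y] by simp
    moreover have "V (- y) * exp (- y - x) \<le> V x"
      by (rule exp_decay_bound)
        (use y P in \<open>auto intro!: continuous_at_imp_continuous_on intro: DERIV_isCont\<close>)
    ultimately show ?thesis by (meson exp_gt_zero less_le_trans mult_pos_pos)
  qed
  then show ?thesis using P gW Vlim Veven Podd by blast
qed

context
  fixes W :: "real \<Rightarrow> real"
  assumes W: "ground_state exp_kernel d f W"
begin

lemma ground_state_facts:
  "0 < W x" "W (- x) = W x" "(W \<longlongrightarrow> 0) at_top"
  using W by (auto simp: ground_state_def)

lemma continuous_ground_state_eq: assumes "continuous_on UNIV W" shows "W x = Uc x"
proof -
  have c: "isCont W x" for x using assms by (simp add: continuous_on_eq_continuous_at)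
  then have fin: "finite {x. \<not> isCont W x}" by simp
  obtain V P where V: "\<forall>x. (V has_real_derivative P x) (at x)" "continuous_on UNIV P"
    "\<forall>x. isCont W x \<longrightarrow> (P has_real_derivative V x - W x) (at x)" "\<forall>x. \<bar>P x\<bar> \<le> V x"
    "\<forall>x. 0 < V x" "\<forall>x. g (W x) = V x" "\<forall>x. V (- x) = V x" "\<forall>x. P (- x) = - P x" "(V \<longlongrightarrow> 0) at_top"
    using ground_state_potential[OF W fin] by (elim exE conjE)
  have "P 0 = 0" using spec[OF V(8), of 0] by simp
  then show ?thesis
    using V c by (intro continuous_ground_state_unique[of V P W])
      (auto simp: ground_state_facts assms less_imp_le)
qed

text \<open>\<open>W\<close> avoids the level \<open>k\<close> midway between the branches and is
  continuous off \<open>{- p, p}\<close>, so it keeps to one branch on each of the three intervals.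
  On the outer two the decay at infinity selects the lower branch.\<close>

lemma two_branch_ground_state_cases:
  assumes range: "range W \<subseteq> {0..\<beta>} \<union> {\<gamma>..1}" and fin: "finite {x. \<not> isCont W x}"
    and card: "card {x. \<not> isCont W x} \<le> 2"
  shows "\<exists>p\<ge>0. {x. \<not> isCont W x} \<subseteq> {- p, p} \<and> (\<forall>x. p < \<bar>x\<bar> \<longrightarrow> W x \<le> \<beta>) \<and>
    ((\<forall>x. \<bar>x\<bar> < p \<longrightarrow> W x \<le> \<beta>) \<or> 0 < p \<and> (\<forall>x. \<bar>x\<bar> < p \<longrightarrow> \<gamma> \<le> W x))"
proof -
  have sym: "- x \<in> {x. \<not> isCont W x}" if "x \<in> {x. \<not> isCont W x}" for x
  proof -
    have "isCont W x" if "isCont W (- x)"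
      using isCont_o2[OF isCont_minus[OF continuous_ident], where g = W and a = x] that
      by (simp add: ground_state_facts)
    then show ?thesis using that by auto
  qed
  obtain p where p: "0 \<le> p" "{x. \<not> isCont W x} \<subseteq> {- p, p}"
    using symmetric_card_le_2[OF fin card sym] by blast
  have c: "continuous_on S W" if "S \<inter> {-p, p} = {}" for S
    using p(2) that by (intro continuous_at_imp_continuous_on) auto
  define k where "k = (\<beta> + \<gamma>) / 2"
  have k: "\<beta> < k" "k < \<gamma>" using \<beta>\<gamma> by (auto simp: k_def)
  have dich: "W x \<le> \<beta> \<or> \<gamma> \<le> W x" for x using range by (auto simp: image_subset_iff)
  then have nk: "W x \<noteq> k" and lt: "W x < k \<Longrightarrow> W x \<le> \<beta>" and gt: "k < W x \<Longrightarrow> \<gamma> \<le> W x" for x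
    using k by (smt (verit))+
  have "eventually (\<lambda>x. W x < k \<and> p < x) at_top"
    using order_tendstoD(2)[OF ground_state_facts(3), of k] k \<beta>\<gamma>
    by (intro eventually_conj eventually_gt_at_top) auto
  then obtain m where m: "W m < k" "p < m" by (auto simp: eventually_at_top_linorder)
  have right: "W x \<le> \<beta>" if "p < x" for x
    by (rule lt, rule no_crossing[of "{p<..}" W k m]) (use m nk that p in \<open>auto intro!: c\<close>)
  have out: "W x \<le> \<beta>" if "p < \<bar>x\<bar>" for x
    using right[of x] right[of "- x"] ground_state_facts(2)[of x] that by (cases "0 \<le> x") auto
  have "(\<forall>x. \<bar>x\<bar> < p \<longrightarrow> W x \<le> \<beta>) \<or> 0 < p \<and> (\<forall>x. \<bar>x\<bar> < p \<longrightarrow> \<gamma> \<le> W x)"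
  proof (cases "W 0 < k")
    case True
    have "W x \<le> \<beta>" if "\<bar>x\<bar> < p" for x
      by (rule lt, rule no_crossing[of "{-p<..<p}" W k 0]) (use True nk that in \<open>auto intro!: c\<close>)
    then show ?thesis by blast
  next
    case False
    then have "k < W 0" using nk[of 0] by simp
    have "\<gamma> \<le> W x" if "\<bar>x\<bar> < p" for x
    proof (rule gt)
      have "- W x < - k"
        by (rule no_crossing[of "{-p<..<p}" "\<lambda>x. - W x" "- k" 0])
          (use \<open>k < W 0\<close> nk that in \<open>auto intro!: continuous_intros c\<close>)
      then show "k < W x" by simp
    qed
    then show ?thesis using p(1) by (cases "p = 0") auto
  qed
  then show ?thesis using p out by blast
qed

text \<open>\<open>hm V\<close> is a continuous representative of \<open>W\<close>: the two agree
  off \<open>D\<close>, and both \<open>g U = V\<close> and the differential equation extend to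
  \<open>D\<close> by continuity.\<close>

lemma one_branch_ground_state_eq:
  assumes D: "finite D" "{x. \<not> isCont W x} \<subseteq> D" and low: "\<And>x. x \<notin> D \<Longrightarrow> W x \<le> \<beta>"
  shows "AE x in lebesgue. W x = Uc x"
proof -
  have fin: "finite {x. \<not> isCont W x}" using D by (rule finite_subset[rotated])
  obtain V P where V: "\<forall>x. (V has_real_derivative P x) (at x)" "continuous_on UNIV P"
    "\<forall>x. isCont W x \<longrightarrow> (P has_real_derivative V x - W x) (at x)" "\<forall>x. \<bar>P x\<bar> \<le> V x"
    "\<forall>x. 0 < V x" "\<forall>x. g (W x) = V x" "\<forall>x. V (- x) = V x" "\<forall>x. P (- x) = - P x" "(V \<longlongrightarrow> 0) at_top"
    using ground_state_potential[OF W fin] by (elim exE conjE)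
  have Vc: "isCont V x" for x using V(1) DERIV_isCont by blast
  define U where "U = (\<lambda>x. hm (V x))"
  have Uc: "isCont U x" for x unfolding U_def by (rule isCont_o2[OF Vc isCont_hm])
  have UW: "U x = W x" if "x \<notin> D" for x
    using hm_g[of "W x"] low[OF that] ground_state_facts(1)[of x] V(6) by (simp add: U_def less_imp_le)
  have gU: "g (U x) = V x" for x
    by (rule eq_off_finite[OF isCont_o2[OF Uc isCont_g] Vc D(1)]) (use UW V(6) in auto)
  have P': "(P has_real_derivative V x - U x) (at x)" for x
  proof (rule DERIV_removable[OF D(1) open_UNIV])
    show "isCont P x" using V(2) by (simp add: continuous_on_eq_continuous_at)
    show "isCont (\<lambda>x. V x - U x) x" by (intro continuous_intros Vc Uc)
    show "(P has_real_derivative V y - U y) (at y)" if "y \<in> UNIV - D" for y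
      using V(3) D(2) UW[of y] that by auto
  qed simp
  have "U x = local.Uc x" for x
  proof (rule continuous_ground_state_unique[of V P U])
    show "continuous_on UNIV U" using Uc by (simp add: continuous_on_eq_continuous_at)
    show "(U \<longlongrightarrow> 0) at_top" unfolding U_def by (rule hm_tendsto_0[OF V(9)])
    show "P 0 = 0" using spec[OF V(8), of 0] by simp
  qed (use V P' gU hm_range in \<open>auto simp: U_def\<close>)
  then show ?thesis using UW by (intro AE_eq_off_finite[OF D(1)]) auto
qed

text \<open>The potential \<open>V\<close> itself serves as inner and as outer profile, with
  \<open>v0 = V p\<close>, \<open>vs = V 0\<close> and \<open>x0 = p\<close>. What remains is the
  data at the switching points and the exclusion of \<open>v0 = g \<beta>\<close>.\<close>

lemma two_branch_ground_state_eq: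
  assumes p: "0 < p" and D: "{x. \<not> isCont W x} \<subseteq> {- p, p}" and W1: "\<And>x. W x \<le> 1"
    and outW: "\<And>x. p < \<bar>x\<bar> \<Longrightarrow> W x \<le> \<beta>" and inW: "\<And>x. \<bar>x\<bar> < p \<Longrightarrow> \<gamma> \<le> W x"
  shows "\<exists>v0 vs Vp Vm. g \<gamma> \<le> v0 \<and> v0 < g \<beta> \<and> 0 < v0 \<and> family_data g \<beta> \<gamma> v0 vs p Vp Vm \<and>
    (AE x in lebesgue. W x = glue g \<beta> \<gamma> p Vp Vm x)"
proof -
  have fin: "finite {x. \<not> isCont W x}" using D by (rule finite_subset) simp
  obtain V P where V: "\<forall>x. (V has_real_derivative P x) (at x)" "continuous_on UNIV P"
    "\<forall>x. isCont W x \<longrightarrow> (P has_real_derivative V x - W x) (at x)" "\<forall>x. \<bar>P x\<bar> \<le> V x"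
    "\<forall>x. 0 < V x" "\<forall>x. g (W x) = V x" "\<forall>x. V (- x) = V x" "\<forall>x. P (- x) = - P x" "(V \<longlongrightarrow> 0) at_top"
    using ground_state_potential[OF W fin] by (elim exE conjE)
  note V' = V(1)[rule_format] and le = V(4)[rule_format] and Vpos = V(5)[rule_format]
    and gW = V(6)[rule_format] and even = V(7)[rule_format] and odd = V(8)[rule_format]
  have Vc: "isCont V x" for x using V' by (rule DERIV_isCont)
  have Vc': "continuous_on S V" and Pc': "continuous_on S P" for S
    using Vc V(2) by (auto intro: continuous_at_imp_continuous_on continuous_on_subset)
  have P0: "P 0 = 0" using odd[of 0] by simp
  have W_out: "W x = hm (V x)" and V_out': "V x \<in> {0..g \<beta>}" if "p < \<bar>x\<bar>" for x
    using hm_g[of "W x"] g_range_minus[of "W x"] outW[OF that] ground_state_facts(1)[of x] gW[of x]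
    by (auto simp: less_imp_le)
  have W_in: "W x = hp (V x)" and V_in': "V x \<in> {g \<gamma>..1}" if "\<bar>x\<bar> < p" for x
    using hp_g[of "W x"] g_range_plus[of "W x"] inW[OF that] W1[of x] gW[of x] by auto
  \<comment> \<open>\<open>W p\<close> may lie on either branch, so the two bounds come from the
    one-sided limits of \<open>V\<close>.\<close>
  have Vp: "V p \<in> {g \<gamma>..g \<beta>}"
  proof -
    have "(V \<longlongrightarrow> V p) (at_left p)" "(V \<longlongrightarrow> V p) (at_right p)"
      using Vc[of p] by (auto simp: isCont_def intro: tendsto_within_subset)
    moreover have "eventually (\<lambda>x. g \<gamma> \<le> V x) (at_left p)"
      using eventually_at_left_real[OF p] by eventually_elim (use V_in' in auto)
    moreover have "eventually (\<lambda>x. V x \<le> g \<beta>) (at_right p)"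
      using eventually_at_right_less[of p] by eventually_elim (use V_out' p in auto)
    ultimately show ?thesis
      using tendsto_lowerbound[of V "V p" "at_left p"] tendsto_upperbound[of V "V p" "at_right p"] by auto
  qed
  have Vp1: "V p < 1" using Vp g_\<beta>_less \<beta>\<gamma> by simp
  have Vm: "V (- p) = V p" by (rule even)
  have V_out: "V x \<in> {0..g \<beta>}" if "p \<le> \<bar>x\<bar>" for x
  proof (cases "p = \<bar>x\<bar>")
    case True
    then have "x = p \<or> x = - p" by auto
    then show ?thesis using Vp Vm Vpos[of p] by auto
  qed (use V_out' that in auto)
  have V_in: "V x \<in> {g \<gamma>..1}" if "x \<in> {-p..p}" for x
  proof (cases "\<bar>x\<bar> = p")
    case True
    then have "x = p \<or> x = - p" by auto
    then show ?thesis using Vp Vm Vp1 by auto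
  qed (use V_in' that in auto)
  have P_in: "(P has_real_derivative V x - hp (V x)) (at x)" if "- p < x" "x < p" for x
  proof -
    have "isCont W x" using D that by auto
    then show ?thesis using V(3)[rule_format, of x] W_in[of x] that by (simp add: abs_less_iff)
  qed
  have P_out: "(P has_real_derivative V x - hm (V x)) (at x)" if "p < \<bar>x\<bar>" for x
  proof -
    have "x \<notin> {- p, p}" using that p by auto
    then have "isCont W x" using D by blast
    then show ?thesis using V(3)[rule_format, of x] W_out[OF that] by simp
  qed
  have hV: "continuous_on UNIV (\<lambda>x. V x - hp (V x))" "continuous_on UNIV (\<lambda>x. V x - hm (V x))"
    by (intro continuous_intros Vc' continuous_on_compose2[OF continuous_hp] continuous_on_compose2[OF continuous_hm]; simp)+
  have P_in': "(P has_real_derivative V x - hp (V x)) (at x within {-p..p})" if "x \<in> {-p..p}" for x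
    by (rule DERIV_within_Icc_removable[OF Pc' hV(1)]) (use P_in p that in auto)
  \<comment> \<open>At \<open>x = p\<close> and \<open>x = - p\<close> the derivative is one-sided;
    near such a point the outer set coincides with a compact interval ending there.\<close>
  have P_out': "(P has_real_derivative V x - hm (V x)) (at x within {x. p \<le> \<bar>x\<bar>})" if px: "p \<le> \<bar>x\<bar>" for x
  proof -
    consider "p < \<bar>x\<bar>" | "x = p" | "x = - p" using px by linarith
    then show ?thesis
    proof cases
      case 1
      then show ?thesis by (rule has_field_derivative_at_within[OF P_out])
    next
      case 2
      have "(P has_real_derivative V x - hm (V x)) (at x within {p..p + 1})"
        by (rule DERIV_within_Icc_removable[OF Pc' hV(2)]) (use P_out p 2 in auto)
      moreover have "at x within {p..p + 1} = at x within {x. p \<le> \<bar>x\<bar>}"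
        by (rule at_within_nhd[of _ "{0<..<p + 1}"]) (use 2 p in auto)
      ultimately show ?thesis by simp
    next
      case 3
      have "(P has_real_derivative V x - hm (V x)) (at x within {- p - 1..- p})"
        by (rule DERIV_within_Icc_removable[OF Pc' hV(2)]) (use P_out p 3 in auto)
      moreover have "at x within {- p - 1..- p} = at x within {x. p \<le> \<bar>x\<bar>}"
        by (rule at_within_nhd[of _ "{- p - 1<..<0}"]) (use 3 p in auto)
      ultimately show ?thesis by simp
    qed
  qed
  have E_right: "(P x)\<^sup>2 / 2 + Gm (V x) = 0" if "p \<le> x" for x
    by (rule tail_energy[OF V' V(2) P_out V(9) le that]) (use p in auto)
  have E_out: "(P x)\<^sup>2 / 2 + Gm (V x) = 0" if "p \<le> \<bar>x\<bar>" for x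
    using E_right[of x] E_right[of "- x"] even[of x] odd[of x] that by (cases "0 \<le> x") auto
  \<comment> \<open>The inner energy is evaluated at \<open>p\<close>, where zero outer energy gives
    \<open>(P p)\<^sup>2 / 2 = - Gm (V p)\<close>.\<close>
  have E_in: "(P x)\<^sup>2 / 2 + Gp (V x) = energy_at (V p)" if "x \<in> {-p..p}" for x
  proof -
    define e where "e = (\<lambda>x. (P x)\<^sup>2 / 2 + Gp (V x))"
    have const: "e x = e (- p)" if "x \<in> {-p..p}" for x
    proof (rule DERIV_isconst2[of "- p" p])
      show "continuous_on {-p..p} e"
        unfolding e_def by (intro continuous_intros Pc' continuous_on_compose2[OF continuous_on_Gp Vc']) auto
      show "(e has_real_derivative 0) (at y)" if "- p < y" "y < p" for y
        unfolding e_def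
        by (rule energy_deriv[where V = V and P = P and h = hp and G = Gp, OF V' P_in[OF that] Gp_deriv])
    qed (use p that in auto)
    have "e x = e p" using const[OF that] const[of p] p by simp
    then show ?thesis using E_right[of p] by (simp add: e_def energy_at_def)
  qed
  \<comment> \<open>Concavity of \<open>V\<close> and \<open>P 0 = 0\<close> select the negative
    root for the slope at \<open>p\<close>.\<close>
  have P_anti: "P y \<le> P x" if "0 \<le> x" "x \<le> y" "y \<le> p" for x y
  proof (rule DERIV_nonpos_imp_decreasing_open[OF that(2) _ Pc'])
    fix z assume z: "x < z" "z < y"
    have "V z \<le> hp (V z)"
      using hp_greater[of "V z"] hp_g[of 1] V_in[of z] z that \<beta>\<gamma> by (cases "V z = 1") auto
    then show "\<exists>d. (P has_real_derivative d) (at z) \<and> d \<le> 0"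
      using P_in[of z] z that by (intro exI[of _ "V z - hp (V z)"]) auto
  qed
  have Pp: "P p \<le> 0" using P_anti[of 0 p] P0 p by simp
  \<comment> \<open>Otherwise \<open>P p = 0\<close>, and monotonicity of \<open>P\<close> makes it
    vanish on \<open>[0, p]\<close>. Then \<open>V\<close> is constant with \<open>V = hp V\<close>,
    which is impossible below 1.\<close>
  have "V p \<noteq> g \<beta>"
  proof
    assume "V p = g \<beta>"
    then have "P p = 0" using E_right[of p] by simp
    then have Pz: "P x = 0" if "0 \<le> x" "x \<le> p" for x
      using P_anti[of 0 x] P_anti[of x p] P0 that by simp
    have "V p = V (p / 2)"
    proof (rule DERIV_isconst_end[OF _ Vc'])
      show "(V has_real_derivative 0) (at x)" if "p / 2 < x" "x < p" for x
        using V'[of x] Pz[of x] that p by simp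
    qed (use p in simp)
    moreover have "V (p / 2) = hp (V (p / 2))"
    proof -
      have "eventually (\<lambda>y. y \<in> {0<..<p}) (nhds (p / 2))" using p by (intro eventually_nhds_in_open) auto
      then have ev: "eventually (\<lambda>y. P y = 0) (nhds (p / 2))" by eventually_elim (use Pz in auto)
      have "(P has_real_derivative V (p / 2) - hp (V (p / 2))) (at (p / 2))" using p by (intro P_in) auto
      then have "((\<lambda>y. 0) has_real_derivative V (p / 2) - hp (V (p / 2))) (at (p / 2))"
        using DERIV_cong_ev[OF refl ev refl] by blast
      then show ?thesis using DERIV_unique[OF _ DERIV_const] by fastforce
    qed
    ultimately show False using hp_greater[OF Vp1] by simp
  qed
  then have v0: "g \<gamma> \<le> V p" "V p < g \<beta>" "0 < V p" using Vp Vpos[of p] by auto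
  have Pp_eq: "P p = - sqrt (- 2 * Gm (V p))"
  proof -
    have "sqrt (- 2 * Gm (V p)) = - P p"
      using E_right[of p] Pp by (intro real_sqrt_unique) auto
    then show ?thesis by simp
  qed
  have "is_inner (V p) p V P"
    unfolding is_inner_def
    by (intro conjI ballI has_field_derivative_at_within[OF V'] P_in' E_in V_in even P0 refl Pp_eq)
      (use odd[of p] Pp_eq in auto)
  moreover have "outer_profile g \<beta> (V p) p V"
    unfolding outer_profile_def
  proof (intro exI[of _ P] conjI allI impI)
    show "solves_on {x. p \<le> \<bar>x\<bar>} (g_minus_inv g \<beta>) V P"
      unfolding solves_on_def
      by (intro exI[of _ "\<lambda>x. V x - hm (V x)"] ballI conjI has_field_derivative_at_within[OF V'] P_out')
        (simp_all add: g_minus_inv_eq[OF V_out])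
    show "(P x)\<^sup>2 / 2 + G_minus g \<beta> (V x) = 0" if "p \<le> \<bar>x\<bar>" for x
      using E_out[OF that] G_minus_eq[OF V_out[OF that]] by simp
    show "(V \<longlongrightarrow> 0) at_bot" using V(9) even by (simp add: filterlim_at_bot_mirror)
    have "G_minus g \<beta> (V p) = Gm (V p)" using v0 by (intro G_minus_eq) auto
    then show "P p = - sqrt (- 2 * G_minus g \<beta> (V p))" "P (- p) = sqrt (- 2 * G_minus g \<beta> (V p))"
      using Pp_eq odd[of p] by auto
  qed (use V_out even V(9) in auto)
  ultimately have fam: "family_data g \<beta> \<gamma> (V p) (V 0) p V V"
    unfolding family_data_iff[OF v0] using p by blast
  have "W x = glue g \<beta> \<gamma> p V V x" if "x \<notin> {-p, p}" for x
  proof (cases "\<bar>x\<bar> < p")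
    case True
    then show ?thesis using W_in[OF True] g_plus_inv_eq[OF V_in'[OF True]] by (simp add: glue_def)
  next
    case False
    then have "p < \<bar>x\<bar>" using that by auto
    then show ?thesis using W_out g_minus_inv_eq[OF V_out'] False by (simp add: glue_def)
  qed
  then have "AE x in lebesgue. W x = glue g \<beta> \<gamma> p V V x" by (intro AE_eq_off_finite[of "{-p, p}"]) auto
  with v0 fam show ?thesis by blast
qed

end

end

theorem lemma3p5:
  fixes f g :: "real \<Rightarrow> real" and d a \<beta> \<gamma> :: real
  assumes "d > 0"
    and "smooth_on UNIV f"
    and "0 < a" "a < 1"
    and "f 0 = 0" "f a = 0" "f 1 = 0"
    and "\<forall>u\<in>{0<..<a}. f u < 0"
    and "\<forall>u\<in>{a<..<1}. f u > 0"
    and "deriv f 0 < 0" "deriv f 1 < 0" "deriv f a > 0"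
    and "integral {0..1} f > 0"
    and "g = (\<lambda>u. u - f u / d)"
    and "0 < \<beta>" "\<beta> < \<gamma>" "\<gamma> < 1"
    and "\<forall>u\<in>{0..<\<beta>} \<union> {\<gamma><..1}. deriv g u > 0"
    and "\<forall>u\<in>{\<beta><..<\<gamma>}. deriv g u < 0"
    and "deriv g \<beta> = 0" "deriv g \<gamma> = 0"
    and "G_minus g \<beta> (g \<beta>) = 0"
  shows "\<exists>(U :: real \<Rightarrow> real \<Rightarrow> real) (Uc :: real \<Rightarrow> real).
     (\<forall>v0\<in>{g \<gamma>..g \<beta>}. 0 < v0 \<longrightarrow>
        (v0 < g \<beta> \<longrightarrow> (\<exists>vs x0 Vp Vm. family_data g \<beta> \<gamma> v0 vs x0 Vp Vm)) \<and>
        (\<forall>vs x0 Vp Vm. family_data g \<beta> \<gamma> v0 vs x0 Vp Vm \<longrightarrow>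
           U v0 = glue g \<beta> \<gamma> x0 Vp Vm \<and>
           ground_state exp_kernel d f (U v0) \<and>
           {x. jump_at (U v0) x} = {- x0, x0} \<and>
           smooth_on (- {- x0, x0}) (U v0))) \<and>
     ground_state exp_kernel d f Uc \<and>
     smooth_on ({..<0} \<union> {0<..}) Uc \<and> isCont Uc 0 \<and>
     (\<forall>W. ground_state exp_kernel d f W \<and> branch_admissible \<beta> \<gamma> W \<longrightarrow>
        (AE x in lebesgue. W x = Uc x) \<or>
        (\<exists>v0. g \<gamma> \<le> v0 \<and> v0 < g \<beta> \<and> 0 < v0 \<and> (AE x in lebesgue. W x = U v0 x)))"
proof -
  interpret bistable f g d a \<beta> \<gamma>
    by (unfold_locales) (fact assms)+
  \<comment> \<open>By uniqueness of the family data the choice is forced for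
    \<open>v0 < g \<beta>\<close>. At \<open>v0 = g \<beta>\<close> there are no family data, the
    value is arbitrary, and the claims about it hold vacuously.\<close>
  define U where "U = (\<lambda>v0. SOME F. \<exists>vs x0 Vp Vm. family_data g \<beta> \<gamma> v0 vs x0 Vp Vm \<and> F = glue g \<beta> \<gamma> x0 Vp Vm)"
  have U: "U v0 = glue g \<beta> \<gamma> x0 Vp Vm"
    if v0: "g \<gamma> \<le> v0" "v0 < g \<beta>" "0 < v0" and fam: "family_data g \<beta> \<gamma> v0 vs x0 Vp Vm" for v0 vs x0 Vp Vm
    unfolding U_def
  proof (rule some_equality)
    show "F = glue g \<beta> \<gamma> x0 Vp Vm"
      if "\<exists>vs x0 Vp Vm. family_data g \<beta> \<gamma> v0 vs x0 Vp Vm \<and> F = glue g \<beta> \<gamma> x0 Vp Vm" for F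
      using that family_data_unique(2)[OF v0 fam] by blast
  qed (use fam in blast)
  have unique: "(AE x in lebesgue. W x = Uc x) \<or>
      (\<exists>v0. g \<gamma> \<le> v0 \<and> v0 < g \<beta> \<and> 0 < v0 \<and> (AE x in lebesgue. W x = U v0 x))"
    if W: "ground_state exp_kernel d f W" and adm: "branch_admissible \<beta> \<gamma> W" for W
  proof (cases "continuous_on UNIV W")
    case True
    then show ?thesis using continuous_ground_state_eq[OF W] by simp
  next
    case False
    then have range: "range W \<subseteq> {0..\<beta>} \<union> {\<gamma>..1}" and fin: "finite {x. \<not> isCont W x}"
      and card: "card {x. \<not> isCont W x} \<le> 2"
      using adm by (auto simp: branch_admissible_def)
    obtain p where D: "{x. \<not> isCont W x} \<subseteq> {- p, p}"
      and out: "\<And>x. p < \<bar>x\<bar> \<Longrightarrow> W x \<le> \<beta>"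
      and inn: "(\<forall>x. \<bar>x\<bar> < p \<longrightarrow> W x \<le> \<beta>) \<or> 0 < p \<and> (\<forall>x. \<bar>x\<bar> < p \<longrightarrow> \<gamma> \<le> W x)"
      using two_branch_ground_state_cases[OF W range fin card] by blast
    from inn show ?thesis
    proof
      assume low: "\<forall>x. \<bar>x\<bar> < p \<longrightarrow> W x \<le> \<beta>"
      have "W x \<le> \<beta>" if "x \<notin> {- p, p}" for x
        using out[of x] low that by (cases x "0 :: real" rule: linorder_cases; cases "\<bar>x\<bar>" p rule: linorder_cases) auto
      then show ?thesis using one_branch_ground_state_eq[OF W _ D] by blast
    next
      assume "0 < p \<and> (\<forall>x. \<bar>x\<bar> < p \<longrightarrow> \<gamma> \<le> W x)"
      then have p: "0 < p" and high: "\<And>x. \<bar>x\<bar> < p \<Longrightarrow> \<gamma> \<le> W x" by auto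
      have "W x \<le> 1" for x using range \<beta>\<gamma> by (force simp: image_subset_iff)
      then obtain v0 vs Vp Vm where v0: "g \<gamma> \<le> v0" "v0 < g \<beta>" "0 < v0"
        and fam: "family_data g \<beta> \<gamma> v0 vs p Vp Vm" and ae: "AE x in lebesgue. W x = glue g \<beta> \<gamma> p Vp Vm x"
        using two_branch_ground_state_eq[OF W p D _ out high] by blast
      have "AE x in lebesgue. W x = U v0 x" using ae U[OF v0 fam] by simp
      with v0 show ?thesis by blast
    qed
  qed
  show ?thesis
  proof (rule exI[of _ U], rule exI[of _ Uc], intro conjI ballI impI allI)
    fix v0 assume v0: "v0 \<in> {g \<gamma>..g \<beta>}" "0 < v0"
    show "\<exists>vs x0 Vp Vm. family_data g \<beta> \<gamma> v0 vs x0 Vp Vm" if "v0 < g \<beta>"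
      using family_data_exists[of v0] v0 that by auto
    fix vs x0 Vp Vm assume fam: "family_data g \<beta> \<gamma> v0 vs x0 Vp Vm"
    have v0': "g \<gamma> \<le> v0" "v0 < g \<beta>" "0 < v0" using v0 family_data_top_less[OF fam v0] by auto
    show "U v0 = glue g \<beta> \<gamma> x0 Vp Vm" by (rule U[OF v0' fam])
    then show "ground_state exp_kernel d f (U v0)" "{x. jump_at (U v0) x} = {- x0, x0}"
      "smooth_on (- {- x0, x0}) (U v0)"
      using family_ground_state[OF v0' fam] by simp_all
  qed (use Uc_ground_state Uc_smooth isCont_Uc unique in blast)+
qed

end
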